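(* If $R\in\{1,\dots,p\}$ divides $p$, $1\leq s\leq\frac{p}{4R}$ (with $p,s$ natural numbers), and $\gamma\in[0,1)$, then $$\varepsilon^*(p,s,\gamma,R)^2\asymp\psi_1^2,\qquad \psi_1^2:=\begin{cases}(1-\gamma)s\log\left(1+\frac{p}{s^2}\right)&\text{if }s<\sqrt{p},\\(1-\gamma)\sqrt{p}&\text{if }s\geq\sqrt{p}.\end{cases}$$
   Context: Notation: $\|\cdot\|$ is the Euclidean norm; $\|\theta\|_0$ is the number of nonzero coordinates. Let $R$ divide $p$ and let $B_1,\dots,B_R$ be a partition of $[p]=\{1,\dots,p\}$ into $R$ known groups of size $p/R$ each. $\mathbf{1}_{B_k}\in\mathbb{R}^p$ is the indicator vector of $B_k$. For $\theta\in\mathbb{R}^p$, $P_{\theta,\gamma,R}$ denotes the distribution $N\big(\theta,(1-\gamma)I_p+\gamma\sum_{k=1}^R\mathbf{1}_{B_k}\mathbf{1}_{B_k}^\intercal\big)$ of the observation $X$. For $\varepsilon>0$ let $\Theta(p,s,\varepsilon)=\{\theta\in\mathbb{R}^p:\|\theta\|\geq\varepsilon,\ \|\theta\|_0\leq s\}$. The minimax testing risk for $H_0:\theta=0$ against $H_1:\theta\in\Theta(p,s,\varepsilon)$ is $$\mathcal{R}(\varepsilon)=\inf_{\varphi}\Big\{P_{0,\gamma,R}\{\varphi=1\}+\sup_{\theta\in\Theta(p,s,\varepsilon)}P_{\theta,\gamma,R}\{\varphi=0\}\Big\},$$ the infimum being over all measurable $\varphi:\mathbb{R}^p\to\{0,1\}$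 (this does not depend on the choice of the groups, only on $R$). Definition: $\varepsilon^*=\varepsilon^*(p,s,\gamma,R)$ is the minimax separation rate if (i) for every $\eta\in(0,1)$ there is $C_\eta>0$ depending only on $\eta$ such that $C>C_\eta$ implies $\mathcal{R}(C\varepsilon^* )\leq\eta$; and (ii) for every $\eta\in(0,1)$ there is $c_\eta>0$ depending only on $\eta$ such that $0<c<c_\eta$ implies $\mathcal{R}(c\varepsilon^* )\geq1-\eta$. The constants do not depend on $(p,s,\gamma,R)$. The rate is unique only up to multiplication by universal constants, and $a\asymp b$ means equality up to universal positive multiplicative constants; thus $(\varepsilon^* )^2\asymp\psi^2$ means that $\psi$ satisfies (i) and (ii) in place of $\varepsilon^*$. *)

theory Defs
  imports
    "HOL-Probability.Probability"
    "Jordan_Normal_Form.Determinant"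
    "Jordan_Normal_Form.Gauss_Jordan_Elimination"
begin

text \<open>
  All constants in the separation rate are uniform in the dimension \<open>p\<close>, so \<open>p\<close> cannot be encoded
  in a type. Vectors of \<open>\<real>\<^sup>p\<close> are extensional functions on the index set \<open>{..<p}\<close> (a shift of
  \<open>{1..p}\<close>); similarly, groups are indexed by \<open>{..<R}\<close>.
\<close>

definition Rn :: "nat \<Rightarrow> (nat \<Rightarrow> real) set" where
  "Rn p = ({..<p} \<rightarrow>\<^sub>E UNIV)"

text \<open>
  The normal distribution \<open>N(\<mu>, \<Sigma>)\<close> on \<open>\<real>\<^sup>p\<close> for a positive definite covariance matrix \<open>\<Sigma>\<close>.
  For singular \<open>\<Sigma>\<close> the definition carries no meaning.
\<close>

definition mvn_density :: "nat \<Rightarrow> (nat \<Rightarrow> real) \<Rightarrow> real mat \<Rightarrow> (nat \<Rightarrow> real) \<Rightarrow> real" where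
  "mvn_density p \<mu> \<Sigma> x =
     (let v = Matrix.vec p (\<lambda>i. x i - \<mu> i)
      in exp (- scalar_prod v (mult_mat_vec (the (mat_inverse \<Sigma>)) v) / 2)
           / sqrt ((2 * pi) ^ p * Determinant.det \<Sigma>))"

definition mvn :: "nat \<Rightarrow> (nat \<Rightarrow> real) \<Rightarrow> real mat \<Rightarrow> (nat \<Rightarrow> real) measure" where
  "mvn p \<mu> \<Sigma> =
     density (Pi\<^sub>M {..<p} (\<lambda>_. lborel)) (\<lambda>x. ennreal (mvn_density p \<mu> \<Sigma> x))"

definition equal_groups :: "nat \<Rightarrow> nat \<Rightarrow> (nat \<Rightarrow> nat set) \<Rightarrow> bool" where
  "equal_groups p R B \<longleftrightarrow>
     (\<Union>k<R. B k) = {..<p} \<and> disjoint_family_on B {..<R} \<and> (\<forall>k<R. card (B k) = p div R)"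

text \<open>
  The matrix \<open>(1 - \<gamma>) I + \<gamma> \<Sum>\<^sub>k 1\<^sub>B\<^sub>k 1\<^sub>B\<^sub>k\<^sup>T\<close>. For \<open>0 \<le> \<gamma> < 1\<close> it is positive definite.
\<close>

definition group_cov :: "nat \<Rightarrow> real \<Rightarrow> nat \<Rightarrow> (nat \<Rightarrow> nat set) \<Rightarrow> real mat" where
  "group_cov p \<gamma> R B =
     Matrix.mat p p (\<lambda>(i, j). (1 - \<gamma>) * (if i = j then 1 else 0)
                      + \<gamma> * (\<Sum>k<R. indicator (B k) i * indicator (B k) j))"

definition P_law :: "nat \<Rightarrow> real \<Rightarrow> nat \<Rightarrow> (nat \<Rightarrow> nat set) \<Rightarrow> (nat \<Rightarrow> real) \<Rightarrow> (nat \<Rightarrow> real) measure"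
  where "P_law p \<gamma> R B \<theta> = mvn p \<theta> (group_cov p \<gamma> R B)"

definition sparse_alt :: "nat \<Rightarrow> nat \<Rightarrow> real \<Rightarrow> (nat \<Rightarrow> real) set" where
  "sparse_alt p s \<epsilon> =
     {\<theta> \<in> Rn p. L2_set \<theta> {..<p} \<ge> \<epsilon> \<and> card {i \<in> {..<p}. \<theta> i \<noteq> 0} \<le> s}"

definition tests :: "nat \<Rightarrow> ((nat \<Rightarrow> real) \<Rightarrow> nat) set" where
  "tests p = Pi\<^sub>M {..<p} (\<lambda>_. borel) \<rightarrow>\<^sub>M count_space {0, 1}"

text \<open>
  The infimum and supremum are taken in the conditionally complete lattice \<open>\<real>\<close>. All values involved
  are probabilities, and \<open>sparse_alt p s \<epsilon>\<close> is nonempty whenever \<open>p, s \<ge> 1\<close>.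
\<close>

definition testing_risk :: "nat \<Rightarrow> nat \<Rightarrow> real \<Rightarrow> nat \<Rightarrow> (nat \<Rightarrow> nat set) \<Rightarrow> real \<Rightarrow> real" where
  "testing_risk p s \<gamma> R B \<epsilon> =
     (INF \<phi>\<in>tests p.
        \<P>(x in P_law p \<gamma> R B (\<lambda>i\<in>{..<p}. 0). \<phi> x = 1)
        + (SUP \<theta>\<in>sparse_alt p s \<epsilon>. \<P>(x in P_law p \<gamma> R B \<theta>. \<phi> x = 0)))"

text \<open>
  \<open>D\<close> is the range of the parameters \<open>(p, s, \<gamma>, R)\<close>. The constants are chosen before the parameters
  and the groups, hence depend on \<open>\<eta>\<close> only. As the separation rate is unique only up to
  universal constants, \<open>(\<epsilon>*)\<^sup>2 \<asymp> \<psi>\<^sup>2\<close> means that \<open>\<psi>\<close> satisfies this predicate.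
\<close>

definition minimax_separation_rate ::
  "(nat \<Rightarrow> nat \<Rightarrow> real \<Rightarrow> nat \<Rightarrow> bool) \<Rightarrow> (nat \<Rightarrow> nat \<Rightarrow> real \<Rightarrow> nat \<Rightarrow> real) \<Rightarrow> bool" where
  "minimax_separation_rate D \<psi> \<longleftrightarrow>
     (\<forall>\<eta>\<in>{0<..<1}. \<exists>C\<^sub>\<eta>>0. \<forall>p s \<gamma> R B. D p s \<gamma> R \<longrightarrow> equal_groups p R B \<longrightarrow>
        (\<forall>C>C\<^sub>\<eta>. testing_risk p s \<gamma> R B (C * \<psi> p s \<gamma> R) \<le> \<eta>)) \<and>
     (\<forall>\<eta>\<in>{0<..<1}. \<exists>c\<^sub>\<eta>>0. \<forall>p s \<gamma> R B. D p s \<gamma> R \<longrightarrow> equal_groups p R B \<longrightarrow>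
        (\<forall>c. 0 < c \<and> c < c\<^sub>\<eta> \<longrightarrow> testing_risk p s \<gamma> R B (c * \<psi> p s \<gamma> R) \<ge> 1 - \<eta>))"

definition psi1_sq :: "nat \<Rightarrow> nat \<Rightarrow> real \<Rightarrow> real" where
  "psi1_sq p s \<gamma> =
     (if real s < sqrt (real p)
      then (1 - \<gamma>) * real s * ln (1 + real p / (real s)\<^sup>2)
      else (1 - \<gamma>) * sqrt (real p))"

end

theory Submission
  imports Defs
begin

text \<open>
  The group effects are removed by conditioning, and both halves of the rate are then statements about
  independent Gaussian coordinates.

  Completing the square in one variable per group shows that the density of the observation is
  the density of \<open>\<theta> i + sqrt \<gamma> * w (g i) + sqrt (1 - \<gamma>) * z i\<close>, where \<open>g i\<close> is the group of \<open>i\<close> and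
  \<open>w\<close>, \<open>z\<close> are independent standard Gaussian vectors (\<open>mvn_density_cov\<close>, \<open>measure_mvn_cov\<close>); this needs the
  determinant and the inverse of the covariance matrix, which are explicit. So every error
  probability is an average over \<open>w\<close> of error probabilities in the model with independent noise
  of variance \<open>1 - \<gamma>\<close> and mean shifted by a constant on each group.

  Lower bound. A fixed \<open>w\<close> only relocates the test, so the independent model suffices.
  Let \<open>n\<close> be the minimum of \<open>s\<close> and the integer part of \<open>sqrt p\<close>. The prior splits the first
  \<open>n * q\<close> coordinates into \<open>n\<close> blocks of size \<open>q = p div n\<close> and puts the same value \<open>\<rho>\<close>, in units of
  \<open>sqrt (1 - \<gamma>)\<close>, at one uniformly chosen position of each block. The second moment of the likelihood ratio is exactly
  \<open>(1 + (exp (\<rho>\<^sup>2) - 1) / q) ^ n\<close> by independence of the blocks (\<open>sum_exp_overlap\<close>), which is close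
  to \<open>1\<close> when \<open>\<rho>\<^sup>2\<close> is a small multiple of \<open>ln (1 + p / n\<^sup>2)\<close> (\<open>overlap_bound\<close>). For \<open>s \<ge> sqrt p\<close>
  this prior with \<open>n\<close> nonzero entries already gives the order \<open>sqrt p\<close>.

  Upper bound. The statistic is the sum over all coordinates of \<open>max (r\<^sup>2 - \<tau>) 0\<close>, where \<open>r\<close> is the
  coordinate minus its group mean, after division by \<open>sqrt (1 - \<gamma>)\<close>. It does not change when a
  constant is added on a group, so \<open>w\<close> disappears (\<open>prob_stat_test\<close>). The threshold \<open>\<tau>\<close> is a multiple of
  \<open>ln (1 + p / s\<^sup>2)\<close> for \<open>s < sqrt p\<close> and \<open>0\<close> otherwise. Three facts make Chebyshev's inequality enough.
  As the summands are convex and even in \<open>r\<close>, null coordinates cannot decrease the mean, even though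
  centring moves them, while a coordinate of centred mean \<open>\<mu>\<close> raises it by at least \<open>\<mu>\<^sup>2 - \<tau>\<close>
  (\<open>stat_mean_gap\<close>). As at most a quarter of each group is nonzero, centring keeps half of the
  energy on the support (\<open>resid_energy\<close>). The residuals within a group are dependent, but the
  Efron-Stein inequality (\<open>efron_stein\<close>) needs only the independence of the coordinates of \<open>z\<close>:
  replacing one coordinate moves its own residual by \<open>O(1)\<close> and the \<open>m\<close> residuals of its group by \<open>O(1 / m)\<close>, so that the variance is at
  most a constant times \<open>(\<Sum>i. \<mu>\<^sub>i\<^sup>2) + p * exp (- \<tau> / 512)\<close> (\<open>stat_moments\<close>).
\<close>

section \<open>The Efron-Stein inequality\<close>

text \<open>
  The case of two factors. Working with nonnegative integrals of squared differences avoids every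
  integrability assumption.
\<close>

lemma efron_stein_pair:
  fixes F :: "'a \<Rightarrow> 'b \<Rightarrow> real"
  assumes P: "prob_space P" and Q: "prob_space Q"
    and F [measurable]: "(\<lambda>(x, a). F x a) \<in> borel_measurable (P \<Otimes>\<^sub>M Q)"
  shows "(\<integral>\<^sup>+x. \<integral>\<^sup>+a. \<integral>\<^sup>+y. \<integral>\<^sup>+b. ennreal ((F x a - F y b)\<^sup>2) \<partial>Q \<partial>P \<partial>Q \<partial>P)
    \<le> (\<integral>\<^sup>+a. \<integral>\<^sup>+x. \<integral>\<^sup>+y. ennreal ((F x a - F y a)\<^sup>2) \<partial>P \<partial>P \<partial>Q)
      + (\<integral>\<^sup>+x. \<integral>\<^sup>+a. \<integral>\<^sup>+b. ennreal ((F x a - F x b)\<^sup>2) \<partial>Q \<partial>Q \<partial>P)"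
    (is "?L \<le> ?A + ?B")
proof -
  interpret P: prob_space P by fact
  interpret Q: prob_space Q by fact
  interpret PQ: pair_sigma_finite P Q by standard
  interpret QQ: pair_sigma_finite Q Q by standard
  define D where "D x a y b = ennreal ((F x a - F y b)\<^sup>2)" for x a y b
  have D [measurable]: "(\<lambda>z. D (f z) (g z) (h z) (k z)) \<in> borel_measurable M"
    if [measurable]: "f \<in> M \<rightarrow>\<^sub>M P" "h \<in> M \<rightarrow>\<^sub>M P" "g \<in> M \<rightarrow>\<^sub>M Q" "k \<in> M \<rightarrow>\<^sub>M Q"
    for M :: "'c measure" and f g h k
    unfolding D_def by measurable
  define I where "I H = (\<integral>\<^sup>+x. \<integral>\<^sup>+y. \<integral>\<^sup>+a. \<integral>\<^sup>+b. H x y a b \<partial>Q \<partial>Q \<partial>P \<partial>P)"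
    for H :: "'a \<Rightarrow> 'a \<Rightarrow> 'b \<Rightarrow> 'b \<Rightarrow> ennreal"
  have L: "I (\<lambda>x y a b. D x a y b) = ?L"
    unfolding I_def D_def[symmetric]
    by (intro nn_integral_cong PQ.Fubini'[symmetric]) measurable
  have L': "I (\<lambda>x y a b. D x b y a) = ?L"
    unfolding L[symmetric] unfolding I_def
    by (intro nn_integral_cong QQ.Fubini') measurable
  have A': "I (\<lambda>x y a b. D x a y a) = ?A"
  proof -
    have "I (\<lambda>x y a b. D x a y a) = (\<integral>\<^sup>+x. \<integral>\<^sup>+y. \<integral>\<^sup>+a. D x a y a \<partial>Q \<partial>P \<partial>P)"
      by (simp add: I_def Q.emeasure_space_1)
    also have "\<dots> = (\<integral>\<^sup>+x. \<integral>\<^sup>+a. \<integral>\<^sup>+y. D x a y a \<partial>P \<partial>Q \<partial>P)"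
      by (intro nn_integral_cong PQ.Fubini'[symmetric]) measurable
    also have "\<dots> = (\<integral>\<^sup>+a. \<integral>\<^sup>+x. \<integral>\<^sup>+y. D x a y a \<partial>P \<partial>P \<partial>Q)"
      by (intro PQ.Fubini'[symmetric]) measurable
    finally show ?thesis by (simp add: D_def)
  qed
  have A'': "I (\<lambda>x y a b. D x b y b) = ?A"
    unfolding A'[symmetric] unfolding I_def
    by (intro nn_integral_cong QQ.Fubini') measurable
  have B': "I (\<lambda>x y a b. D x a x b) = ?B"
    by (simp add: I_def P.emeasure_space_1 D_def)
  have B'': "I (\<lambda>x y a b. D y a y b) = ?B"
    by (simp add: I_def P.emeasure_space_1 D_def)
  have I_add: "I (\<lambda>x y a b. H x y a b + K x y a b) = I H + I K"
    if H [measurable]: "(\<lambda>z. H (fst (fst (fst z))) (snd (fst (fst z))) (snd (fst z)) (snd z)) \<in> borel_measurable (((P \<Otimes>\<^sub>M P) \<Otimes>\<^sub>M Q) \<Otimes>\<^sub>M Q)"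
      and K [measurable]: "(\<lambda>z. K (fst (fst (fst z))) (snd (fst (fst z))) (snd (fst z)) (snd z)) \<in> borel_measurable (((P \<Otimes>\<^sub>M P) \<Otimes>\<^sub>M Q) \<Otimes>\<^sub>M Q)"
    for H K
  proof -
    have H1 [measurable]: "(\<lambda>z. H (f z) (h z) (g z) (k z)) \<in> borel_measurable M"
      if [measurable]: "f \<in> M \<rightarrow>\<^sub>M P" "h \<in> M \<rightarrow>\<^sub>M P" "g \<in> M \<rightarrow>\<^sub>M Q" "k \<in> M \<rightarrow>\<^sub>M Q"
      for M :: "'c measure" and f g h k
      using measurable_compose[OF _ H, of "\<lambda>z. (((f z, h z), g z), k z)" M] by simp
    have K1 [measurable]: "(\<lambda>z. K (f z) (h z) (g z) (k z)) \<in> borel_measurable M"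
      if [measurable]: "f \<in> M \<rightarrow>\<^sub>M P" "h \<in> M \<rightarrow>\<^sub>M P" "g \<in> M \<rightarrow>\<^sub>M Q" "k \<in> M \<rightarrow>\<^sub>M Q"
      for M :: "'c measure" and f g h k
      using measurable_compose[OF _ K, of "\<lambda>z. (((f z, h z), g z), k z)" M] by simp
    have "I (\<lambda>x y a b. H x y a b + K x y a b)
      = (\<integral>\<^sup>+x. \<integral>\<^sup>+y. \<integral>\<^sup>+a. (\<integral>\<^sup>+b. H x y a b \<partial>Q) + (\<integral>\<^sup>+b. K x y a b \<partial>Q) \<partial>Q \<partial>P \<partial>P)"
      unfolding I_def by (intro nn_integral_cong nn_integral_add) measurable
    also have "\<dots> = (\<integral>\<^sup>+x. \<integral>\<^sup>+y. (\<integral>\<^sup>+a. \<integral>\<^sup>+b. H x y a b \<partial>Q \<partial>Q) + (\<integral>\<^sup>+a. \<integral>\<^sup>+b. K x y a b \<partial>Q \<partial>Q) \<partial>P \<partial>P)"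
      by (intro nn_integral_cong nn_integral_add) measurable
    also have "\<dots> = (\<integral>\<^sup>+x. (\<integral>\<^sup>+y. \<integral>\<^sup>+a. \<integral>\<^sup>+b. H x y a b \<partial>Q \<partial>Q \<partial>P)
                     + (\<integral>\<^sup>+y. \<integral>\<^sup>+a. \<integral>\<^sup>+b. K x y a b \<partial>Q \<partial>Q \<partial>P) \<partial>P)"
      by (intro nn_integral_cong nn_integral_add) measurable
    also have "\<dots> = I H + I K"
      unfolding I_def by (intro nn_integral_add) measurable
    finally show ?thesis .
  qed
  \<comment> \<open>Among four points the two diagonals have at most the sum of squares of the four sides.\<close>
  have quad: "D x a y b + D x b y a \<le> (D x a y a + D x b y b) + (D x a x b + D y a y b)" for x y a b
  proof -
    have "(F x a - F y b)\<^sup>2 + (F x b - F y a)\<^sup>2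
      \<le> ((F x a - F y a)\<^sup>2 + (F x b - F y b)\<^sup>2) + ((F x a - F x b)\<^sup>2 + (F y a - F y b)\<^sup>2)"
      using zero_le_power2[of "F x a - F y a - F x b + F y b"]
      by (simp add: power2_eq_square algebra_simps)
    then show ?thesis
      unfolding D_def by (simp add: ennreal_plus[symmetric] ennreal_leI del: ennreal_plus)
  qed
  have "I (\<lambda>x y a b. D x a y b) + I (\<lambda>x y a b. D x b y a) = I (\<lambda>x y a b. D x a y b + D x b y a)"
    by (intro I_add[symmetric]; measurable)
  also have "\<dots> \<le> I (\<lambda>x y a b. (D x a y a + D x b y b) + (D x a x b + D y a y b))"
    unfolding I_def by (intro nn_integral_mono quad)
  also have "\<dots> = I (\<lambda>x y a b. D x a y a + D x b y b) + I (\<lambda>x y a b. D x a x b + D y a y b)"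
    by (intro I_add; measurable)
  also have "I (\<lambda>x y a b. D x a y a + D x b y b)
      = I (\<lambda>x y a b. D x a y a) + I (\<lambda>x y a b. D x b y b)"
    by (intro I_add; measurable)
  also have "I (\<lambda>x y a b. D x a x b + D y a y b)
      = I (\<lambda>x y a b. D x a x b) + I (\<lambda>x y a b. D y a y b)"
    by (intro I_add; measurable)
  finally have "2 * ?L \<le> 2 * (?A + ?B)"
    unfolding L L' A' A'' B' B'' by (simp add: mult_2 algebra_simps)
  then show ?thesis
    by (subst (asm) ennreal_mult_le_mult_iff) auto
qed

text \<open>
  For independent copies \<open>x\<close>, \<open>y\<close> the left-hand side is twice the variance of \<open>f\<close>.
\<close>

lemma efron_stein:
  fixes M :: "'i \<Rightarrow> 'a measure" and f :: "('i \<Rightarrow> 'a) \<Rightarrow> real"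
  assumes M: "\<And>i. prob_space (M i)" and "finite I" and "f \<in> borel_measurable (Pi\<^sub>M I M)"
  shows "(\<integral>\<^sup>+x. \<integral>\<^sup>+y. ennreal ((f x - f y)\<^sup>2) \<partial>Pi\<^sub>M I M \<partial>Pi\<^sub>M I M)
    \<le> (\<Sum>j\<in>I. \<integral>\<^sup>+x. \<integral>\<^sup>+z. ennreal ((f x - f (x(j := z)))\<^sup>2) \<partial>M j \<partial>Pi\<^sub>M I M)"
  using assms(2,3)
proof (induction I arbitrary: f rule: finite_induct)
  case empty
  interpret product_sigma_finite M
    by (simp add: product_sigma_finite_def prob_space_imp_sigma_finite M)
  show ?case by (simp add: nn_integral_empty)
next
  case (insert i I)
  note [measurable] = insert.prems and [simp] = insert.hyps
  let ?P = "Pi\<^sub>M I M" and ?Q = "M i" and ?N = "Pi\<^sub>M (insert i I) M"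
  interpret product_sigma_finite M
    by (simp add: product_sigma_finite_def prob_space_imp_sigma_finite M)
  interpret P: prob_space ?P by (rule prob_space_PiM) (rule M)
  interpret Q: prob_space ?Q by (rule M)
  interpret N: prob_space ?N by (rule prob_space_PiM) (rule M)
  interpret QP: pair_sigma_finite ?Q ?P by standard
  interpret PQ: pair_sigma_finite ?P ?Q by standard
  define F where "F x a = f (x(i := a))" for x a
  have [measurable]: "(\<lambda>(x, a). F x a) \<in> borel_measurable (?P \<Otimes>\<^sub>M ?Q)"
    unfolding F_def by measurable
  have F1 [measurable]: "(\<lambda>z. F (u z) (v z)) \<in> borel_measurable K"
    if [measurable]: "u \<in> K \<rightarrow>\<^sub>M ?P" "v \<in> K \<rightarrow>\<^sub>M ?Q" for K :: "'c measure" and u v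
    by measurable
  \<comment> \<open>In contrast to \<open>measurable_fun_upd\<close>, the updated index already belongs to the index set.\<close>
  have upd [measurable]: "(\<lambda>w. (u w)(j := v w)) \<in> K \<rightarrow>\<^sub>M Pi\<^sub>M J M"
    if "u \<in> K \<rightarrow>\<^sub>M Pi\<^sub>M J M" "v \<in> K \<rightarrow>\<^sub>M M j" "j \<in> J" for K :: "'c measure" and u v j J
    using that by (intro measurable_fun_upd[where J=J]) auto
  have "(\<integral>\<^sup>+x. \<integral>\<^sup>+y. ennreal ((f x - f y)\<^sup>2) \<partial>?N \<partial>?N)
      = (\<integral>\<^sup>+x. \<integral>\<^sup>+a. (\<integral>\<^sup>+y. ennreal ((F x a - f y)\<^sup>2) \<partial>?N) \<partial>?Q \<partial>?P)"
    by (subst product_nn_integral_insert) (simp_all add: F_def)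
  also have "\<dots> = (\<integral>\<^sup>+x. \<integral>\<^sup>+a. \<integral>\<^sup>+y. \<integral>\<^sup>+b. ennreal ((F x a - F y b)\<^sup>2) \<partial>?Q \<partial>?P \<partial>?Q \<partial>?P)"
    by (subst product_nn_integral_insert) (simp_all add: F_def)
  also have "\<dots> \<le> (\<integral>\<^sup>+a. \<integral>\<^sup>+x. \<integral>\<^sup>+y. ennreal ((F x a - F y a)\<^sup>2) \<partial>?P \<partial>?P \<partial>?Q)
      + (\<integral>\<^sup>+x. \<integral>\<^sup>+a. \<integral>\<^sup>+b. ennreal ((F x a - F x b)\<^sup>2) \<partial>?Q \<partial>?Q \<partial>?P)"
    by (rule efron_stein_pair) (unfold_locales, measurable)
  also have "\<dots> \<le> (\<integral>\<^sup>+a. (\<Sum>j\<in>I. \<integral>\<^sup>+x. \<integral>\<^sup>+z. ennreal ((F x a - F (x(j := z)) a)\<^sup>2) \<partial>M j \<partial>?P) \<partial>?Q)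
      + (\<integral>\<^sup>+x. \<integral>\<^sup>+a. \<integral>\<^sup>+b. ennreal ((F x a - F x b)\<^sup>2) \<partial>?Q \<partial>?Q \<partial>?P)"
  proof (intro add_right_mono nn_integral_mono)
    fix a assume [measurable]: "a \<in> space ?Q"
    show "(\<integral>\<^sup>+x. \<integral>\<^sup>+y. ennreal ((F x a - F y a)\<^sup>2) \<partial>?P \<partial>?P)
      \<le> (\<Sum>j\<in>I. \<integral>\<^sup>+x. \<integral>\<^sup>+z. ennreal ((F x a - F (x(j := z)) a)\<^sup>2) \<partial>M j \<partial>?P)"
      by (rule insert.IH) measurable
  qed
  also have "\<dots> = (\<Sum>j\<in>I. \<integral>\<^sup>+a. \<integral>\<^sup>+x. \<integral>\<^sup>+z. ennreal ((F x a - F (x(j := z)) a)\<^sup>2) \<partial>M j \<partial>?P \<partial>?Q)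
      + (\<integral>\<^sup>+x. \<integral>\<^sup>+a. \<integral>\<^sup>+b. ennreal ((F x a - F x b)\<^sup>2) \<partial>?Q \<partial>?Q \<partial>?P)"
    by (subst nn_integral_sum) measurable
  also have "\<dots> = (\<Sum>j\<in>I. \<integral>\<^sup>+x. \<integral>\<^sup>+a. \<integral>\<^sup>+z. ennreal ((F x a - F (x(j := z)) a)\<^sup>2) \<partial>M j \<partial>?Q \<partial>?P)
      + (\<integral>\<^sup>+x. \<integral>\<^sup>+a. \<integral>\<^sup>+b. ennreal ((F x a - F x b)\<^sup>2) \<partial>?Q \<partial>?Q \<partial>?P)"
    by (intro arg_cong2[where f="(+)"] sum.cong PQ.Fubini' refl) measurable
  also have "(\<Sum>j\<in>I. \<integral>\<^sup>+x. \<integral>\<^sup>+a. \<integral>\<^sup>+z. ennreal ((F x a - F (x(j := z)) a)\<^sup>2) \<partial>M j \<partial>?Q \<partial>?P)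
      = (\<Sum>j\<in>I. \<integral>\<^sup>+x. \<integral>\<^sup>+z. ennreal ((f x - f (x(j := z)))\<^sup>2) \<partial>M j \<partial>?N)"
  proof (intro sum.cong refl)
    fix j assume j: "j \<in> I"
    then have [simp]: "j \<noteq> i" using insert.hyps by auto
    show "(\<integral>\<^sup>+x. \<integral>\<^sup>+a. \<integral>\<^sup>+z. ennreal ((F x a - F (x(j := z)) a)\<^sup>2) \<partial>M j \<partial>?Q \<partial>?P)
      = (\<integral>\<^sup>+x. \<integral>\<^sup>+z. ennreal ((f x - f (x(j := z)))\<^sup>2) \<partial>M j \<partial>?N)"
      using j by (subst product_nn_integral_insert) (auto simp: F_def fun_upd_twist[of j i])
  qed
  also have "(\<integral>\<^sup>+x. \<integral>\<^sup>+a. \<integral>\<^sup>+b. ennreal ((F x a - F x b)\<^sup>2) \<partial>?Q \<partial>?Q \<partial>?P)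
      = (\<integral>\<^sup>+x. \<integral>\<^sup>+z. ennreal ((f x - f (x(i := z)))\<^sup>2) \<partial>?Q \<partial>?N)"
    by (subst product_nn_integral_insert) (auto simp: F_def)
  finally show ?case
    unfolding sum.insert[OF insert.hyps] by (subst add.commute)
qed

text \<open>
  Finiteness of the pairwise bound also yields integrability. The sharp bound on the variance is
  \<open>V / 2\<close>; the factor is irrelevant here.
\<close>

lemma (in prob_space) variance_le_of_pairwise:
  fixes f :: "'a \<Rightarrow> real"
  assumes f [measurable]: "f \<in> borel_measurable M" and V0: "V \<ge> 0"
    and V: "(\<integral>\<^sup>+x. \<integral>\<^sup>+y. ennreal ((f x - f y)\<^sup>2) \<partial>M \<partial>M) \<le> ennreal V"
  shows "integrable M f" and "integrable M (\<lambda>x. (f x)\<^sup>2)" and "variance f \<le> V"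
proof -
  have "(\<integral>\<^sup>+x. \<integral>\<^sup>+y. ennreal ((f x - f y)\<^sup>2) \<partial>M \<partial>M) \<noteq> \<infinity>"
    using V by (auto simp: top_unique)
  then have "AE x in M. (\<integral>\<^sup>+y. ennreal ((f x - f y)\<^sup>2) \<partial>M) \<noteq> \<infinity>"
    by (intro nn_integral_PInf_AE) measurable
  \<comment> \<open>Almost every value \<open>c\<close> of \<open>f\<close> is at finite quadratic mean distance from \<open>f\<close>.\<close>
  then obtain c where c: "(\<integral>\<^sup>+y. ennreal ((c - f y)\<^sup>2) \<partial>M) \<noteq> \<infinity>"
    using eventually_happens[of _ "ae_filter M"] ae_filter_eq_bot_iff emeasure_space_1 by fastforce
  then have sq: "integrable M (\<lambda>y. (c - f y)\<^sup>2)"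
    by (intro integrableI_nonneg) (auto simp: top.not_eq_extremum)
  then have "integrable M (\<lambda>y. c - f y)"
    by (rule square_integrable_imp_integrable[rotated]) measurable
  then have "integrable M (\<lambda>y. c - (c - f y))"
    by (rule Bochner_Integration.integrable_diff[rotated]) simp
  then show int: "integrable M f" by simp
  have "integrable M (\<lambda>y. (c - f y)\<^sup>2 + 2 * c * f y - c\<^sup>2)"
    using int sq by simp
  moreover have "(\<lambda>y. (c - f y)\<^sup>2 + 2 * c * f y - c\<^sup>2) = (\<lambda>y. (f y)\<^sup>2)"
    by (auto simp: power2_eq_square algebra_simps)
  ultimately show int2: "integrable M (\<lambda>x. (f x)\<^sup>2)" by simp
  have "ennreal (variance f) \<le> (\<integral>\<^sup>+y. ennreal ((f x - f y)\<^sup>2) \<partial>M)" for x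
  proof -
    have eq: "(\<lambda>y. (f x - f y)\<^sup>2) = (\<lambda>y. (f x)\<^sup>2 - 2 * f x * f y + (f y)\<^sup>2)"
      by (auto simp: power2_eq_square algebra_simps)
    have "expectation (\<lambda>y. (f x - f y)\<^sup>2) = (f x)\<^sup>2 - 2 * f x * expectation f + expectation (\<lambda>y. (f y)\<^sup>2)"
      unfolding eq using int int2 by (simp add: prob_space)
    moreover have "variance f = expectation (\<lambda>y. (f y)\<^sup>2) - (expectation f)\<^sup>2"
      by (rule variance_eq[OF int int2])
    moreover have "(f x)\<^sup>2 - 2 * f x * expectation f + (expectation f)\<^sup>2 \<ge> 0"
      using zero_le_power2[of "f x - expectation f"] by (simp add: power2_eq_square algebra_simps)
    ultimately have "variance f \<le> expectation (\<lambda>y. (f x - f y)\<^sup>2)" by simp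
    moreover have "(\<integral>\<^sup>+y. ennreal ((f x - f y)\<^sup>2) \<partial>M) = ennreal (expectation (\<lambda>y. (f x - f y)\<^sup>2))"
    proof (rule nn_integral_eq_integral)
      show "integrable M (\<lambda>y. (f x - f y)\<^sup>2)" unfolding eq using int int2 by simp
    qed simp
    ultimately show ?thesis by (simp add: ennreal_leI)
  qed
  then have "(\<integral>\<^sup>+x. ennreal (variance f) \<partial>M) \<le> (\<integral>\<^sup>+x. \<integral>\<^sup>+y. ennreal ((f x - f y)\<^sup>2) \<partial>M \<partial>M)"
    by (intro nn_integral_mono)
  also note V
  finally show "variance f \<le> V" using V0 by (simp add: emeasure_space_1 ennreal_le_iff)
qed

section \<open>Densities and images of product measures\<close>

lemma PiM_density:
  fixes f :: "'i \<Rightarrow> 'a \<Rightarrow> ennreal"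
  assumes I: "finite I" and M: "\<And>i. sigma_finite_measure (M i)"
    and f [measurable]: "\<And>i. f i \<in> borel_measurable (M i)"
    and fM: "\<And>i. sigma_finite_measure (density (M i) (f i))"
  shows "Pi\<^sub>M I (\<lambda>i. density (M i) (f i)) = density (Pi\<^sub>M I M) (\<lambda>x. \<Prod>i\<in>I. f i (x i))"
proof -
  interpret M: product_sigma_finite M by (simp add: product_sigma_finite_def M)
  interpret D: product_sigma_finite "\<lambda>i. density (M i) (f i)" by (simp add: product_sigma_finite_def fM)
  have [measurable]: "(\<lambda>x. \<Prod>i\<in>I. f i (x i)) \<in> borel_measurable (Pi\<^sub>M I M)"
    by (intro borel_measurable_prod_ennreal) measurable
  show ?thesis
  proof (rule D.PiM_eqI[symmetric, OF I])
    show "sets (density (Pi\<^sub>M I M) (\<lambda>x. \<Prod>i\<in>I. f i (x i))) = sets (Pi\<^sub>M I (\<lambda>i. density (M i) (f i)))"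
      unfolding sets_density by (intro sets_PiM_cong) auto
    fix A assume A: "\<And>i. i \<in> I \<Longrightarrow> A i \<in> sets (density (M i) (f i))"
    then have [measurable]: "\<And>i. i \<in> I \<Longrightarrow> A i \<in> sets (M i)" by simp
    then have "Pi\<^sub>E I A \<in> sets (Pi\<^sub>M I M)" using I by (intro sets_PiM_I_finite) auto
    then have "emeasure (density (Pi\<^sub>M I M) (\<lambda>x. \<Prod>i\<in>I. f i (x i))) (Pi\<^sub>E I A)
      = (\<integral>\<^sup>+x. (\<Prod>i\<in>I. f i (x i)) * indicator (Pi\<^sub>E I A) x \<partial>Pi\<^sub>M I M)"
      by (intro emeasure_density) auto
    also have "\<dots> = (\<integral>\<^sup>+x. (\<Prod>i\<in>I. f i (x i) * indicator (A i) (x i)) \<partial>Pi\<^sub>M I M)"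
    proof (intro nn_integral_cong)
      fix x assume "x \<in> space (Pi\<^sub>M I M)"
      then have "indicator (Pi\<^sub>E I A) x = (\<Prod>i\<in>I. indicator (A i) (x i) :: ennreal)"
        using I by (auto simp: indicator_def space_PiM PiE_iff prod_zero_iff)
      then show "(\<Prod>i\<in>I. f i (x i)) * indicator (Pi\<^sub>E I A) x = (\<Prod>i\<in>I. f i (x i) * indicator (A i) (x i))"
        by (simp add: prod.distrib)
    qed
    also have "\<dots> = (\<Prod>i\<in>I. \<integral>\<^sup>+x. f i x * indicator (A i) x \<partial>M i)"
      using I by (intro M.product_nn_integral_prod) auto
    also have "\<dots> = (\<Prod>i\<in>I. emeasure (density (M i) (f i)) (A i))"
      by (intro prod.cong refl emeasure_density[symmetric]) auto
    finally show "emeasure (density (Pi\<^sub>M I M) (\<lambda>x. \<Prod>i\<in>I. f i (x i))) (Pi\<^sub>E I A)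
      = (\<Prod>i\<in>I. emeasure (density (M i) (f i)) (A i))" .
  qed
qed

lemma distr_PiM_componentwise:
  assumes I: "finite I" and M: "\<And>i. prob_space (M i)"
    and h [measurable]: "\<And>i. h i \<in> M i \<rightarrow>\<^sub>M N i"
  shows "distr (Pi\<^sub>M I M) (Pi\<^sub>M I N) (\<lambda>x. \<lambda>i\<in>I. h i (x i)) = Pi\<^sub>M I (\<lambda>i. distr (M i) (N i) (h i))"
proof -
  have P: "prob_space (distr (M i) (N i) (h i))" for i
    using M by (rule prob_space.prob_space_distr) (rule h)
  interpret M: product_sigma_finite M
    by (simp add: product_sigma_finite_def prob_space_imp_sigma_finite M)
  interpret D: product_sigma_finite "\<lambda>i. distr (M i) (N i) (h i)"
    by (simp add: product_sigma_finite_def prob_space_imp_sigma_finite P)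
  show ?thesis
  proof (rule D.PiM_eqI[OF I])
    show "sets (distr (Pi\<^sub>M I M) (Pi\<^sub>M I N) (\<lambda>x. \<lambda>i\<in>I. h i (x i))) = sets (Pi\<^sub>M I (\<lambda>i. distr (M i) (N i) (h i)))"
      unfolding sets_distr by (intro sets_PiM_cong) auto
    fix A assume "\<And>i. i \<in> I \<Longrightarrow> A i \<in> sets (distr (M i) (N i) (h i))"
    then have A [measurable]: "\<And>i. i \<in> I \<Longrightarrow> A i \<in> sets (N i)" by simp
    have "(\<lambda>x. \<lambda>i\<in>I. h i (x i)) -` Pi\<^sub>E I A \<inter> space (Pi\<^sub>M I M)
        = Pi\<^sub>E I (\<lambda>i. h i -` A i \<inter> space (M i))"
      by (auto simp: space_PiM PiE_iff restrict_def)
    moreover have "Pi\<^sub>E I A \<in> sets (Pi\<^sub>M I N)" using I by (intro sets_PiM_I_finite A)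
    ultimately have "emeasure (distr (Pi\<^sub>M I M) (Pi\<^sub>M I N) (\<lambda>x. \<lambda>i\<in>I. h i (x i))) (Pi\<^sub>E I A)
      = emeasure (Pi\<^sub>M I M) (Pi\<^sub>E I (\<lambda>i. h i -` A i \<inter> space (M i)))"
      by (subst emeasure_distr) (auto intro!: measurable_restrict)
    also have "\<dots> = (\<Prod>i\<in>I. emeasure (M i) (h i -` A i \<inter> space (M i)))"
      using I by (intro M.emeasure_PiM) auto
    also have "\<dots> = (\<Prod>i\<in>I. emeasure (distr (M i) (N i) (h i)) (A i))"
      by (intro prod.cong refl emeasure_distr[symmetric]) auto
    finally show "emeasure (distr (Pi\<^sub>M I M) (Pi\<^sub>M I N) (\<lambda>x. \<lambda>i\<in>I. h i (x i))) (Pi\<^sub>E I A)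
      = (\<Prod>i\<in>I. emeasure (distr (M i) (N i) (h i)) (A i))" .
  qed
qed

lemma distr_std_normal_affine:
  assumes "\<sigma> \<noteq> 0"
  shows "distr std_normal_distribution borel (\<lambda>z. \<nu> + \<sigma> * z) = density lborel (normal_density \<nu> \<bar>\<sigma>\<bar>)"
proof -
  interpret prob_space std_normal_distribution by (rule prob_space_normal_density) simp
  have "distr std_normal_distribution lborel (\<lambda>z. z) = distr std_normal_distribution std_normal_distribution (\<lambda>z. z)"
    by (rule distr_cong) auto
  then have "distributed std_normal_distribution lborel (\<lambda>z. z) std_normal_density"
    unfolding distributed_def by (simp add: distr_id)
  from normal_density_affine[OF this _ assms, of \<nu>]
  have "distr std_normal_distribution lborel (\<lambda>z. \<nu> + \<sigma> * z) = density lborel (normal_density \<nu> \<bar>\<sigma>\<bar>)"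
    by (simp add: distributed_def)
  moreover have "distr std_normal_distribution borel (\<lambda>z. \<nu> + \<sigma> * z) = distr std_normal_distribution lborel (\<lambda>z. \<nu> + \<sigma> * z)"
    by (rule distr_cong) auto
  ultimately show ?thesis by simp
qed

section \<open>A determinant identity and a Gaussian integral\<close>

text \<open>
  Sylvester's determinant identity: multiply the block matrix with rows \<open>(1, U)\<close>, \<open>(- V, 1)\<close> by the
  lower triangular one with rows \<open>(1, 0)\<close>, \<open>(V, 1)\<close>, once from each side.
\<close>

lemma det_one_plus_mult_commute:
  fixes U :: "'a :: idom mat"
  assumes U: "U \<in> carrier_mat n k" and V: "V \<in> carrier_mat k n"
  shows "Determinant.det (1\<^sub>m n + U * V) = Determinant.det (1\<^sub>m k + V * U)"
proof -
  have carr [simp]: "U * V \<in> carrier_mat n n" "V * U \<in> carrier_mat k k" "- V \<in> carrier_mat k n"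
    using U V by auto
  let ?M = "four_block_mat (1\<^sub>m n) U (- V) (1\<^sub>m k)"
  let ?L = "four_block_mat (1\<^sub>m n) (0\<^sub>m n k) V (1\<^sub>m k)"
  have L: "Determinant.det ?L = 1"
    by (subst det_four_block_mat_upper_right_zero) (use V in auto)
  have Mc: "?M \<in> carrier_mat (n + k) (n + k)" and Lc: "?L \<in> carrier_mat (n + k) (n + k)"
    by (auto intro: four_block_carrier_mat)
  have zero: "- 0\<^sub>m n n = (0\<^sub>m n n :: 'a mat)"
    by (intro eq_matI) auto
  have nv: "- V + V = 0\<^sub>m k n" "V + - V = 0\<^sub>m k n"
    using V by (auto intro!: eq_matI)
  have "?M * ?L = four_block_mat (1\<^sub>m n * 1\<^sub>m n + U * V) (1\<^sub>m n * 0\<^sub>m n k + U * 1\<^sub>m k)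
      (- V * 1\<^sub>m n + 1\<^sub>m k * V) (- V * 0\<^sub>m n k + 1\<^sub>m k * 1\<^sub>m k)"
    using U V by (intro mult_four_block_mat) auto
  also have "\<dots> = four_block_mat (1\<^sub>m n + U * V) U (0\<^sub>m k n) (1\<^sub>m k)"
    using U V nv by simp
  finally have ML1: "?M * ?L = four_block_mat (1\<^sub>m n + U * V) U (0\<^sub>m k n) (1\<^sub>m k)" .
  have "?L * ?M = four_block_mat (1\<^sub>m n * 1\<^sub>m n + 0\<^sub>m n k * - V) (1\<^sub>m n * U + 0\<^sub>m n k * 1\<^sub>m k)
      (V * 1\<^sub>m n + 1\<^sub>m k * - V) (V * U + 1\<^sub>m k * 1\<^sub>m k)"
    using U V by (intro mult_four_block_mat) auto
  also have "\<dots> = four_block_mat (1\<^sub>m n) U (0\<^sub>m k n) (1\<^sub>m k + V * U)"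
    using U V nv zero by (simp add: comm_add_mat[of "V * U" k k])
  finally have LM1: "?L * ?M = four_block_mat (1\<^sub>m n) U (0\<^sub>m k n) (1\<^sub>m k + V * U)" .
  have "Determinant.det (1\<^sub>m n + U * V) = Determinant.det (?M * ?L)"
    unfolding ML1 by (subst det_four_block_mat_lower_left_zero) (use U in auto)
  also have "\<dots> = Determinant.det (?L * ?M)"
    by (simp add: det_mult[OF Mc Lc] det_mult[OF Lc Mc])
  also have "\<dots> = Determinant.det (1\<^sub>m k + V * U)"
    unfolding LM1 by (subst det_four_block_mat_lower_left_zero) (use U in auto)
  finally show ?thesis .
qed

text \<open>
  The density of one group, obtained by integrating out its common factor. The product under the
  integral is, after completing the square in \<open>w\<close>, a constant times a normal density with mean \<open>b\<close> and
  variance \<open>1 / a\<close>.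
\<close>

lemma gaussian_mixture_integral:
  fixes y :: "'i \<Rightarrow> real" and \<sigma> c :: real
  assumes B: "finite B" and \<sigma>: "\<sigma> > 0"
  defines "a \<equiv> 1 + real (card B) * c\<^sup>2 / \<sigma>\<^sup>2"
  shows "(\<integral>\<^sup>+w. ennreal (std_normal_density w) * (\<Prod>i\<in>B. ennreal (normal_density (c * w) \<sigma> (y i))) \<partial>lborel)
    = ennreal (exp (- ((\<Sum>i\<in>B. (y i)\<^sup>2) / \<sigma>\<^sup>2 - c\<^sup>2 * (\<Sum>i\<in>B. y i)\<^sup>2 / (\<sigma>\<^sup>2 * \<sigma>\<^sup>2 * a)) / 2)
        / sqrt ((2 * pi * \<sigma>\<^sup>2) ^ card B * a))" (is "_ = ennreal ?K")
proof -
  have a: "a > 0" unfolding a_def using \<sigma> by (intro add_pos_nonneg) auto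
  define S where "S = (\<Sum>i\<in>B. y i)"
  define Q where "Q = (\<Sum>i\<in>B. (y i)\<^sup>2)"
  define b where "b = c * S / (\<sigma>\<^sup>2 * a)"
  have sq: "(\<Sum>i\<in>B. (y i - c * w)\<^sup>2) = Q - 2 * c * w * S + real (card B) * (c * w)\<^sup>2" for w
  proof -
    have "(\<Sum>i\<in>B. (y i - c * w)\<^sup>2) = (\<Sum>i\<in>B. (y i)\<^sup>2 - 2 * c * w * y i + (c * w)\<^sup>2)"
      by (intro sum.cong) (auto simp: power2_eq_square algebra_simps)
    then show ?thesis by (simp add: sum.distrib sum_subtractf Q_def S_def sum_distrib_left)
  qed
  have pointwise: "std_normal_density w * (\<Prod>i\<in>B. normal_density (c * w) \<sigma> (y i))
    = ?K * normal_density b (1 / sqrt a) w" for w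
  proof -
    have "(\<Prod>i\<in>B. normal_density (c * w) \<sigma> (y i))
      = exp (- (\<Sum>i\<in>B. (y i - c * w)\<^sup>2) / (2 * \<sigma>\<^sup>2)) / sqrt ((2 * pi * \<sigma>\<^sup>2) ^ card B)"
    proof -
      have "(\<Prod>i\<in>B. normal_density (c * w) \<sigma> (y i))
        = (\<Prod>i\<in>B. exp (- (y i - c * w)\<^sup>2 / (2 * \<sigma>\<^sup>2)) / sqrt (2 * pi * \<sigma>\<^sup>2))"
        by (intro prod.cong) (auto simp: normal_density_def)
      also have "\<dots> = exp (\<Sum>i\<in>B. - (y i - c * w)\<^sup>2 / (2 * \<sigma>\<^sup>2)) / sqrt (2 * pi * \<sigma>\<^sup>2) ^ card B"
        by (simp only: prod_dividef exp_sum[OF B] prod_constant)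
      finally show ?thesis
        by (simp only: real_sqrt_power sum_negf sum_divide_distrib minus_divide_left[symmetric])
    qed
    then have "std_normal_density w * (\<Prod>i\<in>B. normal_density (c * w) \<sigma> (y i))
      = exp (- w\<^sup>2 / 2 - (\<Sum>i\<in>B. (y i - c * w)\<^sup>2) / (2 * \<sigma>\<^sup>2))
        / (sqrt ((2 * pi * \<sigma>\<^sup>2) ^ card B) * sqrt (2 * pi))"
    proof -
      have "exp (- w\<^sup>2 / 2 - (\<Sum>i\<in>B. (y i - c * w)\<^sup>2) / (2 * \<sigma>\<^sup>2))
        = exp (- w\<^sup>2 / 2) * exp (- (\<Sum>i\<in>B. (y i - c * w)\<^sup>2) / (2 * \<sigma>\<^sup>2))"
        by (simp add: mult_exp_exp)
      with \<open>(\<Prod>i\<in>B. normal_density (c * w) \<sigma> (y i)) = _\<close> show ?thesis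
        unfolding std_normal_density_def by (simp only:) simp
    qed
    moreover have "- w\<^sup>2 / 2 - (\<Sum>i\<in>B. (y i - c * w)\<^sup>2) / (2 * \<sigma>\<^sup>2)
      = - (Q / \<sigma>\<^sup>2 - c\<^sup>2 * S\<^sup>2 / (\<sigma>\<^sup>2 * \<sigma>\<^sup>2 * a)) / 2 - (w - b)\<^sup>2 * a / 2"
    proof -
      have 1: "w\<^sup>2 + real (card B) * (c * w)\<^sup>2 / \<sigma>\<^sup>2 = a * w\<^sup>2"
        by (simp add: a_def algebra_simps power_mult_distrib)
      have 2: "b * a = c * S / \<sigma>\<^sup>2" using a by (simp add: b_def)
      have 3: "b\<^sup>2 * a = c\<^sup>2 * S\<^sup>2 / (\<sigma>\<^sup>2 * \<sigma>\<^sup>2 * a)"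
        using a \<sigma> by (simp add: b_def power2_eq_square mult_ac)
      have "(w - b)\<^sup>2 * a = a * w\<^sup>2 - 2 * w * (b * a) + b\<^sup>2 * a"
        by (simp add: power2_eq_square algebra_simps)
      then have 4: "(w - b)\<^sup>2 * a = w\<^sup>2 + real (card B) * (c * w)\<^sup>2 / \<sigma>\<^sup>2 - 2 * w * (c * S / \<sigma>\<^sup>2)
          + c\<^sup>2 * S\<^sup>2 / (\<sigma>\<^sup>2 * \<sigma>\<^sup>2 * a)"
        by (simp only: 1 2 3)
      show ?thesis unfolding 4 sq using \<sigma> by (simp add: field_simps)
    qed
    moreover have "normal_density b (1 / sqrt a) w = sqrt a / sqrt (2 * pi) * exp (- ((w - b)\<^sup>2 * a / 2))"
      using a by (simp add: normal_density_def real_sqrt_divide power_divide)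
    moreover have "exp (x - y) / (D * sqrt (2 * pi)) = exp x / (D * sqrt a) * (sqrt a / sqrt (2 * pi) * exp (- y))"
      for x y D :: real
      using a by (simp add: exp_diff exp_minus field_simps)
    ultimately show ?thesis
      unfolding S_def Q_def by (simp only: real_sqrt_mult[of _ a])
  qed
  have K: "?K \<ge> 0" using a by simp
  have "(\<integral>\<^sup>+w. ennreal (std_normal_density w) * (\<Prod>i\<in>B. ennreal (normal_density (c * w) \<sigma> (y i))) \<partial>lborel)
    = (\<integral>\<^sup>+w. ennreal ?K * ennreal (normal_density b (1 / sqrt a) w) \<partial>lborel)"
  proof (intro nn_integral_cong)
    fix w
    have "ennreal (std_normal_density w) * (\<Prod>i\<in>B. ennreal (normal_density (c * w) \<sigma> (y i)))
      = ennreal (std_normal_density w * (\<Prod>i\<in>B. normal_density (c * w) \<sigma> (y i)))"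
      by (simp add: prod_ennreal ennreal_mult prod_nonneg)
    then show "ennreal (std_normal_density w) * (\<Prod>i\<in>B. ennreal (normal_density (c * w) \<sigma> (y i)))
      = ennreal ?K * ennreal (normal_density b (1 / sqrt a) w)"
      unfolding pointwise using K by (subst ennreal_mult[symmetric]) auto
  qed
  also have "\<dots> = ennreal ?K * (\<integral>\<^sup>+w. ennreal (normal_density b (1 / sqrt a) w) \<partial>lborel)"
    by (intro nn_integral_cmult) measurable
  also have "(\<integral>\<^sup>+w. ennreal (normal_density b (1 / sqrt a) w) \<partial>lborel) = 1"
    using a by (subst nn_integral_eq_integral) auto
  finally show ?thesis by simp
qed

section \<open>The covariance matrix of the observation\<close>

lemma equal_groups_labelling:
  assumes "equal_groups p R B"
  obtains g where "\<And>i. i < p \<Longrightarrow> g i < R"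
    and "\<And>k. k < R \<Longrightarrow> B k = {i \<in> {..<p}. g i = k}"
    and "\<And>k. k < R \<Longrightarrow> card {i \<in> {..<p}. g i = k} = p div R"
proof -
  have U: "(\<Union>k<R. B k) = {..<p}" and D: "disjoint_family_on B {..<R}"
    and C: "\<And>k. k < R \<Longrightarrow> card (B k) = p div R"
    using assms by (auto simp: equal_groups_def)
  have "\<forall>i. \<exists>k. i < p \<longrightarrow> k < R \<and> i \<in> B k" using U by auto
  then obtain g where g: "\<And>i. i < p \<Longrightarrow> g i < R" "\<And>i. i < p \<Longrightarrow> i \<in> B (g i)" by metis
  have "B k = {i \<in> {..<p}. g i = k}" if k: "k < R" for k
  proof (intro equalityI subsetI)
    fix i assume i: "i \<in> B k"
    then have "i < p" using U k by auto
    moreover from this have "g i = k"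
      using D g i k unfolding disjoint_family_on_def by (metis disjoint_iff lessThan_iff)
    ultimately show "i \<in> {i \<in> {..<p}. g i = k}" by simp
  qed (use g in auto)
  with that g C show ?thesis by metis
qed

text \<open>
  The groups are encoded by the function \<open>g\<close> that maps a coordinate to the index of its group; \<open>m\<close>
  is the common size of the groups.
\<close>

locale labelled_groups =
  fixes p R m :: nat and g :: "nat \<Rightarrow> nat"
  assumes label_less: "i < p \<Longrightarrow> g i < R"
    and card_group: "k < R \<Longrightarrow> card {i \<in> {..<p}. g i = k} = m"
begin

lemma sum_groups: "(\<Sum>k<R. \<Sum>i\<in>{i \<in> {..<p}. g i = k}. f i) = (\<Sum>i<p. f i :: 'a :: comm_monoid_add)"
  by (rule sum.group) (auto simp: label_less)

lemma prod_groups: "(\<Prod>k<R. \<Prod>i\<in>{i \<in> {..<p}. g i = k}. f i) = (\<Prod>i<p. f i :: 'a :: comm_monoid_mult)"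
  by (rule prod.group) (auto simp: label_less)

text \<open>
  The set comprehension in the normal form of the simplifier.
\<close>

lemma card_group': "k < R \<Longrightarrow> card {i. i < p \<and> g i = k} = m"
  using card_group by simp

lemma card_groups: "p = R * m"
  using sum_groups[of "\<lambda>_. 1 :: nat"] by (simp add: card_group')

lemma sum_same_label:
  assumes "i < p"
  shows "(\<Sum>j<p. (if g i = g j then 1 else 0) * f j) = (\<Sum>j\<in>{j \<in> {..<p}. g j = g i}. f j :: real)"
proof -
  have "(\<Sum>j<p. (if g i = g j then 1 else 0) * f j) = (\<Sum>j<p. if g j = g i then f j else 0)"
    by (intro sum.cong) auto
  then show ?thesis by (simp only: sum.inter_filter finite_lessThan)
qed

lemma sum_label_product:
  "(\<Sum>i<p. f i * (\<Sum>j\<in>{j \<in> {..<p}. g j = g i}. f j)) = (\<Sum>k<R. (\<Sum>i\<in>{i \<in> {..<p}. g i = k}. f i :: real)\<^sup>2)"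
proof -
  have "(\<Sum>k<R. (\<Sum>i\<in>{i \<in> {..<p}. g i = k}. f i)\<^sup>2)
    = (\<Sum>k<R. \<Sum>i\<in>{i \<in> {..<p}. g i = k}. f i * (\<Sum>j\<in>{j \<in> {..<p}. g j = g i}. f j))"
  proof (intro sum.cong refl)
    fix k
    have "(\<Sum>i\<in>{i \<in> {..<p}. g i = k}. f i * (\<Sum>j\<in>{j \<in> {..<p}. g j = g i}. f j))
      = (\<Sum>i\<in>{i \<in> {..<p}. g i = k}. f i * (\<Sum>j\<in>{j \<in> {..<p}. g j = k}. f j))"
      by (intro sum.cong) auto
    then show "(\<Sum>i\<in>{i \<in> {..<p}. g i = k}. f i)\<^sup>2
      = (\<Sum>i\<in>{i \<in> {..<p}. g i = k}. f i * (\<Sum>j\<in>{j \<in> {..<p}. g j = g i}. f j))"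
      by (simp add: power2_eq_square sum_distrib_right)
  qed
  then show ?thesis by (simp only: sum_groups)
qed

text \<open>
  The covariance matrix of the observation in terms of the labels.
\<close>

definition cov :: "real \<Rightarrow> real mat" where
  "cov \<gamma> = Matrix.mat p p (\<lambda>(i, j). (1 - \<gamma>) * (if i = j then 1 else 0) + \<gamma> * (if g i = g j then 1 else 0))"

text \<open>
  The inverse of the covariance matrix.
\<close>

definition prec :: "real \<Rightarrow> real mat" where
  "prec \<gamma> = Matrix.mat p p (\<lambda>(i, j). ((if i = j then 1 else 0)
      - \<gamma> / (1 - \<gamma> + real m * \<gamma>) * (if g i = g j then 1 else 0)) / (1 - \<gamma>))"

lemma cov_carrier [simp]: "cov \<gamma> \<in> carrier_mat p p" and prec_carrier [simp]: "prec \<gamma> \<in> carrier_mat p p"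
  by (auto simp: cov_def prec_def)

lemma group_cov_eq_cov:
  assumes B: "\<And>k. k < R \<Longrightarrow> B k = {i \<in> {..<p}. g i = k}"
  shows "group_cov p \<gamma> R B = cov \<gamma>"
  unfolding group_cov_def cov_def
proof (intro cong_mat refl)
  fix i j assume ij: "i < p" "j < p"
  have "(\<Sum>k<R. indicator (B k) i * indicator (B k) j) = (\<Sum>k<R. if k = g i then (if g i = g j then 1 else 0) else 0 :: real)"
    using ij by (intro sum.cong) (auto simp: B)
  also have "\<dots> = (if g i = g j then 1 else 0)" using ij by (simp add: label_less)
  finally show "(case (i, j) of (i, j) \<Rightarrow> (1 - \<gamma>) * (if i = j then 1 else 0)
        + \<gamma> * (\<Sum>k<R. indicator (B k) i * indicator (B k) j))
    = (case (i, j) of (i, j) \<Rightarrow> (1 - \<gamma>) * (if i = j then 1 else 0) + \<gamma> * (if g i = g j then 1 else 0))"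
    by simp
qed

lemma cov_prec:
  assumes \<gamma>: "0 \<le> \<gamma>" "\<gamma> < 1"
  shows "cov \<gamma> * prec \<gamma> = 1\<^sub>m p"
proof (intro eq_matI)
  fix i j assume "i < dim_row (1\<^sub>m p :: real mat)" "j < dim_col (1\<^sub>m p :: real mat)"
  then have ij: "i < p" "j < p" by auto
  define d where "d = \<gamma> / (1 - \<gamma> + real m * \<gamma>)"
  define e where "e a b = (if a = b then 1 else 0 :: real)" for a b :: nat
  have den: "1 - \<gamma> + real m * \<gamma> > 0" using \<gamma> by (intro add_pos_nonneg) auto
  have "(cov \<gamma> * prec \<gamma>) $$ (i, j)
    = (\<Sum>l<p. ((1 - \<gamma>) * e i l + \<gamma> * e (g i) (g l)) * ((e l j - d * e (g l) (g j)) / (1 - \<gamma>)))"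
    using ij by (simp add: cov_def prec_def scalar_prod_def d_def e_def lessThan_atLeast0)
  also have "\<dots> = (\<Sum>l<p. e i l * e l j - d * (e i l * e (g l) (g j))
      + \<gamma> / (1 - \<gamma>) * (e (g i) (g l) * e l j) - \<gamma> * d / (1 - \<gamma>) * (e (g i) (g l) * e (g l) (g j)))"
  proof (intro sum.cong refl)
    fix l
    have "(v * e1 + \<gamma> * e2) * ((e3 - d * e4) / v) = e1 * e3 - d * (e1 * e4) + \<gamma> / v * (e2 * e3) - \<gamma> * d / v * (e2 * e4)"
      if "v \<noteq> 0" for v e1 e2 e3 e4 :: real
      using that by (simp add: field_simps)
    then show "((1 - \<gamma>) * e i l + \<gamma> * e (g i) (g l)) * ((e l j - d * e (g l) (g j)) / (1 - \<gamma>))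
      = e i l * e l j - d * (e i l * e (g l) (g j))
      + \<gamma> / (1 - \<gamma>) * (e (g i) (g l) * e l j) - \<gamma> * d / (1 - \<gamma>) * (e (g i) (g l) * e (g l) (g j))"
      using \<gamma> by simp
  qed
  also have "\<dots> = (\<Sum>l<p. e i l * e l j) - d * (\<Sum>l<p. e i l * e (g l) (g j))
      + \<gamma> / (1 - \<gamma>) * (\<Sum>l<p. e (g i) (g l) * e l j) - \<gamma> * d / (1 - \<gamma>) * (\<Sum>l<p. e (g i) (g l) * e (g l) (g j))"
    by (simp only: sum.distrib sum_subtractf sum_distrib_left)
  also have "(\<Sum>l<p. e i l * e l j) = (\<Sum>l<p. if l = i then e i j else 0)"
    by (intro sum.cong) (auto simp: e_def)
  also have "\<dots> = e i j" using ij by simp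
  also have "(\<Sum>l<p. e i l * e (g l) (g j)) = (\<Sum>l<p. if l = i then e (g i) (g j) else 0)"
    by (intro sum.cong) (auto simp: e_def)
  also have "\<dots> = e (g i) (g j)" using ij by simp
  also have "(\<Sum>l<p. e (g i) (g l) * e l j) = (\<Sum>l<p. if l = j then e (g i) (g j) else 0)"
    by (intro sum.cong) (auto simp: e_def)
  also have "\<dots> = e (g i) (g j)" using ij by simp
  also have "(\<Sum>l<p. e (g i) (g l) * e (g l) (g j)) = (\<Sum>l\<in>{l \<in> {..<p}. g l = g i}. e (g l) (g j))"
    unfolding e_def by (rule sum_same_label) fact
  also have "\<dots> = (\<Sum>l\<in>{l \<in> {..<p}. g l = g i}. e (g i) (g j))"
    by (intro sum.cong) auto
  also have "\<dots> = real m * e (g i) (g j)" using ij by (simp add: card_group' label_less)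
  also have "e i j - d * e (g i) (g j) + \<gamma> / (1 - \<gamma>) * e (g i) (g j)
      - \<gamma> * d / (1 - \<gamma>) * (real m * e (g i) (g j)) = e i j"
  proof -
    have "d * (1 - \<gamma> + real m * \<gamma>) = \<gamma>"
      using den by (simp add: d_def)
    then have "\<gamma> = d * (1 - \<gamma>) + \<gamma> * d * real m"
      by (simp add: algebra_simps)
    then have "- d + \<gamma> / (1 - \<gamma>) - \<gamma> * d / (1 - \<gamma>) * real m = 0"
      using \<gamma> by (simp add: field_simps)
    then have "(- d + \<gamma> / (1 - \<gamma>) - \<gamma> * d / (1 - \<gamma>) * real m) * e (g i) (g j) = 0" by simp
    then show ?thesis by (simp add: algebra_simps)
  qed
  finally show "(cov \<gamma> * prec \<gamma>) $$ (i, j) = 1\<^sub>m p $$ (i, j)"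
    using ij by (simp add: e_def)
qed (auto simp: cov_def prec_def)

lemma mat_inverse_cov:
  assumes \<gamma>: "0 \<le> \<gamma>" "\<gamma> < 1"
  shows "the (mat_inverse (cov \<gamma>)) = prec \<gamma>"
proof -
  have right: "cov \<gamma> * prec \<gamma> = 1\<^sub>m p" by (rule cov_prec[OF \<gamma>])
  then have left: "prec \<gamma> * cov \<gamma> = 1\<^sub>m p"
    by (rule mat_mult_left_right_inverse[OF cov_carrier prec_carrier])
  have "cov \<gamma> \<in> Units (ring_mat TYPE(real) p ())"
    using right left by (auto simp: Units_def ring_mat_def intro!: bexI[of _ "prec \<gamma>"])
  then obtain C where C: "mat_inverse (cov \<gamma>) = Some C"
    using mat_inverse(1)[OF cov_carrier, where b = "()"] by (cases "mat_inverse (cov \<gamma>)") auto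
  then have CC: "cov \<gamma> * C = 1\<^sub>m p" "C \<in> carrier_mat p p"
    using mat_inverse(2)[OF cov_carrier] by auto
  have "C = (prec \<gamma> * cov \<gamma>) * C" using CC left by simp
  also have "\<dots> = prec \<gamma> * (cov \<gamma> * C)"
    using CC by (intro assoc_mult_mat[of _ p p _ p _ p]) auto
  also have "\<dots> = prec \<gamma>" using CC right_mult_one_mat[OF prec_carrier] by simp
  finally show ?thesis using C by simp
qed

lemma det_cov:
  assumes \<gamma>: "0 \<le> \<gamma>" "\<gamma> < 1"
  shows "Determinant.det (cov \<gamma>) = (1 - \<gamma>) ^ p * (1 + real m * \<gamma> / (1 - \<gamma>)) ^ R"
proof -
  \<comment> \<open>Up to the factor \<open>1 - \<gamma>\<close> the matrix is a perturbation of the identity of rank \<open>R\<close>, and \<open>V * U\<close> is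
    a multiple of the identity.\<close>
  define U where "U = Matrix.mat p R (\<lambda>(i, k). if g i = k then \<gamma> / (1 - \<gamma>) else 0)"
  define V where "V = Matrix.mat R p (\<lambda>(k, i). if g i = k then 1 else 0 :: real)"
  have U [simp]: "U \<in> carrier_mat p R" and V [simp]: "V \<in> carrier_mat R p" by (auto simp: U_def V_def)
  have "cov \<gamma> = (1 - \<gamma>) \<cdot>\<^sub>m (1\<^sub>m p + U * V)"
  proof (intro eq_matI)
    fix i j assume "i < dim_row ((1 - \<gamma>) \<cdot>\<^sub>m (1\<^sub>m p + U * V))" "j < dim_col ((1 - \<gamma>) \<cdot>\<^sub>m (1\<^sub>m p + U * V))"
    then have ij: "i < p" "j < p" by (auto simp: U_def V_def)
    have "(U * V) $$ (i, j) = (\<Sum>k<R. (if g i = k then \<gamma> / (1 - \<gamma>) else 0) * (if g j = k then 1 else 0))"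
      using ij by (simp add: U_def V_def scalar_prod_def lessThan_atLeast0)
    also have "\<dots> = (\<Sum>k<R. if k = g i then (if g i = g j then \<gamma> / (1 - \<gamma>) else 0) else 0)"
      by (intro sum.cong) auto
    also have "\<dots> = (if g i = g j then \<gamma> / (1 - \<gamma>) else 0)" using ij by (simp add: label_less)
    finally have UV: "(U * V) $$ (i, j) = (if g i = g j then \<gamma> / (1 - \<gamma>) else 0)" .
    have "((1 - \<gamma>) \<cdot>\<^sub>m (1\<^sub>m p + U * V)) $$ (i, j) = (1 - \<gamma>) * ((if i = j then 1 else 0) + (U * V) $$ (i, j))"
      using ij by (subst index_smult_mat) (auto simp: U_def V_def)
    also have "\<dots> = cov \<gamma> $$ (i, j)"
      using ij \<gamma> unfolding UV by (auto simp: cov_def distrib_left)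
    finally show "cov \<gamma> $$ (i, j) = ((1 - \<gamma>) \<cdot>\<^sub>m (1\<^sub>m p + U * V)) $$ (i, j)" by simp
  qed (auto simp: cov_def U_def V_def)
  then have "Determinant.det (cov \<gamma>) = (1 - \<gamma>) ^ p * Determinant.det (1\<^sub>m p + U * V)"
    using carrier_matD(2)[OF V] by (simp add: Determinant.det_smult)
  also have "Determinant.det (1\<^sub>m p + U * V) = Determinant.det (1\<^sub>m R + V * U)"
    by (rule det_one_plus_mult_commute[OF U V])
  also have "1\<^sub>m R + V * U = (1 + real m * \<gamma> / (1 - \<gamma>)) \<cdot>\<^sub>m 1\<^sub>m R"
  proof (intro eq_matI)
    fix k l assume "k < dim_row ((1 + real m * \<gamma> / (1 - \<gamma>)) \<cdot>\<^sub>m 1\<^sub>m R)" "l < dim_col ((1 + real m * \<gamma> / (1 - \<gamma>)) \<cdot>\<^sub>m 1\<^sub>m R)"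
    then have kl: "k < R" "l < R" by auto
    have "(V * U) $$ (k, l) = (\<Sum>i<p. (if g i = k then 1 else 0) * (if g i = l then \<gamma> / (1 - \<gamma>) else 0))"
      using kl by (simp add: U_def V_def scalar_prod_def lessThan_atLeast0)
    also have "\<dots> = (\<Sum>i<p. if g i = k then (if k = l then \<gamma> / (1 - \<gamma>) else 0) else 0)"
      by (intro sum.cong) auto
    also have "\<dots> = (\<Sum>i\<in>{i \<in> {..<p}. g i = k}. if k = l then \<gamma> / (1 - \<gamma>) else 0)"
      by (simp only: sum.inter_filter finite_lessThan)
    also have "\<dots> = (if k = l then real m * \<gamma> / (1 - \<gamma>) else 0)" using kl by (simp add: card_group')
    finally have VU: "(V * U) $$ (k, l) = (if k = l then real m * \<gamma> / (1 - \<gamma>) else 0)" .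
    have "(1\<^sub>m R + V * U) $$ (k, l) = (if k = l then 1 else 0) + (V * U) $$ (k, l)"
      using kl by (subst index_add_mat) (auto simp: U_def V_def)
    then show "(1\<^sub>m R + V * U) $$ (k, l) = ((1 + real m * \<gamma> / (1 - \<gamma>)) \<cdot>\<^sub>m 1\<^sub>m R) $$ (k, l)"
      using kl unfolding VU by auto
  qed (auto simp: U_def V_def)
  finally show ?thesis by (simp add: Determinant.det_smult)
qed

lemma prec_quadratic_form:
  fixes y :: "nat \<Rightarrow> real"
  shows "scalar_prod (Matrix.vec p y) (mult_mat_vec (prec \<gamma>) (Matrix.vec p y))
    = (\<Sum>k<R. ((\<Sum>i\<in>{i \<in> {..<p}. g i = k}. (y i)\<^sup>2)
        - \<gamma> / (1 - \<gamma> + real m * \<gamma>) * (\<Sum>i\<in>{i \<in> {..<p}. g i = k}. y i)\<^sup>2) / (1 - \<gamma>))"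
proof -
  define d where "d = \<gamma> / (1 - \<gamma> + real m * \<gamma>)"
  have row: "(\<Sum>j<p. prec \<gamma> $$ (i, j) * y j)
    = (y i - d * (\<Sum>j\<in>{j \<in> {..<p}. g j = g i}. y j)) / (1 - \<gamma>)" if i: "i < p" for i
  proof -
    have "(\<Sum>j<p. prec \<gamma> $$ (i, j) * y j)
      = (\<Sum>j<p. (if j = i then y i else 0) / (1 - \<gamma>) - d / (1 - \<gamma>) * ((if g i = g j then 1 else 0) * y j))"
      using i by (intro sum.cong) (auto simp: prec_def d_def diff_divide_distrib algebra_simps)
    also have "\<dots> = (\<Sum>j<p. if j = i then y i else 0) / (1 - \<gamma>)
        - d / (1 - \<gamma>) * (\<Sum>j<p. (if g i = g j then 1 else 0) * y j)"
      by (simp only: sum_subtractf sum_distrib_left sum_divide_distrib)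
    finally show ?thesis using i unfolding sum_same_label[OF i] by (simp add: diff_divide_distrib)
  qed
  have "scalar_prod (Matrix.vec p y) (mult_mat_vec (prec \<gamma>) (Matrix.vec p y))
    = (\<Sum>i<p. y i * (\<Sum>j<p. prec \<gamma> $$ (i, j) * y j))"
    by (auto simp: scalar_prod_def lessThan_atLeast0 prec_def intro!: sum.cong)
  also have "\<dots> = (\<Sum>i<p. ((y i)\<^sup>2 - d * (y i * (\<Sum>j\<in>{j \<in> {..<p}. g j = g i}. y j))) / (1 - \<gamma>))"
  proof (intro sum.cong refl)
    fix i assume "i \<in> {..<p}"
    then show "y i * (\<Sum>j<p. prec \<gamma> $$ (i, j) * y j)
      = ((y i)\<^sup>2 - d * (y i * (\<Sum>j\<in>{j \<in> {..<p}. g j = g i}. y j))) / (1 - \<gamma>)"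
      by (simp only: row lessThan_iff) (simp add: power2_eq_square algebra_simps)
  qed
  also have "\<dots> = ((\<Sum>i<p. (y i)\<^sup>2) - d * (\<Sum>i<p. y i * (\<Sum>j\<in>{j \<in> {..<p}. g j = g i}. y j))) / (1 - \<gamma>)"
    by (simp only: sum_subtractf sum_distrib_left[symmetric] sum_divide_distrib[symmetric])
  also have "\<dots> = (\<Sum>k<R. ((\<Sum>i\<in>{i \<in> {..<p}. g i = k}. (y i)\<^sup>2)
        - d * (\<Sum>i\<in>{i \<in> {..<p}. g i = k}. y i)\<^sup>2) / (1 - \<gamma>))"
    unfolding sum_label_product sum_groups[of "\<lambda>i. (y i)\<^sup>2", symmetric]
    by (simp only: sum_subtractf sum_distrib_left[symmetric] sum_divide_distrib[symmetric])
  finally show ?thesis by (simp add: d_def)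
qed

text \<open>
  The Gaussian density is a mixture, over the common factors \<open>w\<close> of the groups, of densities with
  independent coordinates.
\<close>

lemma mvn_density_cov:
  assumes \<gamma>: "0 \<le> \<gamma>" "\<gamma> < 1"
  shows "ennreal (mvn_density p \<theta> (cov \<gamma>) x)
    = (\<integral>\<^sup>+w. (\<Prod>k<R. ennreal (std_normal_density (w k)))
        * (\<Prod>i<p. ennreal (normal_density (\<theta> i + sqrt \<gamma> * w (g i)) (sqrt (1 - \<gamma>)) (x i))) \<partial>Pi\<^sub>M {..<R} (\<lambda>_. lborel))"
proof -
  interpret product_sigma_finite "\<lambda>_ :: nat. lborel :: real measure" by standard
  define a where "a = 1 + real m * \<gamma> / (1 - \<gamma>)"
  have a: "a > 0" unfolding a_def using \<gamma> by (intro add_pos_nonneg) auto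
  define y where "y i = x i - \<theta> i" for i
  define G where "G k = {i \<in> {..<p}. g i = k}" for k
  define K where "K k = exp (- ((\<Sum>i\<in>G k. (y i)\<^sup>2) / (1 - \<gamma>) - \<gamma> * (\<Sum>i\<in>G k. y i)\<^sup>2 / ((1 - \<gamma>) * (1 - \<gamma>) * a)) / 2)
      / sqrt ((2 * pi * (1 - \<gamma>)) ^ m * a)" for k
  have "(\<integral>\<^sup>+w. (\<Prod>k<R. ennreal (std_normal_density (w k)))
        * (\<Prod>i<p. ennreal (normal_density (\<theta> i + sqrt \<gamma> * w (g i)) (sqrt (1 - \<gamma>)) (x i))) \<partial>Pi\<^sub>M {..<R} (\<lambda>_. lborel))
    = (\<integral>\<^sup>+w. (\<Prod>k<R. ennreal (std_normal_density (w k))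
        * (\<Prod>i\<in>G k. ennreal (normal_density (sqrt \<gamma> * w k) (sqrt (1 - \<gamma>)) (y i)))) \<partial>Pi\<^sub>M {..<R} (\<lambda>_. lborel))"
  proof (intro nn_integral_cong)
    fix w :: "nat \<Rightarrow> real"
    have "(\<Prod>i<p. ennreal (normal_density (\<theta> i + sqrt \<gamma> * w (g i)) (sqrt (1 - \<gamma>)) (x i)))
      = (\<Prod>k<R. \<Prod>i\<in>G k. ennreal (normal_density (\<theta> i + sqrt \<gamma> * w (g i)) (sqrt (1 - \<gamma>)) (x i)))"
      unfolding G_def by (rule prod_groups[symmetric])
    also have "\<dots> = (\<Prod>k<R. \<Prod>i\<in>G k. ennreal (normal_density (sqrt \<gamma> * w k) (sqrt (1 - \<gamma>)) (y i)))"
      by (intro prod.cong) (auto simp: G_def y_def normal_density_def diff_diff_eq)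
    finally show "(\<Prod>k<R. ennreal (std_normal_density (w k)))
        * (\<Prod>i<p. ennreal (normal_density (\<theta> i + sqrt \<gamma> * w (g i)) (sqrt (1 - \<gamma>)) (x i)))
      = (\<Prod>k<R. ennreal (std_normal_density (w k))
        * (\<Prod>i\<in>G k. ennreal (normal_density (sqrt \<gamma> * w k) (sqrt (1 - \<gamma>)) (y i))))"
      by (simp only: prod.distrib)
  qed
  also have "\<dots> = (\<Prod>k<R. \<integral>\<^sup>+w. ennreal (std_normal_density w)
        * (\<Prod>i\<in>G k. ennreal (normal_density (sqrt \<gamma> * w) (sqrt (1 - \<gamma>)) (y i))) \<partial>lborel)"
    by (rule product_nn_integral_prod) (auto simp: normal_density_def)
  also have "\<dots> = (\<Prod>k<R. ennreal (K k))"
  proof (intro prod.cong refl)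
    fix k assume "k \<in> {..<R}"
    then have "card (G k) = m" by (simp add: G_def card_group')
    then show "(\<integral>\<^sup>+w. ennreal (std_normal_density w)
        * (\<Prod>i\<in>G k. ennreal (normal_density (sqrt \<gamma> * w) (sqrt (1 - \<gamma>)) (y i))) \<partial>lborel) = ennreal (K k)"
      using \<gamma> by (subst gaussian_mixture_integral) (auto simp: G_def K_def a_def)
  qed
  also have "\<dots> = ennreal (\<Prod>k<R. K k)"
    using a \<gamma> by (intro prod_ennreal) (auto simp: K_def)
  also have "(\<Prod>k<R. K k) = mvn_density p \<theta> (cov \<gamma>) x"
  proof -
    have da: "(1 - \<gamma>) * a = 1 - \<gamma> + real m * \<gamma>" using \<gamma> by (simp add: a_def field_simps)
    have "(\<Prod>k<R. K k) = exp (\<Sum>k<R. - ((\<Sum>i\<in>G k. (y i)\<^sup>2) / (1 - \<gamma>) - \<gamma> * (\<Sum>i\<in>G k. y i)\<^sup>2 / ((1 - \<gamma>) * (1 - \<gamma>) * a)) / 2)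
        / sqrt ((2 * pi * (1 - \<gamma>)) ^ m * a) ^ R"
      unfolding K_def by (simp only: prod_dividef exp_sum[OF finite_lessThan] prod_constant card_lessThan)
    also have "(\<Sum>k<R. - ((\<Sum>i\<in>G k. (y i)\<^sup>2) / (1 - \<gamma>) - \<gamma> * (\<Sum>i\<in>G k. y i)\<^sup>2 / ((1 - \<gamma>) * (1 - \<gamma>) * a)) / 2)
      = - (scalar_prod (Matrix.vec p y) (mult_mat_vec (prec \<gamma>) (Matrix.vec p y))) / 2"
    proof -
      have "(\<Sum>k<R. - ((\<Sum>i\<in>G k. (y i)\<^sup>2) / (1 - \<gamma>) - \<gamma> * (\<Sum>i\<in>G k. y i)\<^sup>2 / ((1 - \<gamma>) * (1 - \<gamma>) * a)) / 2)
        = (\<Sum>k<R. - (((\<Sum>i\<in>G k. (y i)\<^sup>2) - \<gamma> / ((1 - \<gamma>) * a) * (\<Sum>i\<in>G k. y i)\<^sup>2) / (1 - \<gamma>)) / 2)"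
        by (intro sum.cong refl) (simp add: diff_divide_distrib mult.assoc)
      then show ?thesis
        unfolding prec_quadratic_form da[symmetric] G_def[symmetric]
        by (simp only: sum_negf sum_divide_distrib[symmetric])
    qed
    also have "sqrt ((2 * pi * (1 - \<gamma>)) ^ m * a) ^ R = sqrt ((2 * pi) ^ p * Determinant.det (cov \<gamma>))"
    proof -
      have "((2 * pi * (1 - \<gamma>)) ^ m * a) ^ R = (2 * pi * (1 - \<gamma>)) ^ p * a ^ R"
        unfolding card_groups by (simp add: power_mult_distrib power_mult[symmetric] mult.commute)
      then show ?thesis
        by (simp only: real_sqrt_power[symmetric] det_cov[OF \<gamma>] a_def power_mult_distrib mult.assoc)
    qed
    finally show ?thesis
      by (simp only: mvn_density_def mat_inverse_cov[OF \<gamma>] Let_def y_def)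
  qed
  finally show ?thesis by simp
qed

end

section \<open>The law of the observation as a mixture\<close>

text \<open>
  The standard Gaussian measure on \<open>\<real>\<^sup>n\<close>, with vectors as extensional functions on \<open>{..<n}\<close>.
\<close>

definition std_gauss :: "nat \<Rightarrow> (nat \<Rightarrow> real) measure" where
  "std_gauss n = Pi\<^sub>M {..<n} (\<lambda>_. std_normal_distribution)"

lemma prob_space_std_normal [intro, simp]: "prob_space std_normal_distribution"
  by (rule prob_space_normal_density) simp

lemma prob_space_std_gauss [intro, simp]: "prob_space (std_gauss n)"
  unfolding std_gauss_def by (intro prob_space_PiM) simp

lemma sets_std_gauss [measurable_cong]: "sets (std_gauss n) = sets (Pi\<^sub>M {..<n} (\<lambda>_. borel))"
  unfolding std_gauss_def by (intro sets_PiM_cong) auto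

lemma space_std_gauss: "space (std_gauss n) = Rn n"
  unfolding std_gauss_def by (simp add: space_PiM Rn_def)

lemma component_std_gauss [measurable]: "i < n \<Longrightarrow> (\<lambda>x. x i) \<in> borel_measurable (std_gauss n)"
  unfolding measurable_cong_sets[OF sets_std_gauss refl] by (rule measurable_component_singleton) simp

lemma std_gauss_eq_density:
  "std_gauss n = density (Pi\<^sub>M {..<n} (\<lambda>_. lborel)) (\<lambda>w. \<Prod>k<n. ennreal (std_normal_density (w k)))"
  unfolding std_gauss_def
  by (rule PiM_density) (auto intro: prob_space_imp_sigma_finite simp: sigma_finite_lborel)

lemma distr_std_gauss_affine:
  assumes "\<sigma> > 0"
  shows "distr (std_gauss n) (Pi\<^sub>M {..<n} (\<lambda>_. borel)) (\<lambda>z. \<lambda>i\<in>{..<n}. \<nu> i + \<sigma> * z i)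
    = density (Pi\<^sub>M {..<n} (\<lambda>_. lborel)) (\<lambda>x. \<Prod>i<n. ennreal (normal_density (\<nu> i) \<sigma> (x i)))"
proof -
  have "distr (std_gauss n) (Pi\<^sub>M {..<n} (\<lambda>_. borel)) (\<lambda>z. \<lambda>i\<in>{..<n}. \<nu> i + \<sigma> * z i)
    = Pi\<^sub>M {..<n} (\<lambda>i. distr std_normal_distribution borel (\<lambda>z. \<nu> i + \<sigma> * z))"
    unfolding std_gauss_def by (rule distr_PiM_componentwise) auto
  also have "\<dots> = Pi\<^sub>M {..<n} (\<lambda>i. density lborel (normal_density (\<nu> i) \<sigma>))"
    using assms by (simp add: distr_std_normal_affine)
  also have "\<dots> = density (Pi\<^sub>M {..<n} (\<lambda>_. lborel)) (\<lambda>x. \<Prod>i<n. ennreal (normal_density (\<nu> i) \<sigma> (x i)))"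
    using assms by (intro PiM_density)
      (auto intro!: prob_space_imp_sigma_finite prob_space_normal_density simp: sigma_finite_lborel)
  finally show ?thesis .
qed

context labelled_groups
begin

lemma label_measurable [measurable]: "i < p \<Longrightarrow> (\<lambda>w. w (g i)) \<in> borel_measurable (std_gauss R)"
  using label_less by measurable

lemma nn_integral_mvn_cov:
  fixes f :: "(nat \<Rightarrow> real) \<Rightarrow> ennreal"
  assumes \<gamma>: "0 \<le> \<gamma>" "\<gamma> < 1" and f [measurable]: "f \<in> borel_measurable (Pi\<^sub>M {..<p} (\<lambda>_. borel))"
  shows "(\<integral>\<^sup>+x. f x \<partial>mvn p \<theta> (cov \<gamma>))
    = (\<integral>\<^sup>+w. \<integral>\<^sup>+z. f (\<lambda>i\<in>{..<p}. \<theta> i + sqrt \<gamma> * w (g i) + sqrt (1 - \<gamma>) * z i) \<partial>std_gauss p \<partial>std_gauss R)"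
proof -
  let ?X = "Pi\<^sub>M {..<p} (\<lambda>_. lborel :: real measure)" and ?W = "Pi\<^sub>M {..<R} (\<lambda>_. lborel :: real measure)"
  interpret L: product_sigma_finite "\<lambda>_ :: nat. lborel :: real measure" by standard
  interpret X: sigma_finite_measure ?X by (rule L.sigma_finite) simp
  interpret W: sigma_finite_measure ?W by (rule L.sigma_finite) simp
  interpret WX: pair_sigma_finite ?W ?X by standard
  interpret N: prob_space "std_gauss p" by simp
  have sX: "sets ?X = sets (Pi\<^sub>M {..<p} (\<lambda>_. borel))" by (intro sets_PiM_cong) auto
  have f' [measurable]: "f \<in> borel_measurable ?X"
    unfolding measurable_cong_sets[OF sX refl] by (rule f)
  define H where "H w = (\<Prod>k<R. ennreal (std_normal_density (w k)))" for w :: "nat \<Rightarrow> real"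
  define D where "D w x = (\<Prod>i<p. ennreal (normal_density (\<theta> i + sqrt \<gamma> * w (g i)) (sqrt (1 - \<gamma>)) (x i)))"
    for w x :: "nat \<Rightarrow> real"
  have H [measurable]: "H \<in> borel_measurable ?W"
    unfolding H_def by (intro borel_measurable_prod_ennreal) measurable
  have w [measurable]: "(\<lambda>w. w (g i)) \<in> borel_measurable ?W" if "i < p" for i
    using measurable_component_singleton[of "g i" "{..<R}" "\<lambda>_. lborel :: real measure"] label_less[OF that] by simp
  have [measurable]: "(\<lambda>(w, x). D w x) \<in> borel_measurable (?W \<Otimes>\<^sub>M ?X)"
    unfolding D_def normal_density_def case_prod_beta'
    by (intro borel_measurable_prod_ennreal) measurable
  have D: "D w \<in> borel_measurable ?X" for w
    unfolding D_def normal_density_def by (intro borel_measurable_prod_ennreal) measurable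
  have dens: "ennreal (mvn_density p \<theta> (cov \<gamma>) x) = (\<integral>\<^sup>+w. H w * D w x \<partial>?W)" for x
    unfolding H_def D_def by (rule mvn_density_cov[OF \<gamma>])
  have "(\<integral>\<^sup>+x. f x \<partial>mvn p \<theta> (cov \<gamma>)) = (\<integral>\<^sup>+x. (\<integral>\<^sup>+w. H w * D w x \<partial>?W) * f x \<partial>?X)"
    unfolding mvn_def dens by (rule nn_integral_density) measurable
  also have "\<dots> = (\<integral>\<^sup>+x. \<integral>\<^sup>+w. H w * (D w x * f x) \<partial>?W \<partial>?X)"
    by (intro nn_integral_cong) (simp add: nn_integral_multc[symmetric] mult.assoc)
  also have "\<dots> = (\<integral>\<^sup>+w. \<integral>\<^sup>+x. H w * (D w x * f x) \<partial>?X \<partial>?W)"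
    by (rule WX.Fubini') measurable
  also have "\<dots> = (\<integral>\<^sup>+w. H w * (\<integral>\<^sup>+x. D w x * f x \<partial>?X) \<partial>?W)"
    by (intro nn_integral_cong nn_integral_cmult) (use D in measurable)
  also have "\<dots> = (\<integral>\<^sup>+w. H w * (\<integral>\<^sup>+z. f (\<lambda>i\<in>{..<p}. \<theta> i + sqrt \<gamma> * w (g i) + sqrt (1 - \<gamma>) * z i) \<partial>std_gauss p) \<partial>?W)"
  proof (intro nn_integral_cong arg_cong2[where f = "(*)"] refl)
    fix w
    have "(\<integral>\<^sup>+x. D w x * f x \<partial>?X) = (\<integral>\<^sup>+x. f x \<partial>density ?X (D w))"
      by (rule nn_integral_density[symmetric]) (use D in measurable)
    also have "density ?X (D w) = distr (std_gauss p) (Pi\<^sub>M {..<p} (\<lambda>_. borel))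
        (\<lambda>z. \<lambda>i\<in>{..<p}. \<theta> i + sqrt \<gamma> * w (g i) + sqrt (1 - \<gamma>) * z i)"
      unfolding D_def using \<gamma> by (intro distr_std_gauss_affine[symmetric]) auto
    also have "(\<integral>\<^sup>+x. f x \<partial>\<dots>)
      = (\<integral>\<^sup>+z. f (\<lambda>i\<in>{..<p}. \<theta> i + sqrt \<gamma> * w (g i) + sqrt (1 - \<gamma>) * z i) \<partial>std_gauss p)"
      by (intro nn_integral_distr measurable_restrict) auto
    finally show "(\<integral>\<^sup>+x. D w x * f x \<partial>?X)
      = (\<integral>\<^sup>+z. f (\<lambda>i\<in>{..<p}. \<theta> i + sqrt \<gamma> * w (g i) + sqrt (1 - \<gamma>) * z i) \<partial>std_gauss p)" .
  qed
  also have "\<dots> = (\<integral>\<^sup>+w. \<integral>\<^sup>+z. f (\<lambda>i\<in>{..<p}. \<theta> i + sqrt \<gamma> * w (g i) + sqrt (1 - \<gamma>) * z i) \<partial>std_gauss p \<partial>std_gauss R)"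
    unfolding std_gauss_eq_density[of R] H_def[symmetric]
    by (rule nn_integral_density[symmetric]) measurable
  finally show ?thesis .
qed

text \<open>
  Probabilities under the law of the observation are averages, over the common factors, of
  probabilities in the model with independent coordinates.
\<close>

lemma measure_mvn_cov:
  fixes \<theta> :: "nat \<Rightarrow> real"
  assumes \<gamma>: "0 \<le> \<gamma>" "\<gamma> < 1" and S: "Measurable.pred (Pi\<^sub>M {..<p} (\<lambda>_. borel)) S"
  defines "Q \<equiv> \<lambda>w. \<P>(z in std_gauss p. S (\<lambda>i\<in>{..<p}. \<theta> i + sqrt \<gamma> * w (g i) + sqrt (1 - \<gamma>) * z i))"
  shows "integrable (std_gauss R) Q" and "\<P>(x in mvn p \<theta> (cov \<gamma>). S x) = (\<integral>w. Q w \<partial>std_gauss R)"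
proof -
  interpret N: prob_space "std_gauss p" by simp
  interpret NR: prob_space "std_gauss R" by simp
  note S [measurable]
  have sP: "sets (mvn p \<theta> (cov \<gamma>)) = sets (Pi\<^sub>M {..<p} (\<lambda>_. borel))"
    unfolding mvn_def sets_density by (intro sets_PiM_cong) auto
  have [measurable]: "(\<lambda>(w, z). \<lambda>i\<in>{..<p}. \<theta> i + sqrt \<gamma> * w (g i) + sqrt (1 - \<gamma>) * z i)
      \<in> std_gauss R \<Otimes>\<^sub>M std_gauss p \<rightarrow>\<^sub>M Pi\<^sub>M {..<p} (\<lambda>_. borel)"
    unfolding case_prod_beta' by (intro measurable_restrict) measurable
  have map1: "(\<lambda>z. \<lambda>i\<in>{..<p}. \<theta> i + sqrt \<gamma> * w (g i) + sqrt (1 - \<gamma>) * z i) \<in> std_gauss p \<rightarrow>\<^sub>M Pi\<^sub>M {..<p} (\<lambda>_. borel)"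
    for w by (intro measurable_restrict) measurable
  have Q: "ennreal (Q w) = (\<integral>\<^sup>+z. indicator {x. S x} (\<lambda>i\<in>{..<p}. \<theta> i + sqrt \<gamma> * w (g i) + sqrt (1 - \<gamma>) * z i) \<partial>std_gauss p)" for w
  proof -
    have "(\<integral>\<^sup>+z. indicator {x. S x} (\<lambda>i\<in>{..<p}. \<theta> i + sqrt \<gamma> * w (g i) + sqrt (1 - \<gamma>) * z i) \<partial>std_gauss p)
      = (\<integral>\<^sup>+z. indicator {z \<in> space (std_gauss p). S (\<lambda>i\<in>{..<p}. \<theta> i + sqrt \<gamma> * w (g i) + sqrt (1 - \<gamma>) * z i)} z \<partial>std_gauss p)"
      by (intro nn_integral_cong) (auto simp: indicator_def)
    also have "\<dots> = emeasure (std_gauss p) {z \<in> space (std_gauss p). S (\<lambda>i\<in>{..<p}. \<theta> i + sqrt \<gamma> * w (g i) + sqrt (1 - \<gamma>) * z i)}"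
      using map1[of w] by (intro nn_integral_indicator) measurable
    finally show ?thesis by (simp add: Q_def N.emeasure_eq_measure)
  qed
  have "(\<lambda>w. ennreal (Q w)) \<in> borel_measurable (std_gauss R)"
    unfolding Q by measurable
  then have Qm [measurable]: "Q \<in> borel_measurable (std_gauss R)"
    using borel_measurable_enn2real[of "\<lambda>w. ennreal (Q w)"] by (simp add: Q_def)
  show "integrable (std_gauss R) Q"
    by (rule NR.integrable_const_bound[where B = 1]) (auto simp: Q_def)
  have "emeasure (mvn p \<theta> (cov \<gamma>)) {x \<in> space (mvn p \<theta> (cov \<gamma>)). S x}
    = (\<integral>\<^sup>+x. indicator {x. S x} x \<partial>mvn p \<theta> (cov \<gamma>))"
  proof -
    have "{x \<in> space (mvn p \<theta> (cov \<gamma>)). S x} \<in> sets (mvn p \<theta> (cov \<gamma>))"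
      using S unfolding sP sets_eq_imp_space_eq[OF sP] by (simp add: pred_def)
    then have "emeasure (mvn p \<theta> (cov \<gamma>)) {x \<in> space (mvn p \<theta> (cov \<gamma>)). S x}
      = (\<integral>\<^sup>+x. indicator {x \<in> space (mvn p \<theta> (cov \<gamma>)). S x} x \<partial>mvn p \<theta> (cov \<gamma>))"
      by (rule nn_integral_indicator[symmetric])
    also have "\<dots> = (\<integral>\<^sup>+x. indicator {x. S x} x \<partial>mvn p \<theta> (cov \<gamma>))"
      by (intro nn_integral_cong) (auto simp: indicator_def)
    finally show ?thesis .
  qed
  also have "\<dots> = (\<integral>\<^sup>+w. ennreal (Q w) \<partial>std_gauss R)"
    unfolding Q by (intro nn_integral_mvn_cov[OF \<gamma>]) (auto simp: pred_def[symmetric])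
  finally show "\<P>(x in mvn p \<theta> (cov \<gamma>). S x) = (\<integral>w. Q w \<partial>std_gauss R)"
    by (subst integral_eq_nn_integral) (auto simp: measure_def Q_def)
qed

end

section \<open>Testing against a mixture of Gaussian shifts\<close>

text \<open>
  The likelihood ratio of the standard Gaussian measure shifted by \<open>\<nu>\<close> against the unshifted one.
\<close>

definition gauss_shift_density :: "nat \<Rightarrow> (nat \<Rightarrow> real) \<Rightarrow> (nat \<Rightarrow> real) \<Rightarrow> real" where
  "gauss_shift_density p \<nu> z = exp (\<Sum>i<p. \<nu> i * z i - (\<nu> i)\<^sup>2 / 2)"

lemma gauss_shift_density_measurable [measurable]:
  "gauss_shift_density p \<nu> \<in> borel_measurable (std_gauss p)"
  unfolding gauss_shift_density_def by measurable

lemma gauss_shift_density_pos: "gauss_shift_density p \<nu> z > 0"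
  by (simp add: gauss_shift_density_def)

lemma distr_std_gauss_shift:
  "distr (std_gauss p) (Pi\<^sub>M {..<p} (\<lambda>_. borel)) (\<lambda>z. \<lambda>i\<in>{..<p}. \<nu> i + z i)
    = density (std_gauss p) (\<lambda>z. ennreal (gauss_shift_density p \<nu> z))"
proof -
  have dens: "density std_normal_distribution (\<lambda>z. ennreal (exp (a * z - a\<^sup>2 / 2))) = density lborel (normal_density a 1)" for a
  proof -
    have "std_normal_density z * exp (a * z - a\<^sup>2 / 2) = normal_density a 1 z" for z
      unfolding normal_density_def std_normal_density_def
      by (simp add: mult_exp_exp power2_eq_square algebra_simps add_divide_distrib diff_divide_distrib)
    then show ?thesis
      by (subst density_density_eq) (auto simp: ennreal_mult[symmetric] intro!: density_cong)
  qed
  have "distr (std_gauss p) (Pi\<^sub>M {..<p} (\<lambda>_. borel)) (\<lambda>z. \<lambda>i\<in>{..<p}. \<nu> i + z i)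
    = Pi\<^sub>M {..<p} (\<lambda>i. distr std_normal_distribution borel (\<lambda>z. \<nu> i + z))"
    unfolding std_gauss_def by (rule distr_PiM_componentwise) auto
  also have "\<dots> = Pi\<^sub>M {..<p} (\<lambda>i. density std_normal_distribution (\<lambda>z. ennreal (exp (\<nu> i * z - (\<nu> i)\<^sup>2 / 2))))"
    using distr_std_normal_affine[of 1] by (simp add: dens)
  also have "\<dots> = density (std_gauss p) (\<lambda>x. \<Prod>i<p. ennreal (exp (\<nu> i * x i - (\<nu> i)\<^sup>2 / 2)))"
    unfolding std_gauss_def
    by (rule PiM_density) (auto intro!: prob_space_imp_sigma_finite prob_space_normal_density simp: dens)
  also have "\<dots> = density (std_gauss p) (\<lambda>z. ennreal (gauss_shift_density p \<nu> z))"
    by (simp add: prod_ennreal gauss_shift_density_def exp_sum)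
  finally show ?thesis .
qed

lemma shift_measurable [measurable]:
  "(\<lambda>z. \<lambda>i\<in>{..<p}. \<nu> i + z i) \<in> std_gauss p \<rightarrow>\<^sub>M Pi\<^sub>M {..<p} (\<lambda>_. borel)"
  by (intro measurable_restrict) measurable

lemma gauss_shift_density_integral:
  shows "integrable (std_gauss p) (gauss_shift_density p \<nu>)"
    and "(\<integral>z. gauss_shift_density p \<nu> z \<partial>std_gauss p) = 1"
proof -
  interpret N: prob_space "std_gauss p" by simp
  have "prob_space (density (std_gauss p) (\<lambda>z. ennreal (gauss_shift_density p \<nu> z)))"
    unfolding distr_std_gauss_shift[symmetric] by (rule N.prob_space_distr) measurable
  from prob_space.emeasure_space_1[OF this]
  have "(\<integral>\<^sup>+z. ennreal (gauss_shift_density p \<nu> z) \<partial>std_gauss p) = 1"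
    by (simp add: emeasure_density nn_integral_set_ennreal[symmetric] mult_indicator_subset cong: nn_integral_cong)
  then have "has_bochner_integral (std_gauss p) (gauss_shift_density p \<nu>) 1"
    by (intro has_bochner_integral_nn_integral) (auto simp: gauss_shift_density_pos less_imp_le)
  then show "integrable (std_gauss p) (gauss_shift_density p \<nu>)"
    and "(\<integral>z. gauss_shift_density p \<nu> z \<partial>std_gauss p) = 1"
    by (auto simp: has_bochner_integral_iff)
qed

lemma gauss_shift_density_mult:
  "gauss_shift_density p \<nu> z * gauss_shift_density p \<mu> z
    = exp (\<Sum>i<p. \<nu> i * \<mu> i) * gauss_shift_density p (\<lambda>i. \<nu> i + \<mu> i) z"
proof -
  have "(\<Sum>i<p. \<nu> i * z i - (\<nu> i)\<^sup>2 / 2) + (\<Sum>i<p. \<mu> i * z i - (\<mu> i)\<^sup>2 / 2)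
    = (\<Sum>i<p. \<nu> i * \<mu> i) + (\<Sum>i<p. (\<nu> i + \<mu> i) * z i - (\<nu> i + \<mu> i)\<^sup>2 / 2)"
    unfolding sum.distrib[symmetric]
    by (intro sum.cong) (auto simp: power2_eq_square field_simps)
  then show ?thesis unfolding gauss_shift_density_def by (simp add: mult_exp_exp)
qed

text \<open>
  The sum of the two error probabilities of a test of \<open>M\<close> against the measure with density \<open>L\<close>,
  where \<open>A\<close> is the rejection region, is at least \<open>1\<close> minus the square root of the chi-square divergence.
\<close>

lemma (in prob_space) second_moment_testing_bound:
  fixes L :: "'a \<Rightarrow> real"
  assumes A [measurable]: "A \<in> events"
    and L: "integrable M L" "integrable M (\<lambda>x. (L x)\<^sup>2)" "expectation L = 1"
  shows "prob A + (\<integral>x. L x * indicator (space M - A) x \<partial>M) \<ge> 1 - sqrt (expectation (\<lambda>x. (L x)\<^sup>2) - 1)"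
proof -
  note [measurable] = borel_measurable_integrable[OF L(1)]
  define D where "D x = L x - 1" for x
  have D: "integrable M D" and D2: "integrable M (\<lambda>x. (D x)\<^sup>2)"
    and eD2: "expectation (\<lambda>x. (D x)\<^sup>2) = expectation (\<lambda>x. (L x)\<^sup>2) - 1"
    using L by (simp_all add: D_def[abs_def] power2_diff prob_space)
  have "(expectation (\<lambda>x. \<bar>D x\<bar>))\<^sup>2 \<le> expectation (\<lambda>x. (D x)\<^sup>2)"
    using variance_positive[of "\<lambda>x. \<bar>D x\<bar>"] variance_eq[of "\<lambda>x. \<bar>D x\<bar>"] D D2 by simp
  then have "expectation (\<lambda>x. \<bar>D x\<bar>) \<le> sqrt (expectation (\<lambda>x. (L x)\<^sup>2) - 1)"
    unfolding eD2[symmetric] by (rule real_le_rsqrt)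
  moreover have "(\<integral>x. - \<bar>D x\<bar> \<partial>M) \<le> (\<integral>x. D x * indicator (space M - A) x \<partial>M)"
    using D by (intro integral_mono integrable_real_mult_indicator) (auto simp: indicator_def)
  moreover have "(\<integral>x. D x * indicator (space M - A) x \<partial>M)
    = (\<integral>x. L x * indicator (space M - A) x \<partial>M) - prob (space M - A)"
  proof -
    have "(\<integral>x. D x * indicator (space M - A) x \<partial>M)
      = (\<integral>x. L x * indicator (space M - A) x - indicator (space M - A) x \<partial>M)"
      by (intro Bochner_Integration.integral_cong) (auto simp: D_def indicator_def)
    also have "\<dots> = (\<integral>x. L x * indicator (space M - A) x \<partial>M) - (\<integral>x. indicator (space M - A) x \<partial>M)"
      using L by (intro Bochner_Integration.integral_diff integrable_real_mult_indicator integrable_real_indicator)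
        (auto simp: emeasure_eq_measure)
    finally show ?thesis by simp
  qed
  ultimately show ?thesis using prob_compl[OF A] by simp
qed

text \<open>
  The alternative is the uniform mixture of the shifts \<open>\<nu> f\<close> for \<open>f \<in> F\<close>; \<open>S\<close> is the event of rejection.
\<close>

lemma gauss_mixture_testing_bound:
  fixes \<nu> :: "'f \<Rightarrow> nat \<Rightarrow> real"
  assumes F: "finite F" "F \<noteq> {}" and S: "Measurable.pred (Pi\<^sub>M {..<p} (\<lambda>_. borel)) S"
  shows "\<P>(z in std_gauss p. S z)
      + (\<Sum>f\<in>F. \<P>(z in std_gauss p. \<not> S (\<lambda>i\<in>{..<p}. \<nu> f i + z i))) / real (card F)
    \<ge> 1 - sqrt ((\<Sum>f\<in>F. \<Sum>h\<in>F. exp (\<Sum>i<p. \<nu> f i * \<nu> h i)) / (real (card F))\<^sup>2 - 1)"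
proof -
  interpret N: prob_space "std_gauss p" by simp
  have S' [measurable]: "Measurable.pred (std_gauss p) S"
    unfolding measurable_cong_sets[OF sets_std_gauss refl] by (rule S)
  let ?l = "\<lambda>f. gauss_shift_density p (\<nu> f)"
  define c where "c = real (card F)"
  have c: "c > 0" using F by (simp add: c_def card_gt_0_iff)
  define L where "L z = (\<Sum>f\<in>F. ?l f z) / c" for z
  have sq: "(L z)\<^sup>2 = (\<Sum>f\<in>F. \<Sum>h\<in>F. exp (\<Sum>i<p. \<nu> f i * \<nu> h i) * gauss_shift_density p (\<lambda>i. \<nu> f i + \<nu> h i) z) / c\<^sup>2" for z
    unfolding L_def power_divide by (simp add: power2_eq_square sum_product gauss_shift_density_mult)
  have L: "integrable (std_gauss p) L" "integrable (std_gauss p) (\<lambda>z. (L z)\<^sup>2)"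
    unfolding sq unfolding L_def
    by (intro Bochner_Integration.integrable_sum integrable_divide_zero integrable_mult_right gauss_shift_density_integral; simp)+
  have eL: "N.expectation L = 1"
    unfolding L_def using c by (simp add: gauss_shift_density_integral Bochner_Integration.integral_sum c_def)
  have eL2: "N.expectation (\<lambda>z. (L z)\<^sup>2) = (\<Sum>f\<in>F. \<Sum>h\<in>F. exp (\<Sum>i<p. \<nu> f i * \<nu> h i)) / c\<^sup>2"
    unfolding sq by (simp add: gauss_shift_density_integral Bochner_Integration.integral_sum)
  define A where "A = {z \<in> space (std_gauss p). S z}"
  have A [measurable]: "A \<in> sets (std_gauss p)" unfolding A_def by measurable
  have shift: "\<P>(z in std_gauss p. \<not> S (\<lambda>i\<in>{..<p}. \<nu> f i + z i))
    = (\<integral>z. ?l f z * indicator (space (std_gauss p) - A) z \<partial>std_gauss p)" for f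
  proof -
    let ?C = "space (std_gauss p) - A"
    have C: "?C \<in> sets (Pi\<^sub>M {..<p} (\<lambda>_. borel))"
      using sets.compl_sets[OF A] by (simp only: sets_std_gauss)
    have "{z \<in> space (std_gauss p). \<not> S (\<lambda>i\<in>{..<p}. \<nu> f i + z i)}
        = (\<lambda>z. \<lambda>i\<in>{..<p}. \<nu> f i + z i) -` ?C \<inter> space (std_gauss p)"
      by (auto simp: A_def space_std_gauss Rn_def)
    then have "emeasure (std_gauss p) {z \<in> space (std_gauss p). \<not> S (\<lambda>i\<in>{..<p}. \<nu> f i + z i)}
      = emeasure (distr (std_gauss p) (Pi\<^sub>M {..<p} (\<lambda>_. borel)) (\<lambda>z. \<lambda>i\<in>{..<p}. \<nu> f i + z i)) ?C"
      by (subst emeasure_distr[OF shift_measurable C]) simp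
    also have "\<dots> = (\<integral>\<^sup>+z. ennreal (?l f z) * indicator ?C z \<partial>std_gauss p)"
      unfolding distr_std_gauss_shift by (rule emeasure_density) auto
    also have "\<dots> = (\<integral>\<^sup>+z. ennreal (?l f z * indicator ?C z) \<partial>std_gauss p)"
      by (intro nn_integral_cong) (auto simp: indicator_def)
    finally show ?thesis
      by (subst integral_eq_nn_integral) (auto simp: measure_def gauss_shift_density_pos less_imp_le)
  qed
  have "(\<integral>z. L z * indicator (space (std_gauss p) - A) z \<partial>std_gauss p)
    = (\<integral>z. (\<Sum>f\<in>F. ?l f z * indicator (space (std_gauss p) - A) z) / c \<partial>std_gauss p)"
    by (simp add: L_def sum_distrib_right)
  also have "\<dots> = (\<Sum>f\<in>F. \<integral>z. ?l f z * indicator (space (std_gauss p) - A) z \<partial>std_gauss p) / c"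
    by (simp add: Bochner_Integration.integral_sum integrable_real_mult_indicator gauss_shift_density_integral)
  also have "\<dots> = (\<Sum>f\<in>F. \<P>(z in std_gauss p. \<not> S (\<lambda>i\<in>{..<p}. \<nu> f i + z i))) / c"
    by (simp only: shift)
  finally show ?thesis
    using N.second_moment_testing_bound[OF A L eL] unfolding eL2 c_def[symmetric] A_def by simp
qed

section \<open>The lower bound\<close>

text \<open>
  The first \<open>n * q\<close> coordinates form \<open>n\<close> consecutive blocks of size \<open>q\<close>; the signal is \<open>\<rho>\<close> at
  position \<open>f j\<close> of block \<open>j\<close> and \<open>0\<close> elsewhere.
\<close>

definition block_signal :: "real \<Rightarrow> nat \<Rightarrow> nat \<Rightarrow> (nat \<Rightarrow> nat) \<Rightarrow> nat \<Rightarrow> real" where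
  "block_signal \<rho> n q f i = (if i < n * q \<and> f (i div q) = i mod q then \<rho> else 0)"

lemma sum_block_signal_mult:
  assumes nq: "n * q \<le> p" and f: "f \<in> {..<n} \<rightarrow>\<^sub>E {..<q}"
  shows "(\<Sum>i<p. block_signal \<rho> n q f i * block_signal \<rho> n q h i) = (\<Sum>j<n. if f j = h j then \<rho>\<^sup>2 else 0)"
proof -
  have "(\<Sum>i<p. block_signal \<rho> n q f i * block_signal \<rho> n q h i)
    = (\<Sum>i<n * q. block_signal \<rho> n q f i * block_signal \<rho> n q h i)"
    using nq by (intro sum.mono_neutral_right) (auto simp: block_signal_def)
  also have "\<dots> = (\<Sum>j<n. \<Sum>i\<in>{j * q..<j * q + q}. block_signal \<rho> n q f i * block_signal \<rho> n q h i)"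
    by (rule sum.nat_group[symmetric])
  also have "\<dots> = (\<Sum>j<n. if f j = h j then \<rho>\<^sup>2 else 0)"
  proof (intro sum.cong refl)
    fix j assume j: "j \<in> {..<n}"
    then have fj: "f j < q" using f by auto
    have "(\<Sum>i\<in>{j * q..<j * q + q}. block_signal \<rho> n q f i * block_signal \<rho> n q h i)
      = (\<Sum>a\<in>{0..<q}. block_signal \<rho> n q f (a + j * q) * block_signal \<rho> n q h (a + j * q))"
      using sum.shift_bounds_nat_ivl[of "\<lambda>i. block_signal \<rho> n q f i * block_signal \<rho> n q h i" 0 "j * q" q]
      by (simp add: add.commute)
    also have "\<dots> = (\<Sum>a\<in>{0..<q}. if a = f j then (if f j = h j then \<rho>\<^sup>2 else 0) else 0)"
    proof (intro sum.cong refl)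
      fix a assume a: "a \<in> {0..<q}"
      have "Suc j * q \<le> n * q" using j by (intro mult_right_mono) auto
      then have "a + j * q < n * q" using a by auto
      then show "block_signal \<rho> n q f (a + j * q) * block_signal \<rho> n q h (a + j * q)
        = (if a = f j then (if f j = h j then \<rho>\<^sup>2 else 0) else 0)"
        using a by (auto simp: block_signal_def power2_eq_square)
    qed
    also have "\<dots> = (if f j = h j then \<rho>\<^sup>2 else 0)" using fj by simp
    finally show "(\<Sum>i\<in>{j * q..<j * q + q}. block_signal \<rho> n q f i * block_signal \<rho> n q h i)
      = (if f j = h j then \<rho>\<^sup>2 else 0)" .
  qed
  finally show ?thesis .
qed

text \<open>
  The second moment of the likelihood ratio of the uniform mixture of block signals.
\<close>

lemma sum_exp_overlap:
  fixes \<rho> :: real and n q :: nat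
  assumes q: "q \<ge> 1"
  defines "F \<equiv> {..<n} \<rightarrow>\<^sub>E {..<q}"
  shows "(\<Sum>f\<in>F. \<Sum>h\<in>F. exp (\<Sum>j<n. if f j = h j then \<rho>\<^sup>2 else 0)) / (real (card F))\<^sup>2
    = (1 + (exp (\<rho>\<^sup>2) - 1) / real q) ^ n"
proof -
  have card: "real (card F) = real q ^ n" by (simp add: F_def card_PiE)
  have "(\<Sum>h\<in>F. exp (\<Sum>j<n. if f j = h j then \<rho>\<^sup>2 else 0)) = (real q - 1 + exp (\<rho>\<^sup>2)) ^ n"
    if f: "f \<in> F" for f
  proof -
    have "(\<Sum>h\<in>F. exp (\<Sum>j<n. if f j = h j then \<rho>\<^sup>2 else 0))
      = (\<Sum>h\<in>F. \<Prod>j<n. if f j = h j then exp (\<rho>\<^sup>2) else 1)"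
      by (intro sum.cong refl) (simp add: exp_sum if_distrib cong: if_cong)
    also have "\<dots> = (\<Prod>j<n. \<Sum>a<q. if f j = a then exp (\<rho>\<^sup>2) else 1)"
      unfolding F_def by (rule prod_sum_PiE[symmetric]) auto
    also have "\<dots> = (\<Prod>j<n. real q - 1 + exp (\<rho>\<^sup>2))"
    proof (intro prod.cong refl)
      fix j assume "j \<in> {..<n}"
      then have fj: "f j < q" using f by (auto simp: F_def)
      have "(\<Sum>a<q. if f j = a then exp (\<rho>\<^sup>2) else 1) = (\<Sum>a<q. 1 + (if a = f j then exp (\<rho>\<^sup>2) - 1 else 0))"
        by (intro sum.cong) auto
      also have "\<dots> = real q - 1 + exp (\<rho>\<^sup>2)"
        using fj by (simp add: sum.distrib)
      finally show "(\<Sum>a<q. if f j = a then exp (\<rho>\<^sup>2) else 1) = real q - 1 + exp (\<rho>\<^sup>2)" .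
    qed
    finally show ?thesis by simp
  qed
  then have "(\<Sum>f\<in>F. \<Sum>h\<in>F. exp (\<Sum>j<n. if f j = h j then \<rho>\<^sup>2 else 0))
    = real q ^ n * (real q - 1 + exp (\<rho>\<^sup>2)) ^ n"
    by (simp add: card)
  also have "\<dots> / (real (card F))\<^sup>2 = ((real q - 1 + exp (\<rho>\<^sup>2)) / real q) ^ n"
    using q unfolding card by (simp add: power2_eq_square power_divide)
  also have "(real q - 1 + exp (\<rho>\<^sup>2)) / real q = 1 + (exp (\<rho>\<^sup>2) - 1) / real q"
    using q by (simp add: field_simps)
  finally show ?thesis .
qed

lemma overlap_bound:
  fixes b :: real and n p :: nat
  assumes n: "1 \<le> n" "n * n \<le> p" and b: "0 < b" "b \<le> 1 / 2"
  defines "\<rho> \<equiv> b * sqrt (ln (1 + real p / (real n)\<^sup>2))"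
  shows "(1 + (exp (\<rho>\<^sup>2) - 1) / real (p div n)) ^ n \<le> 1 + (2 * b)\<^sup>2"
proof -
  define x where "x = real p / (real n)\<^sup>2"
  have x: "x \<ge> 0" by (simp add: x_def)
  define q where "q = p div n"
  have np: "n \<le> p" using n le_trans[OF _ n(2), of n] by simp
  have q: "q \<ge> 1" unfolding q_def using n(1) np by (simp add: Suc_le_eq div_greater_zero_iff)
  have "real p < real n * (real q + 1)"
  proof -
    have "p < n * (q + 1)" using n(1) unfolding q_def
      using dividend_less_times_div[of n p] by simp
    then have "real p < real (n * (q + 1))" by (simp only: of_nat_less_iff)
    then show ?thesis by (simp add: algebra_simps)
  qed
  also have "\<dots> \<le> real n * (2 * real q)" using q by (intro mult_left_mono) auto
  finally have pq: "real p \<le> 2 * real n * real q" by simp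
  have "\<rho>\<^sup>2 = b\<^sup>2 * ln (1 + x)"
    using x by (simp add: \<rho>_def power_mult_distrib x_def[symmetric])
  moreover have "exp (b\<^sup>2 * ln (1 + x)) \<le> (1 - b\<^sup>2) * 1 + b\<^sup>2 * (1 + x)"
  proof -
    have b2: "b\<^sup>2 \<le> 1" using b by (intro power_le_one) auto
    \<comment> \<open>Bernoulli's inequality \<open>(1 + x) powr a \<le> 1 + a * x\<close> for \<open>0 \<le> a \<le> 1\<close>, as convexity of \<open>exp\<close>.\<close>
    have "convex_on UNIV (exp :: real \<Rightarrow> real)" by (rule exp_convex)
    from convex_onD[OF this, of "b\<^sup>2" 0 "ln (1 + x)"] show ?thesis
      using b2 x by simp
  qed
  ultimately have e: "exp (\<rho>\<^sup>2) - 1 \<le> b\<^sup>2 * x" by (simp add: algebra_simps)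
  have e0: "0 \<le> exp (\<rho>\<^sup>2) - 1" by simp
  have "(1 + (exp (\<rho>\<^sup>2) - 1) / real q) ^ n \<le> exp ((exp (\<rho>\<^sup>2) - 1) / real q) ^ n"
    using e0 by (intro power_mono exp_ge_add_one_self) (simp add: add_nonneg_nonneg)
  also have "\<dots> = exp (real n * ((exp (\<rho>\<^sup>2) - 1) / real q))"
    by (simp only: exp_of_nat_mult)
  also have "\<dots> \<le> exp (2 * b\<^sup>2)"
  proof -
    have "real n * ((exp (\<rho>\<^sup>2) - 1) / real q) \<le> real n * ((b\<^sup>2 * x) / real q)"
      using e by (intro mult_left_mono divide_right_mono) auto
    also have "\<dots> = b\<^sup>2 * (real p / (real n * real q))"
      using n(1) by (simp add: x_def power2_eq_square)
    also have "\<dots> \<le> b\<^sup>2 * 2"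
      using pq n(1) q by (intro mult_left_mono) (auto simp: divide_le_eq)
    finally show ?thesis by simp
  qed
  also have "\<dots> \<le> 1 + (2 * b)\<^sup>2"
  proof -
    have "b\<^sup>2 \<le> (1 / 2)\<^sup>2" using b by (intro power_mono) auto
    then have "2 * b\<^sup>2 \<le> 1" by (simp add: power2_eq_square)
    then have "exp (2 * b\<^sup>2) \<le> 1 + 2 * b\<^sup>2 + (2 * b\<^sup>2)\<^sup>2" by (intro exp_bound) auto
    also have "(2 * b\<^sup>2)\<^sup>2 \<le> 2 * b\<^sup>2 * 1"
      using \<open>2 * b\<^sup>2 \<le> 1\<close> unfolding power2_eq_square[of "2 * b\<^sup>2"] by (intro mult_left_mono) auto
    finally show ?thesis by (simp add: power_mult_distrib)
  qed
  finally show ?thesis unfolding q_def .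
qed

lemma tests_pred:
  assumes "\<phi> \<in> tests p"
  shows "Measurable.pred (Pi\<^sub>M {..<p} (\<lambda>_. borel)) (\<lambda>x. \<phi> x = a)"
  using assms unfolding tests_def by (intro measurable_compose[OF _ pred_count_space_const1]) auto

lemma (in labelled_groups) bdd_above_type_two_error:
  assumes \<gamma>: "0 \<le> \<gamma>" "\<gamma> < 1" and \<phi>: "\<phi> \<in> tests p"
  shows "bdd_above ((\<lambda>\<theta>. \<P>(x in mvn p \<theta> (cov \<gamma>). \<phi> x = 0)) ` A)"
proof (rule bdd_aboveI2[where M = 1])
  interpret N: prob_space "std_gauss p" by simp
  interpret NR: prob_space "std_gauss R" by simp
  fix \<theta>
  have "\<P>(x in mvn p \<theta> (cov \<gamma>). \<phi> x = 0)
    = (\<integral>w. \<P>(z in std_gauss p. \<phi> (\<lambda>i\<in>{..<p}. \<theta> i + sqrt \<gamma> * w (g i) + sqrt (1 - \<gamma>) * z i) = 0) \<partial>std_gauss R)"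
    by (rule measure_mvn_cov(2)[OF \<gamma> tests_pred[OF \<phi>]])
  also have "\<dots> \<le> (\<integral>w. 1 \<partial>std_gauss R)"
    by (intro integral_mono measure_mvn_cov(1)[OF \<gamma> tests_pred[OF \<phi>]]) auto
  finally show "\<P>(x in mvn p \<theta> (cov \<gamma>). \<phi> x = 0) \<le> 1" by (simp add: NR.prob_space)
qed

text \<open>
  The parameter \<open>n\<close> is the sparsity of the prior. It may be smaller than \<open>s\<close>, which is how
  \<open>s > sqrt p\<close> is covered.
\<close>

lemma (in labelled_groups) risk_lower_bound:
  fixes \<epsilon> b \<gamma> :: real
  assumes \<gamma>: "0 \<le> \<gamma>" "\<gamma> < 1" and n: "1 \<le> n" "n * n \<le> p" "n \<le> s" and b: "0 < b" "b \<le> 1 / 2"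
    and \<epsilon>: "\<epsilon> \<le> b * sqrt ((1 - \<gamma>) * real n * ln (1 + real p / (real n)\<^sup>2))"
    and \<phi>: "\<phi> \<in> tests p"
  shows "1 - 2 * b \<le> \<P>(x in mvn p (\<lambda>i\<in>{..<p}. 0) (cov \<gamma>). \<phi> x = 1)
      + (SUP \<theta>\<in>sparse_alt p s \<epsilon>. \<P>(x in mvn p \<theta> (cov \<gamma>). \<phi> x = 0))"
proof -
  interpret N: prob_space "std_gauss p" by simp
  interpret NR: prob_space "std_gauss R" by simp
  define \<rho> where "\<rho> = b * sqrt (ln (1 + real p / (real n)\<^sup>2))"
  define q where "q = p div n"
  have np: "n \<le> p" using n le_trans[OF _ n(2), of n] by simp
  have q: "q \<ge> 1" unfolding q_def using n(1) np by (simp add: Suc_le_eq div_greater_zero_iff)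
  have nq: "n * q \<le> p" unfolding q_def by simp
  have L: "ln (1 + real p / (real n)\<^sup>2) > 0"
    using n(1) np by (intro ln_gt_zero) simp
  then have \<rho>: "\<rho> > 0" using b by (simp add: \<rho>_def)
  define F where "F = {..<n} \<rightarrow>\<^sub>E {..<q}"
  have F: "finite F" "F \<noteq> {}" using q by (auto simp: F_def finite_PiE PiE_eq_empty_iff lessThan_empty_iff)
  define \<nu> where "\<nu> = block_signal \<rho> n q"
  define \<theta> where "\<theta> f = (\<lambda>i\<in>{..<p}. sqrt (1 - \<gamma>) * \<nu> f i)" for f
  define c where "c = real (card F)"
  have c: "c > 0" using F by (simp add: c_def card_gt_0_iff)
  have sq: "(\<Sum>i<p. (\<nu> f i)\<^sup>2) = real n * \<rho>\<^sup>2" if "f \<in> F" for f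
    using sum_block_signal_mult[OF nq, of f \<rho> f] that unfolding F_def \<nu>_def by (simp add: power2_eq_square)
  have alt: "\<theta> f \<in> sparse_alt p s \<epsilon>" if f: "f \<in> F" for f
  proof -
    have "(\<Sum>i<p. (\<theta> f i)\<^sup>2) = (1 - \<gamma>) * (\<Sum>i<p. (\<nu> f i)\<^sup>2)"
      using \<gamma> by (simp add: \<theta>_def power_mult_distrib sum_distrib_left)
    then have "L2_set (\<theta> f) {..<p} = sqrt ((1 - \<gamma>) * (real n * \<rho>\<^sup>2))"
      by (simp add: L2_set_def sq[OF f])
    also have "(1 - \<gamma>) * (real n * \<rho>\<^sup>2) = b\<^sup>2 * ((1 - \<gamma>) * real n * ln (1 + real p / (real n)\<^sup>2))"
      using L by (simp add: \<rho>_def power_mult_distrib)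
    also have "sqrt \<dots> = b * sqrt ((1 - \<gamma>) * real n * ln (1 + real p / (real n)\<^sup>2))"
      using b by (simp only: real_sqrt_mult real_sqrt_abs abs_of_pos)
    finally have norm: "L2_set (\<theta> f) {..<p} \<ge> \<epsilon>" using \<epsilon> by simp
    have nz: "{i \<in> {..<p}. \<theta> f i \<noteq> 0} = {i \<in> {..<p}. \<nu> f i \<noteq> 0}"
      using \<gamma> by (auto simp: \<theta>_def)
    have "real n * \<rho>\<^sup>2 = (\<Sum>i<p. if \<nu> f i \<noteq> 0 then \<rho>\<^sup>2 else 0)"
      unfolding sq[OF f, symmetric] by (intro sum.cong) (auto simp: \<nu>_def block_signal_def)
    also have "\<dots> = real (card {i \<in> {..<p}. \<nu> f i \<noteq> 0}) * \<rho>\<^sup>2"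
      by (subst sum.inter_filter[symmetric]) auto
    finally have "card {i \<in> {..<p}. \<theta> f i \<noteq> 0} = n" using \<rho> unfolding nz by simp
    then show ?thesis using norm n(3) by (simp add: sparse_alt_def Rn_def \<theta>_def)
  qed
  have \<phi>m [measurable]: "Measurable.pred (Pi\<^sub>M {..<p} (\<lambda>_. borel)) (\<lambda>x. \<phi> x = a)" for a
    by (rule tests_pred[OF \<phi>])
  have \<phi>01: "\<phi> x \<in> {0, 1}" if "x \<in> Rn p" for x
    using measurable_space[of \<phi> "Pi\<^sub>M {..<p} (\<lambda>_. borel)" "count_space {0, 1}" x] \<phi> that
    by (auto simp: tests_def Rn_def space_PiM)
  define S where "S w z \<longleftrightarrow> \<phi> (\<lambda>i\<in>{..<p}. sqrt \<gamma> * w (g i) + sqrt (1 - \<gamma>) * z i) = 1" for w z :: "nat \<Rightarrow> real"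
  define Q0 where "Q0 w = \<P>(z in std_gauss p. S w z)" for w
  define Q1 where "Q1 f w = \<P>(z in std_gauss p. \<not> S w (\<lambda>i\<in>{..<p}. \<nu> f i + z i))" for f w
  have "\<P>(z in std_gauss p. \<phi> (\<lambda>i\<in>{..<p}. (\<lambda>i\<in>{..<p}. 0) i + sqrt \<gamma> * w (g i) + sqrt (1 - \<gamma>) * z i) = 1) = Q0 w" for w
    unfolding Q0_def S_def by (intro arg_cong[where f = "measure _"] Collect_cong conj_cong refl arg_cong2[where f = "(=)"] arg_cong[where f = \<phi>]) auto
  then have I0: "integrable (std_gauss R) Q0" "\<P>(x in mvn p (\<lambda>i\<in>{..<p}. 0) (cov \<gamma>). \<phi> x = 1) = (\<integral>w. Q0 w \<partial>std_gauss R)"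
    using measure_mvn_cov[OF \<gamma> \<phi>m, of "\<lambda>i\<in>{..<p}. 0" 1] by simp_all
  have "\<P>(z in std_gauss p. \<phi> (\<lambda>i\<in>{..<p}. \<theta> f i + sqrt \<gamma> * w (g i) + sqrt (1 - \<gamma>) * z i) = 0) = Q1 f w" for w f
  proof -
    have "\<phi> (\<lambda>i\<in>{..<p}. \<theta> f i + sqrt \<gamma> * w (g i) + sqrt (1 - \<gamma>) * z i) = 0 \<longleftrightarrow> \<not> S w (\<lambda>i\<in>{..<p}. \<nu> f i + z i)" for z
    proof -
      have "(\<lambda>i\<in>{..<p}. \<theta> f i + sqrt \<gamma> * w (g i) + sqrt (1 - \<gamma>) * z i)
        = (\<lambda>i\<in>{..<p}. sqrt \<gamma> * w (g i) + sqrt (1 - \<gamma>) * (\<lambda>i\<in>{..<p}. \<nu> f i + z i) i)"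
        by (auto simp: \<theta>_def fun_eq_iff algebra_simps)
      moreover have "\<phi> (\<lambda>i\<in>{..<p}. \<theta> f i + sqrt \<gamma> * w (g i) + sqrt (1 - \<gamma>) * z i) \<in> {0, 1}"
        by (rule \<phi>01) (simp add: Rn_def)
      ultimately show ?thesis unfolding S_def by auto
    qed
    then show ?thesis by (simp add: Q1_def)
  qed
  then have I1: "integrable (std_gauss R) (Q1 f)" "\<P>(x in mvn p (\<theta> f) (cov \<gamma>). \<phi> x = 0) = (\<integral>w. Q1 f w \<partial>std_gauss R)" for f
    using measure_mvn_cov[OF \<gamma> \<phi>m, of "\<theta> f" 0] by simp_all
  \<comment> \<open>Once the common factors are fixed, \<open>\<phi>\<close> becomes a test in the independent model.\<close>
  have point: "1 - 2 * b \<le> Q0 w + (\<Sum>f\<in>F. Q1 f w) / c" for w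
  proof -
    have "(\<lambda>z. \<lambda>i\<in>{..<p}. sqrt \<gamma> * w (g i) + sqrt (1 - \<gamma>) * z i) \<in> Pi\<^sub>M {..<p} (\<lambda>_. borel) \<rightarrow>\<^sub>M Pi\<^sub>M {..<p} (\<lambda>_. borel)"
      by (intro measurable_restrict) measurable
    then have "Measurable.pred (Pi\<^sub>M {..<p} (\<lambda>_. borel)) (S w)"
      unfolding S_def[abs_def] by measurable
    from gauss_mixture_testing_bound[OF F this, of \<nu>]
    have "1 - sqrt ((\<Sum>f\<in>F. \<Sum>h\<in>F. exp (\<Sum>i<p. \<nu> f i * \<nu> h i)) / c\<^sup>2 - 1) \<le> Q0 w + (\<Sum>f\<in>F. Q1 f w) / c"
      by (simp add: Q0_def Q1_def c_def)
    moreover have "(\<Sum>f\<in>F. \<Sum>h\<in>F. exp (\<Sum>i<p. \<nu> f i * \<nu> h i)) / c\<^sup>2 = (1 + (exp (\<rho>\<^sup>2) - 1) / real q) ^ n"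
      unfolding \<nu>_def c_def using sum_exp_overlap[OF q, where n = n and \<rho> = \<rho>]
      by (simp add: sum_block_signal_mult[OF nq] F_def cong: sum.cong)
    moreover have "\<dots> \<le> 1 + (2 * b)\<^sup>2"
      unfolding \<rho>_def q_def using n b by (intro overlap_bound) auto
    then have "sqrt ((1 + (exp (\<rho>\<^sup>2) - 1) / real q) ^ n - 1) \<le> sqrt ((2 * b)\<^sup>2)"
      by (intro real_sqrt_le_mono) simp
    ultimately have "1 - sqrt ((2 * b)\<^sup>2) \<le> Q0 w + (\<Sum>f\<in>F. Q1 f w) / c"
      by (simp only:)
    moreover have "sqrt ((2 * b)\<^sup>2) = 2 * b" using b by (intro real_sqrt_unique) auto
    ultimately show ?thesis by simp
  qed
  have "1 - 2 * b = (\<integral>w. 1 - 2 * b \<partial>std_gauss R)" by (simp add: NR.prob_space)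
  also have "\<dots> \<le> (\<integral>w. Q0 w + (\<Sum>f\<in>F. Q1 f w) / c \<partial>std_gauss R)"
    using I0 I1 point by (intro integral_mono Bochner_Integration.integrable_add Bochner_Integration.integrable_sum integrable_divide_zero) auto
  also have "\<dots> = (\<integral>w. Q0 w \<partial>std_gauss R) + (\<Sum>f\<in>F. \<integral>w. Q1 f w \<partial>std_gauss R) / c"
    using I0 I1 by (simp add: Bochner_Integration.integral_sum)
  also have "\<dots> \<le> (\<integral>w. Q0 w \<partial>std_gauss R) + (SUP \<theta>\<in>sparse_alt p s \<epsilon>. \<P>(x in mvn p \<theta> (cov \<gamma>). \<phi> x = 0))"
  proof -
    have "(\<Sum>f\<in>F. \<integral>w. Q1 f w \<partial>std_gauss R) \<le> (\<Sum>f\<in>F. (SUP \<theta>\<in>sparse_alt p s \<epsilon>. \<P>(x in mvn p \<theta> (cov \<gamma>). \<phi> x = 0)))"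
      unfolding I1(2)[symmetric] by (intro sum_mono cSUP_upper alt bdd_above_type_two_error[OF \<gamma> \<phi>])
    then show ?thesis using c by (simp add: c_def[symmetric] divide_le_eq mult.commute)
  qed
  finally show ?thesis unfolding I0(2) .
qed

section \<open>Truncated squares and Gaussian moments\<close>

text \<open>
  The summand of the test statistic, with the threshold \<open>\<tau>\<close> on the squared scale. It is convex, and
  \<open>above \<tau>\<close> is, up to the factor \<open>4\<close>, the square of its derivative.
\<close>

definition excess :: "real \<Rightarrow> real \<Rightarrow> real" where
  "excess \<tau> y = max (y\<^sup>2 - \<tau>) 0"

definition above :: "real \<Rightarrow> real \<Rightarrow> real" where
  "above \<tau> y = (if y\<^sup>2 > \<tau> then y\<^sup>2 else 0)"

lemma excess_measurable [measurable]: "excess \<tau> \<in> borel_measurable borel"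
  unfolding excess_def by measurable

lemma above_nonneg: "above \<tau> y \<ge> 0" by (simp add: above_def)

lemma excess_diff_sq_le:
  "(excess \<tau> y - excess \<tau> y')\<^sup>2 \<le> 4 * (y - y')\<^sup>2 * (above \<tau> y + above \<tau> y')"
proof -
  have *: "(excess \<tau> a - excess \<tau> b)\<^sup>2 \<le> 4 * (a - b)\<^sup>2 * (above \<tau> a + above \<tau> b)"
    if ab: "b\<^sup>2 \<le> a\<^sup>2" for a b
  proof (cases "a\<^sup>2 > \<tau>")
    case True
    have "\<bar>excess \<tau> a - excess \<tau> b\<bar> \<le> a\<^sup>2 - b\<^sup>2" using ab by (auto simp: excess_def)
    then have "(excess \<tau> a - excess \<tau> b)\<^sup>2 \<le> (a\<^sup>2 - b\<^sup>2)\<^sup>2"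
      by (intro power2_le_iff_abs_le[THEN iffD2]) (use ab in auto)
    also have "\<dots> = (a - b)\<^sup>2 * (a + b)\<^sup>2"
      by (simp add: power2_eq_square algebra_simps)
    also have "\<dots> \<le> (a - b)\<^sup>2 * (4 * a\<^sup>2)"
    proof (intro mult_left_mono)
      show "(a + b)\<^sup>2 \<le> 4 * a\<^sup>2"
        using ab zero_le_power2[of "a - b"] by (simp add: power2_eq_square algebra_simps)
    qed simp
    also have "\<dots> \<le> 4 * (a - b)\<^sup>2 * (above \<tau> a + above \<tau> b)"
      using True above_nonneg[of \<tau> b] by (simp add: above_def algebra_simps)
    finally show ?thesis .
  next
    case False
    then show ?thesis using ab by (simp add: excess_def above_def)
  qed
  show ?thesis
  proof (cases "y'\<^sup>2 \<le> y\<^sup>2")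
    case True
    then show ?thesis by (rule *)
  next
    case False
    then have "(excess \<tau> y' - excess \<tau> y)\<^sup>2 \<le> 4 * (y' - y)\<^sup>2 * (above \<tau> y' + above \<tau> y)"
      by (intro *) simp
    then show ?thesis by (simp add: power2_commute add.commute)
  qed
qed

lemma above_add_le: "above \<tau> (\<mu> + a) \<le> 4 * \<mu>\<^sup>2 + 4 * (if a\<^sup>2 \<ge> \<tau> / 4 then a\<^sup>2 else 0)"
proof -
  have "(\<mu> + a)\<^sup>2 \<le> 2 * \<mu>\<^sup>2 + 2 * a\<^sup>2"
    using zero_le_power2[of "\<mu> - a"] by (simp add: power2_eq_square algebra_simps)
  moreover have "(if A > \<tau> then A else 0) \<le> 4 * C + 4 * (if B \<ge> \<tau> / 4 then B else 0)"
    if "A \<le> 2 * C + 2 * B" "B \<ge> 0" "C \<ge> 0" for A B C :: real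
    using that by auto
  ultimately show ?thesis unfolding above_def by simp
qed

text \<open>
  The exponent \<open>1 / 64\<close> is small enough for the Gaussian expectations of the right-hand side below to be
  finite.
\<close>

lemma tail_product_le:
  fixes a D Q \<tau> :: real
  assumes "a\<^sup>2 \<le> Q" "D\<^sup>2 \<le> Q"
  shows "D\<^sup>2 * (if a\<^sup>2 \<ge> \<tau> / 4 then a\<^sup>2 else 0) \<le> 32768 * exp (- \<tau> / 512) * exp (Q / 64)"
proof (cases "a\<^sup>2 \<ge> \<tau> / 4")
  case True
  have Q: "Q \<ge> 0" using assms(1) zero_le_power2[of a] by linarith
  have "D\<^sup>2 * a\<^sup>2 \<le> Q * Q" using assms Q by (intro mult_mono) auto
  \<comment> \<open>\<open>exp x \<ge> x\<^sup>2 / 2\<close> at \<open>x = Q / 128\<close>, and \<open>Q\<close> is at least \<open>\<tau> / 4\<close>.\<close>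
  also have "\<dots> \<le> 32768 * exp (Q / 128)"
    using exp_lower_Taylor_quadratic[of "Q / 128"] Q by (simp add: power2_eq_square)
  also have "\<dots> \<le> 32768 * (exp (- \<tau> / 512) * exp (Q / 64))"
    using True assms(1) by (intro mult_left_mono) (auto simp: mult_exp_exp)
  finally show ?thesis using True by simp
qed simp

text \<open>
  A convex exponential weight whose standard normal expectation is \<open>sqrt 2\<close>.
\<close>

definition exp4 :: "real \<Rightarrow> real" where "exp4 x = exp (x\<^sup>2 / 4)"

lemma exp4_measurable [measurable]: "exp4 \<in> borel_measurable borel"
  unfolding exp4_def by measurable

lemma std_normal_exp4:
  shows "integrable std_normal_distribution exp4"
    and "(\<integral>x. exp4 x \<partial>std_normal_distribution) \<le> 2"
proof -
  have eq: "std_normal_density x * exp4 x = sqrt 2 * normal_density 0 (sqrt 2) x" for x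
  proof -
    have "exp (- x\<^sup>2 / 2) * exp (x\<^sup>2 / 4) = exp (- x\<^sup>2 / 4)" by (simp add: mult_exp_exp)
    then show ?thesis
      by (simp add: normal_density_def exp4_def real_sqrt_mult field_simps)
  qed
  show "integrable std_normal_distribution exp4"
    by (subst integrable_density) (auto simp: eq)
  have "(\<integral>x. exp4 x \<partial>std_normal_distribution) = sqrt 2"
    by (subst integral_density) (auto simp: eq)
  also have "\<dots> \<le> 2" by (rule real_le_lsqrt) auto
  finally show "(\<integral>x. exp4 x \<partial>std_normal_distribution) \<le> 2" .
qed

lemma std_normal_sq:
  shows "integrable std_normal_distribution (\<lambda>x. x\<^sup>2)"
    and "(\<integral>x. x\<^sup>2 \<partial>std_normal_distribution) = 1"
  using std_normal_distribution_even_moments[of 1] by simp_all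

lemma integral_component_std_gauss:
  fixes f :: "real \<Rightarrow> real"
  assumes i: "i < n" and f: "integrable std_normal_distribution f"
  shows "integrable (std_gauss n) (\<lambda>z. f (z i))"
    and "(\<integral>z. f (z i) \<partial>std_gauss n) = (\<integral>x. f x \<partial>std_normal_distribution)"
proof -
  have d: "distr (std_gauss n) std_normal_distribution (\<lambda>z. z i) = std_normal_distribution"
    unfolding std_gauss_def using i by (intro distr_PiM_component) auto
  have m: "(\<lambda>z. z i) \<in> std_gauss n \<rightarrow>\<^sub>M std_normal_distribution"
    unfolding std_gauss_def using i by (intro measurable_component_singleton) auto
  have f': "f \<in> borel_measurable std_normal_distribution" using f by auto
  show "integrable (std_gauss n) (\<lambda>z. f (z i))"
    using f by (subst integrable_distr_eq[OF m f', symmetric]) (simp add: d)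
  show "(\<integral>z. f (z i) \<partial>std_gauss n) = (\<integral>x. f x \<partial>std_normal_distribution)"
    by (subst integral_distr[OF m f', symmetric]) (simp add: d)
qed

section \<open>The statistic and its increments\<close>

context labelled_groups
begin

text \<open>
  The coordinates in the group of \<open>i\<close>.
\<close>

abbreviation "grp i \<equiv> {j \<in> {..<p}. g j = g i}"

text \<open>
  The deviation of a coordinate from the mean of its group.
\<close>

definition resid :: "(nat \<Rightarrow> real) \<Rightarrow> nat \<Rightarrow> real" where
  "resid x i = x i - (\<Sum>j\<in>grp i. x j) / real m"

text \<open>
  The test statistic; centring makes it invariant under adding a constant on a group.
\<close>

definition stat :: "real \<Rightarrow> (nat \<Rightarrow> real) \<Rightarrow> real" where
  "stat \<tau> x = (\<Sum>i<p. excess \<tau> (resid x i))"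

text \<open>
  The influence of coordinate \<open>j\<close> on the residual at \<open>i\<close>.
\<close>

definition wt :: "nat \<Rightarrow> nat \<Rightarrow> real" where
  "wt i j = (if i = j then 1 else 0) + (if g i = g j then 1 else 0) / real m"

text \<open>
  The mean of the squares over the group of \<open>i\<close>.
\<close>

definition gmean_sq :: "(nat \<Rightarrow> real) \<Rightarrow> nat \<Rightarrow> real" where
  "gmean_sq z i = (\<Sum>l\<in>grp i. (z l)\<^sup>2) / real m"

lemma wt_nonneg: "wt i j \<ge> 0" by (simp add: wt_def)

lemma wt_commute: "wt i j = wt j i" by (auto simp: wt_def)

lemma card_grp: "i < p \<Longrightarrow> card (grp i) = m"
  by (rule card_group) (rule label_less)

text \<open>
  The set comprehension in the normal form of the simplifier.
\<close>

lemma card_grp': "i < p \<Longrightarrow> card {j. j < p \<and> g j = g i} = m"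
  using card_grp by simp

lemma wt_sum:
  assumes m: "m > 0" and j: "j < p"
  shows "(\<Sum>i<p. wt i j) = 2" and "(\<Sum>i<p. wt j i) = 2"
proof -
  have "(\<Sum>i<p. wt i j) = (\<Sum>i<p. if i = j then 1 else 0) + (\<Sum>i<p. if g i = g j then 1 else 0) / real m"
    by (simp add: wt_def sum.distrib sum_divide_distrib)
  also have "(\<Sum>i<p. if g i = g j then 1 else 0 :: real) = real (card (grp j))"
    by (subst sum.inter_filter[symmetric]) auto
  finally show "(\<Sum>i<p. wt i j) = 2" using m j by (simp add: card_grp')
  then show "(\<Sum>i<p. wt j i) = 2" by (simp only: wt_commute[of j])
qed

lemma resid_add: "resid (\<lambda>i. x i + y i) i = resid x i + resid y i"
  by (simp add: resid_def sum.distrib add_divide_distrib)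

lemma resid_uminus: "resid (\<lambda>i. - y i) i = - resid y i"
  by (simp add: resid_def sum_negf)

lemma resid_cong: "i < p \<Longrightarrow> (\<And>i. i < p \<Longrightarrow> x i = y i) \<Longrightarrow> resid x i = resid y i"
  by (auto simp: resid_def intro!: sum.cong)

lemma stat_cong: "(\<And>i. i < p \<Longrightarrow> x i = y i) \<Longrightarrow> stat \<tau> x = stat \<tau> y"
  unfolding stat_def by (intro sum.cong refl arg_cong[where f = "excess \<tau>"] resid_cong) auto

lemma resid_sq_le:
  assumes m: "m > 0" and i: "i < p"
  shows "(resid z i)\<^sup>2 \<le> 2 * (z i)\<^sup>2 + 2 * gmean_sq z i"
proof -
  have "(\<Sum>j\<in>grp i. z j)\<^sup>2 \<le> real m * (\<Sum>j\<in>grp i. (z j)\<^sup>2)"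
    using sum_squared_le_sum_of_squares[where I = "grp i" and f = z] i by (simp add: card_grp' mult.commute)
  then have "((\<Sum>j\<in>grp i. z j) / real m)\<^sup>2 \<le> (real m * (\<Sum>j\<in>grp i. (z j)\<^sup>2)) / (real m)\<^sup>2"
    unfolding power_divide by (rule divide_right_mono) simp
  also have "\<dots> = gmean_sq z i" using m by (simp add: gmean_sq_def power2_eq_square)
  finally have "((\<Sum>j\<in>grp i. z j) / real m)\<^sup>2 \<le> gmean_sq z i" .
  moreover have "(a - b)\<^sup>2 \<le> 2 * a\<^sup>2 + 2 * b\<^sup>2" for a b :: real
    using zero_le_power2[of "a + b"] by (simp add: power2_eq_square algebra_simps)
  ultimately show ?thesis unfolding resid_def by (smt (verit))
qed

lemma resid_upd:
  assumes i: "i < p" and j: "j < p"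
  shows "\<bar>resid z i - resid (z(j := \<zeta>)) i\<bar> \<le> wt i j * \<bar>z j - \<zeta>\<bar>"
proof -
  have "(\<Sum>l\<in>grp i. z l) - (\<Sum>l\<in>grp i. (z(j := \<zeta>)) l) = (\<Sum>l\<in>grp i. if l = j then z j - \<zeta> else 0)"
    unfolding sum_subtractf[symmetric] by (intro sum.cong) auto
  also have "\<dots> = (if g i = g j then z j - \<zeta> else 0)" using j by simp
  finally have D: "(\<Sum>l\<in>grp i. z l) - (\<Sum>l\<in>grp i. (z(j := \<zeta>)) l) = (if g i = g j then z j - \<zeta> else 0)" .
  have "resid z i - resid (z(j := \<zeta>)) i
    = (z i - (z(j := \<zeta>)) i) - ((\<Sum>l\<in>grp i. z l) - (\<Sum>l\<in>grp i. (z(j := \<zeta>)) l)) / real m"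
    by (simp add: resid_def diff_divide_distrib)
  also have "\<dots> = (if i = j then z j - \<zeta> else 0) - (if g i = g j then z j - \<zeta> else 0) / real m"
    unfolding D by simp
  finally have "resid z i - resid (z(j := \<zeta>)) i
    = (if i = j then z j - \<zeta> else 0) - (if g i = g j then z j - \<zeta> else 0) / real m" .
  then have "\<bar>resid z i - resid (z(j := \<zeta>)) i\<bar>
    \<le> \<bar>if i = j then z j - \<zeta> else 0\<bar> + \<bar>(if g i = g j then z j - \<zeta> else 0) / real m\<bar>"
    by (simp only: abs_triangle_ineq4)
  also have "\<dots> = wt i j * \<bar>z j - \<zeta>\<bar>"
    by (simp add: wt_def distrib_right)
  finally show ?thesis .
qed

lemma gmean_sq_upd:
  assumes m: "m > 0" and i: "i < p"
  shows "gmean_sq (z(j := \<zeta>)) i \<le> gmean_sq z i + \<zeta>\<^sup>2"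
proof -
  have "(\<Sum>l\<in>grp i. ((z(j := \<zeta>)) l)\<^sup>2) \<le> (\<Sum>l\<in>grp i. (z l)\<^sup>2 + \<zeta>\<^sup>2)"
    by (intro sum_mono) auto
  also have "\<dots> = (\<Sum>l\<in>grp i. (z l)\<^sup>2) + real m * \<zeta>\<^sup>2"
    using i by (simp add: sum.distrib card_grp')
  finally show ?thesis unfolding gmean_sq_def using m by (simp add: divide_simps mult.commute)
qed

lemma exp_gmean_sq_le:
  assumes m: "m > 0" and i: "i < p"
  shows "exp (gmean_sq z i / 8) \<le> (\<Sum>l\<in>grp i. exp4 (z l)) / real m"
proof -
  have "convex_on UNIV (exp :: real \<Rightarrow> real)" by (rule exp_convex)
  moreover have "finite (grp i)" "grp i \<noteq> {}" using i by auto
  moreover have "(\<Sum>l\<in>grp i. 1 / real m) = 1" using i m by (simp add: card_grp')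
  ultimately have "exp (\<Sum>l\<in>grp i. (1 / real m) *\<^sub>R ((z l)\<^sup>2 / 8)) \<le> (\<Sum>l\<in>grp i. 1 / real m * exp ((z l)\<^sup>2 / 8))"
    by (intro convex_on_sum) auto
  also have "\<dots> \<le> (\<Sum>l\<in>grp i. 1 / real m * exp4 (z l))"
    by (intro sum_mono mult_left_mono) (auto simp: exp4_def)
  finally show ?thesis
    by (simp add: gmean_sq_def sum_divide_distrib)
qed

text \<open>
  The effect of replacing one noise coordinate, bounded by terms each depending on a single
  coordinate, so that expectations are one-dimensional. The weights \<open>wt i j\<close> sum to \<open>2\<close> over
  either index.
\<close>

lemma stat_upd_sq_le:
  assumes m: "m > 0" and j: "j < p"
  shows "(stat \<tau> (\<lambda>i. \<theta> i + z i) - stat \<tau> (\<lambda>i. \<theta> i + (z(j := \<zeta>)) i))\<^sup>2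
    \<le> (\<Sum>i<p. wt i j * (64 * (resid \<theta> i)\<^sup>2 * (2 * (z j)\<^sup>2 + 2 * \<zeta>\<^sup>2)
        + 524288 * exp (- \<tau> / 512) * (exp4 (z i) + (\<Sum>l\<in>grp i. exp4 (z l)) / real m + exp4 \<zeta> + exp4 (z j))))"
proof -
  define z' where "z' = z(j := \<zeta>)"
  define \<Delta> where "\<Delta> = z j - \<zeta>"
  \<comment> \<open>A common bound for the square of the increment and of the residuals before and after the change.\<close>
  define Q where "Q i = 2 * (z i)\<^sup>2 + 2 * gmean_sq z i + 4 * \<zeta>\<^sup>2 + 2 * (z j)\<^sup>2" for i
  define e where "e i = 4 * \<Delta>\<^sup>2 * (above \<tau> (resid \<theta> i + resid z i) + above \<tau> (resid \<theta> i + resid z' i))" for i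
  have gm: "gmean_sq z i \<ge> 0" for i by (simp add: gmean_sq_def sum_nonneg)
  have e0: "e i \<ge> 0" for i by (simp add: e_def above_nonneg)
  have \<Delta>: "\<Delta>\<^sup>2 \<le> 2 * (z j)\<^sup>2 + 2 * \<zeta>\<^sup>2"
    unfolding \<Delta>_def using zero_le_power2[of "z j + \<zeta>"] by (simp add: power2_eq_square algebra_simps)
  have \<Delta>Q: "\<Delta>\<^sup>2 \<le> Q i" for i
    using \<Delta> gm[of i] zero_le_power2[of "z i"] zero_le_power2[of \<zeta>] unfolding Q_def by linarith
  have step: "\<bar>excess \<tau> (resid \<theta> i + resid z i) - excess \<tau> (resid \<theta> i + resid z' i)\<bar> \<le> wt i j * sqrt (e i)" if i: "i < p" for i
  proof -
    have "(excess \<tau> (resid \<theta> i + resid z i) - excess \<tau> (resid \<theta> i + resid z' i))\<^sup>2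
      \<le> 4 * (resid z i - resid z' i)\<^sup>2 * (above \<tau> (resid \<theta> i + resid z i) + above \<tau> (resid \<theta> i + resid z' i))"
      using excess_diff_sq_le[of \<tau> "resid \<theta> i + resid z i" "resid \<theta> i + resid z' i"]
      by (simp only: add_diff_cancel_left)
    moreover have "(resid z i - resid z' i)\<^sup>2 \<le> (wt i j * \<bar>\<Delta>\<bar>)\<^sup>2"
      using resid_upd[OF i j, of z \<zeta>] wt_nonneg[of i j] unfolding z'_def \<Delta>_def
      by (intro power2_le_iff_abs_le[THEN iffD2]) auto
    then have "4 * (resid z i - resid z' i)\<^sup>2 * (above \<tau> (resid \<theta> i + resid z i) + above \<tau> (resid \<theta> i + resid z' i))
      \<le> 4 * (wt i j * \<bar>\<Delta>\<bar>)\<^sup>2 * (above \<tau> (resid \<theta> i + resid z i) + above \<tau> (resid \<theta> i + resid z' i))"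
      by (intro mult_right_mono mult_left_mono add_nonneg_nonneg above_nonneg) auto
    moreover have "4 * (wt i j * \<bar>\<Delta>\<bar>)\<^sup>2 * (above \<tau> (resid \<theta> i + resid z i) + above \<tau> (resid \<theta> i + resid z' i))
      = (wt i j * sqrt (e i))\<^sup>2"
      using e0[of i] by (simp add: power_mult_distrib e_def)
    ultimately have "(excess \<tau> (resid \<theta> i + resid z i) - excess \<tau> (resid \<theta> i + resid z' i))\<^sup>2 \<le> (wt i j * sqrt (e i))\<^sup>2"
      by linarith
    then show ?thesis
      using wt_nonneg[of i j] e0[of i] by (intro power2_le_iff_abs_le[THEN iffD1]) auto
  qed
  have bound: "e i \<le> 32 * (resid \<theta> i)\<^sup>2 * (2 * (z j)\<^sup>2 + 2 * \<zeta>\<^sup>2)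
      + 262144 * exp (- \<tau> / 512) * (exp4 (z i) + (\<Sum>l\<in>grp i. exp4 (z l)) / real m + exp4 \<zeta> + exp4 (z j))"
    if i: "i < p" for i
  proof -
    have r: "(resid z i)\<^sup>2 \<le> Q i" using resid_sq_le[OF m i, of z] zero_le_power2[of "z j"] zero_le_power2[of \<zeta>]
      unfolding Q_def by linarith
    have "(z' i)\<^sup>2 \<le> (z i)\<^sup>2 + \<zeta>\<^sup>2" by (simp add: z'_def)
    then have r': "(resid z' i)\<^sup>2 \<le> Q i"
      using resid_sq_le[OF m i, of z'] gmean_sq_upd[OF m i, of z j \<zeta>] zero_le_power2[of "z j"]
      unfolding Q_def z'_def by linarith
    define T where "T a = (if a\<^sup>2 \<ge> \<tau> / 4 then a\<^sup>2 else 0)" for a :: real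
    have "e i \<le> 4 * \<Delta>\<^sup>2 * ((4 * (resid \<theta> i)\<^sup>2 + 4 * T (resid z i)) + (4 * (resid \<theta> i)\<^sup>2 + 4 * T (resid z' i)))"
      unfolding e_def T_def by (intro mult_left_mono add_mono above_add_le) auto
    also have "\<dots> = 32 * (resid \<theta> i)\<^sup>2 * \<Delta>\<^sup>2 + 16 * (\<Delta>\<^sup>2 * T (resid z i)) + 16 * (\<Delta>\<^sup>2 * T (resid z' i))"
      by (simp add: algebra_simps)
    also have "\<dots> \<le> 32 * (resid \<theta> i)\<^sup>2 * (2 * (z j)\<^sup>2 + 2 * \<zeta>\<^sup>2)
      + 16 * (32768 * exp (- \<tau> / 512) * exp (Q i / 64)) + 16 * (32768 * exp (- \<tau> / 512) * exp (Q i / 64))"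
      unfolding T_def by (intro add_mono mult_left_mono tail_product_le r r' \<Delta>Q \<Delta>) auto
    also have "\<dots> = 32 * (resid \<theta> i)\<^sup>2 * (2 * (z j)\<^sup>2 + 2 * \<zeta>\<^sup>2) + 262144 * exp (- \<tau> / 512) * (4 * exp (Q i / 64))"
      by simp
    also have "\<dots> \<le> 32 * (resid \<theta> i)\<^sup>2 * (2 * (z j)\<^sup>2 + 2 * \<zeta>\<^sup>2)
      + 262144 * exp (- \<tau> / 512) * (exp4 (z i) + (\<Sum>l\<in>grp i. exp4 (z l)) / real m + exp4 \<zeta> + exp4 (z j))"
    proof (intro add_left_mono mult_left_mono)
      have amgm: "4 * exp ((a + b + c + d) / 4) \<le> exp a + exp b + exp c + exp d" for a b c d :: real
      proof -
        have two: "2 * exp ((x + y) / 2) \<le> exp x + exp y" for x y :: real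
        proof -
          have "0 \<le> (exp (x / 2) - exp (y / 2))\<^sup>2" by simp
          also have "\<dots> = exp x + exp y - 2 * exp ((x + y) / 2)"
            by (simp add: power2_diff exp_double[symmetric] mult_exp_exp add_divide_distrib)
          finally show ?thesis by simp
        qed
        show ?thesis
          using two[of a b] two[of c d] two[of "(a + b) / 2" "(c + d) / 2"]
          by (simp add: add_divide_distrib add.assoc)
      qed
      have "Q i / 64 = ((z i)\<^sup>2 / 8 + gmean_sq z i / 8 + \<zeta>\<^sup>2 / 4 + (z j)\<^sup>2 / 8) / 4"
        by (simp add: Q_def)
      then have "4 * exp (Q i / 64) \<le> exp ((z i)\<^sup>2 / 8) + exp (gmean_sq z i / 8) + exp (\<zeta>\<^sup>2 / 4) + exp ((z j)\<^sup>2 / 8)"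
        by (simp only: amgm)
      also have "\<dots> \<le> exp4 (z i) + (\<Sum>l\<in>grp i. exp4 (z l)) / real m + exp4 \<zeta> + exp4 (z j)"
        by (intro add_mono exp_gmean_sq_le[OF m i]) (auto simp: exp4_def)
      finally show "4 * exp (Q i / 64) \<le> exp4 (z i) + (\<Sum>l\<in>grp i. exp4 (z l)) / real m + exp4 \<zeta> + exp4 (z j)" .
    qed simp
    finally show ?thesis .
  qed
  have "(stat \<tau> (\<lambda>i. \<theta> i + z i) - stat \<tau> (\<lambda>i. \<theta> i + z' i))\<^sup>2
    = (\<Sum>i<p. excess \<tau> (resid \<theta> i + resid z i) - excess \<tau> (resid \<theta> i + resid z' i))\<^sup>2"
    by (simp only: stat_def resid_add sum_subtractf)
  also have "\<dots> \<le> (\<Sum>i<p. wt i j * sqrt (e i))\<^sup>2"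
  proof (intro power2_le_iff_abs_le[THEN iffD2])
    show "\<bar>\<Sum>i<p. excess \<tau> (resid \<theta> i + resid z i) - excess \<tau> (resid \<theta> i + resid z' i)\<bar> \<le> (\<Sum>i<p. wt i j * sqrt (e i))"
      by (rule order_trans[OF sum_abs sum_mono]) (simp add: step)
  qed (auto intro!: sum_nonneg simp: wt_nonneg e0)
  also have "\<dots> = (\<Sum>i<p. sqrt (wt i j) * (sqrt (wt i j) * sqrt (e i)))\<^sup>2"
    by (simp add: mult.assoc[symmetric] wt_nonneg)
  also have "\<dots> \<le> (\<Sum>i<p. (sqrt (wt i j))\<^sup>2) * (\<Sum>i<p. (sqrt (wt i j) * sqrt (e i))\<^sup>2)"
    by (rule Cauchy_Schwarz_ineq_sum)
  also have "\<dots> = (\<Sum>i<p. wt i j) * (\<Sum>i<p. wt i j * e i)"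
    by (simp add: power_mult_distrib wt_nonneg e0)
  also have "\<dots> = (\<Sum>i<p. wt i j * (2 * e i))"
    by (simp add: wt_sum[OF m j] sum_distrib_left mult.left_commute)
  also have "\<dots> \<le> (\<Sum>i<p. wt i j * (64 * (resid \<theta> i)\<^sup>2 * (2 * (z j)\<^sup>2 + 2 * \<zeta>\<^sup>2)
        + 524288 * exp (- \<tau> / 512) * (exp4 (z i) + (\<Sum>l\<in>grp i. exp4 (z l)) / real m + exp4 \<zeta> + exp4 (z j))))"
  proof (intro sum_mono mult_left_mono wt_nonneg)
    fix i assume "i \<in> {..<p}"
    then show "2 * e i \<le> 64 * (resid \<theta> i)\<^sup>2 * (2 * (z j)\<^sup>2 + 2 * \<zeta>\<^sup>2)
        + 524288 * exp (- \<tau> / 512) * (exp4 (z i) + (\<Sum>l\<in>grp i. exp4 (z l)) / real m + exp4 \<zeta> + exp4 (z j))"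
      using bound[of i] by simp
  qed
  finally show ?thesis unfolding z'_def .
qed

end

section \<open>Mean and variance of the statistic\<close>

lemma nn_integral_add_separate:
  fixes A :: "'a \<Rightarrow> real" and B :: "'b \<Rightarrow> real"
  assumes M: "prob_space M" and N: "prob_space N"
    and A: "integrable M A" "\<And>x. A x \<ge> 0" and B: "integrable N B" "\<And>y. B y \<ge> 0"
  shows "(\<integral>\<^sup>+x. \<integral>\<^sup>+y. ennreal (A x + B y) \<partial>N \<partial>M) = ennreal (integral\<^sup>L M A + integral\<^sup>L N B)"
proof -
  interpret M: prob_space M by fact
  interpret N: prob_space N by fact
  have "(\<integral>\<^sup>+y. ennreal (A x + B y) \<partial>N) = ennreal (A x + integral\<^sup>L N B)" for x
    using A B by (subst nn_integral_eq_integral) (auto simp: N.prob_space)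
  then have "(\<integral>\<^sup>+x. \<integral>\<^sup>+y. ennreal (A x + B y) \<partial>N \<partial>M) = (\<integral>\<^sup>+x. ennreal (A x + integral\<^sup>L N B) \<partial>M)"
    by simp
  also have "\<dots> = ennreal (integral\<^sup>L M A + integral\<^sup>L N B)"
    using A B by (subst nn_integral_eq_integral) (auto simp: M.prob_space)
  finally show ?thesis .
qed

lemma distr_std_gauss_uminus:
  "distr (std_gauss p) (Pi\<^sub>M {..<p} (\<lambda>_. borel)) (\<lambda>z. \<lambda>i\<in>{..<p}. - z i) = std_gauss p"
proof -
  have "distr std_normal_distribution borel uminus = std_normal_distribution"
    using distr_std_normal_affine[of "-1" 0] by simp
  then show ?thesis
    unfolding std_gauss_def by (subst distr_PiM_componentwise) auto
qed

context labelled_groups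
begin

lemma stat_measurable [measurable]:
  assumes "\<And>i. i < p \<Longrightarrow> (\<lambda>z. f z i) \<in> borel_measurable M"
  shows "(\<lambda>z. stat \<tau> (f z)) \<in> borel_measurable M"
  unfolding stat_def resid_def
  by (intro borel_measurable_sum measurable_compose[OF _ excess_measurable] borel_measurable_diff
      borel_measurable_divide borel_measurable_const) (auto intro: assms)

text \<open>
  The variance bound is the Efron-Stein inequality applied to \<open>stat_upd_sq_le\<close>.
\<close>

lemma stat_moments:
  fixes \<theta> :: "nat \<Rightarrow> real" and \<tau> :: real
  assumes m: "m > 0"
  defines "F \<equiv> \<lambda>z. stat \<tau> (\<lambda>i. \<theta> i + z i)"
  shows "integrable (std_gauss p) F" and "integrable (std_gauss p) (\<lambda>z. (F z)\<^sup>2)"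
    and "prob_space.variance (std_gauss p) F
      \<le> 8388608 * ((\<Sum>i<p. (resid \<theta> i)\<^sup>2) + real p * exp (- \<tau> / 512))"
proof -
  interpret N: prob_space "std_gauss p" by simp
  define E where "E = exp (- \<tau> / 512)"
  define \<mu> where "\<mu> i = resid \<theta> i" for i
  define c where "c = 524288 * E"
  have c: "c \<ge> 0" by (simp add: c_def E_def)
  have e4: "exp4 x \<ge> 0" for x by (simp add: exp4_def)
  have F [measurable]: "F \<in> borel_measurable (std_gauss p)"
    unfolding F_def by measurable
  define V where "V = 8388608 * ((\<Sum>i<p. (\<mu> i)\<^sup>2) + real p * E)"
  have V0: "V \<ge> 0" unfolding V_def E_def by (auto intro!: add_nonneg_nonneg sum_nonneg)
  have step: "(\<integral>\<^sup>+z. \<integral>\<^sup>+\<zeta>. ennreal ((F z - F (z(j := \<zeta>)))\<^sup>2) \<partial>std_normal_distribution \<partial>std_gauss p)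
      \<le> ennreal (\<Sum>i<p. wt i j * (256 * (\<mu> i)\<^sup>2 + 8 * c))" if j: "j < p" for j
  proof -
    \<comment> \<open>The bound of \<open>stat_upd_sq_le\<close>, split into the parts depending on \<open>z\<close> and on \<open>\<zeta>\<close>.\<close>
    define A where "A z = (\<Sum>i<p. wt i j * (128 * (\<mu> i)\<^sup>2 * (z j)\<^sup>2
        + c * (exp4 (z i) + (\<Sum>l\<in>grp i. exp4 (z l)) / real m + exp4 (z j))))" for z
    define B where "B \<zeta> = (\<Sum>i<p. wt i j * (128 * (\<mu> i)\<^sup>2 * \<zeta>\<^sup>2 + c * exp4 \<zeta>))" for \<zeta>
    have le: "(F z - F (z(j := \<zeta>)))\<^sup>2 \<le> A z + B \<zeta>" for z \<zeta>
    proof -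
      have "A z + B \<zeta> = (\<Sum>i<p. wt i j * (64 * (\<mu> i)\<^sup>2 * (2 * (z j)\<^sup>2 + 2 * \<zeta>\<^sup>2)
        + c * (exp4 (z i) + (\<Sum>l\<in>grp i. exp4 (z l)) / real m + exp4 \<zeta> + exp4 (z j))))"
        unfolding A_def B_def sum.distrib[symmetric] distrib_left[symmetric]
        by (intro sum.cong refl arg_cong[where f = "(*) _"]) (simp add: algebra_simps)
      then show ?thesis
        using stat_upd_sq_le[OF m j, of \<tau> \<theta> z \<zeta>] unfolding F_def c_def E_def \<mu>_def by simp
    qed
    have A0: "A z \<ge> 0" for z
      unfolding A_def using c e4 by (intro sum_nonneg mult_nonneg_nonneg add_nonneg_nonneg divide_nonneg_nonneg wt_nonneg) auto
    have B0: "B \<zeta> \<ge> 0" for \<zeta>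
      unfolding B_def using c e4 by (intro sum_nonneg mult_nonneg_nonneg add_nonneg_nonneg wt_nonneg) auto
    note I4 = integral_component_std_gauss[OF _ std_normal_exp4(1)]
    note I2 = integral_component_std_gauss[OF _ std_normal_sq(1)]
    have iA: "integrable (std_gauss p) A"
      unfolding A_def
      by (intro Bochner_Integration.integrable_sum integrable_mult_right Bochner_Integration.integrable_add
          integrable_divide_zero I4(1) I2(1)) (auto simp: j)
    have iB: "integrable std_normal_distribution B"
      unfolding B_def using std_normal_exp4(1) std_normal_sq(1)
      by (intro Bochner_Integration.integrable_sum integrable_mult_right Bochner_Integration.integrable_add) auto
    define a where "a = (\<integral>x. exp4 x \<partial>std_normal_distribution)"
    have a: "a \<le> 2" unfolding a_def by (rule std_normal_exp4(2))
    have eA: "(\<integral>z. A z \<partial>std_gauss p) = (\<Sum>i<p. wt i j * (128 * (\<mu> i)\<^sup>2 + c * (a + a + a)))"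
    proof -
      have "(\<integral>z. A z \<partial>std_gauss p) = (\<Sum>i<p. \<integral>z. wt i j * (128 * (\<mu> i)\<^sup>2 * (z j)\<^sup>2
        + c * (exp4 (z i) + (\<Sum>l\<in>grp i. exp4 (z l)) / real m + exp4 (z j))) \<partial>std_gauss p)"
        unfolding A_def
        by (intro Bochner_Integration.integral_sum integrable_mult_right Bochner_Integration.integrable_add
          Bochner_Integration.integrable_sum integrable_divide_zero I4(1) I2(1)) (auto simp: j)
      also have "\<dots> = (\<Sum>i<p. wt i j * (128 * (\<mu> i)\<^sup>2 + c * (a + a + a)))"
      proof (intro sum.cong refl)
        fix i assume "i \<in> {..<p}"
        then have i: "i < p" by simp
        have s: "integrable (std_gauss p) (\<lambda>z. \<Sum>l\<in>grp i. exp4 (z l))"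
          by (intro Bochner_Integration.integrable_sum I4(1)) auto
        have "(\<integral>z. (\<Sum>l\<in>grp i. exp4 (z l)) \<partial>std_gauss p) = (\<Sum>l\<in>grp i. a)"
          unfolding a_def by (subst Bochner_Integration.integral_sum) (auto simp: I4 intro!: sum.cong)
        also have "\<dots> = real m * a" using i by (simp add: card_grp')
        finally have es: "(\<integral>z. (\<Sum>l\<in>grp i. exp4 (z l)) \<partial>std_gauss p) = real m * a" .
        show "(\<integral>z. wt i j * (128 * (\<mu> i)\<^sup>2 * (z j)\<^sup>2
            + c * (exp4 (z i) + (\<Sum>l\<in>grp i. exp4 (z l)) / real m + exp4 (z j))) \<partial>std_gauss p)
          = wt i j * (128 * (\<mu> i)\<^sup>2 + c * (a + a + a))"
          using s i j m by (simp add: I4 I2 es std_normal_sq(2) a_def[symmetric] card_grp')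
      qed
      finally show ?thesis .
    qed
    have eB: "(\<integral>\<zeta>. B \<zeta> \<partial>std_normal_distribution) = (\<Sum>i<p. wt i j * (128 * (\<mu> i)\<^sup>2 + c * a))"
      unfolding B_def using std_normal_exp4(1) std_normal_sq
      by (subst Bochner_Integration.integral_sum) (auto simp: a_def[symmetric])
    have "(\<integral>\<^sup>+z. \<integral>\<^sup>+\<zeta>. ennreal ((F z - F (z(j := \<zeta>)))\<^sup>2) \<partial>std_normal_distribution \<partial>std_gauss p)
      \<le> (\<integral>\<^sup>+z. \<integral>\<^sup>+\<zeta>. ennreal (A z + B \<zeta>) \<partial>std_normal_distribution \<partial>std_gauss p)"
      by (intro nn_integral_mono ennreal_leI le)
    also have "\<dots> = ennreal ((\<integral>z. A z \<partial>std_gauss p) + (\<integral>\<zeta>. B \<zeta> \<partial>std_normal_distribution))"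
      by (intro nn_integral_add_separate iA A0 iB B0) auto
    also have "\<dots> \<le> ennreal (\<Sum>i<p. wt i j * (256 * (\<mu> i)\<^sup>2 + 8 * c))"
    proof (rule ennreal_leI)
      have "(\<integral>z. A z \<partial>std_gauss p) + (\<integral>\<zeta>. B \<zeta> \<partial>std_normal_distribution)
        = (\<Sum>i<p. wt i j * (256 * (\<mu> i)\<^sup>2 + 4 * (c * a)))"
        unfolding eA eB sum.distrib[symmetric] distrib_left[symmetric]
        by (intro sum.cong refl arg_cong[where f = "(*) _"]) (simp add: algebra_simps)
      also have "\<dots> \<le> (\<Sum>i<p. wt i j * (256 * (\<mu> i)\<^sup>2 + 8 * c))"
        using mult_left_mono[OF a c] by (intro sum_mono mult_left_mono wt_nonneg) (auto simp: mult.commute)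
      finally show "(\<integral>z. A z \<partial>std_gauss p) + (\<integral>\<zeta>. B \<zeta> \<partial>std_normal_distribution)
        \<le> (\<Sum>i<p. wt i j * (256 * (\<mu> i)\<^sup>2 + 8 * c))" .
    qed
    finally show ?thesis .
  qed
  have "(\<integral>\<^sup>+x. \<integral>\<^sup>+y. ennreal ((F x - F y)\<^sup>2) \<partial>std_gauss p \<partial>std_gauss p)
    \<le> (\<Sum>j\<in>{..<p}. \<integral>\<^sup>+z. \<integral>\<^sup>+\<zeta>. ennreal ((F z - F (z(j := \<zeta>)))\<^sup>2) \<partial>std_normal_distribution \<partial>std_gauss p)"
    using F unfolding std_gauss_def by (intro efron_stein) auto
  also have "\<dots> \<le> (\<Sum>j\<in>{..<p}. ennreal (\<Sum>i<p. wt i j * (256 * (\<mu> i)\<^sup>2 + 8 * c)))"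
    by (intro sum_mono step) auto
  also have "\<dots> = ennreal (\<Sum>j<p. \<Sum>i<p. wt i j * (256 * (\<mu> i)\<^sup>2 + 8 * c))"
    using c by (intro sum_ennreal sum_nonneg mult_nonneg_nonneg wt_nonneg) auto
  also have "(\<Sum>j<p. \<Sum>i<p. wt i j * (256 * (\<mu> i)\<^sup>2 + 8 * c)) = (\<Sum>i<p. (\<Sum>j<p. wt i j) * (256 * (\<mu> i)\<^sup>2 + 8 * c))"
    by (subst sum.swap) (simp add: sum_distrib_right)
  also have "\<dots> = (\<Sum>i<p. 512 * (\<mu> i)\<^sup>2 + 16 * c)"
    using wt_sum(2)[OF m] by (intro sum.cong) auto
  also have "\<dots> = 512 * (\<Sum>i<p. (\<mu> i)\<^sup>2) + 8388608 * (real p * E)"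
    by (simp add: sum.distrib sum_distrib_left c_def)
  finally have "(\<integral>\<^sup>+x. \<integral>\<^sup>+y. ennreal ((F x - F y)\<^sup>2) \<partial>std_gauss p \<partial>std_gauss p)
    \<le> ennreal (512 * (\<Sum>i<p. (\<mu> i)\<^sup>2) + 8388608 * (real p * E))" .
  also have "\<dots> \<le> ennreal V"
    unfolding V_def by (intro ennreal_leI) (simp add: sum_nonneg algebra_simps)
  finally have pair: "(\<integral>\<^sup>+x. \<integral>\<^sup>+y. ennreal ((F x - F y)\<^sup>2) \<partial>std_gauss p \<partial>std_gauss p) \<le> ennreal V" .
  show "integrable (std_gauss p) F" "integrable (std_gauss p) (\<lambda>z. (F z)\<^sup>2)"
    using N.variance_le_of_pairwise[OF F V0 pair] by auto
  show "prob_space.variance (std_gauss p) F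
      \<le> 8388608 * ((\<Sum>i<p. (resid \<theta> i)\<^sup>2) + real p * exp (- \<tau> / 512))"
    using N.variance_le_of_pairwise(3)[OF F V0 pair] by (simp add: V_def \<mu>_def E_def)
qed

text \<open>
  The set \<open>S\<close> will be the support of the signal. The other coordinates contribute nothing negative,
  whatever their residual mean is, since the noise is symmetric and \<open>excess \<tau>\<close> is even and convex.
\<close>

lemma stat_mean_gap:
  assumes m: "m > 0" and \<tau>: "\<tau> \<ge> 0" and S: "S \<subseteq> {..<p}"
  shows "(\<integral>z. stat \<tau> (\<lambda>i. \<theta> i + z i) \<partial>std_gauss p) - (\<integral>z. stat \<tau> z \<partial>std_gauss p)
    \<ge> (\<Sum>i\<in>S. (resid \<theta> i)\<^sup>2 - \<tau>)"
proof -
  interpret N: prob_space "std_gauss p" by simp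
  have i1: "integrable (std_gauss p) (\<lambda>z. stat \<tau> (\<lambda>i. \<theta> i + z i))" by (rule stat_moments(1)[OF m])
  have i0: "integrable (std_gauss p) (\<lambda>z. stat \<tau> z)"
    using stat_moments(1)[OF m, of \<tau> "\<lambda>_. 0"] by simp
  have neg: "(\<lambda>z. \<lambda>i\<in>{..<p}. - z i) \<in> std_gauss p \<rightarrow>\<^sub>M Pi\<^sub>M {..<p} (\<lambda>_. borel)"
    by (intro measurable_restrict) measurable
  have F: "(\<lambda>z. stat \<tau> (\<lambda>i. \<theta> i + z i)) \<in> borel_measurable (Pi\<^sub>M {..<p} (\<lambda>_. borel))"
    by measurable
  have eq: "stat \<tau> (\<lambda>i. \<theta> i + (\<lambda>i\<in>{..<p}. - z i) i) = stat \<tau> (\<lambda>i. \<theta> i + - z i)" for z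
    by (intro stat_cong) auto
  have i2: "integrable (std_gauss p) (\<lambda>z. stat \<tau> (\<lambda>i. \<theta> i + - z i))"
    using integrable_distr_eq[OF neg F] i1 unfolding distr_std_gauss_uminus eq by simp
  have e2: "(\<integral>z. stat \<tau> (\<lambda>i. \<theta> i + - z i) \<partial>std_gauss p) = (\<integral>z. stat \<tau> (\<lambda>i. \<theta> i + z i) \<partial>std_gauss p)"
    using integral_distr[OF neg F] unfolding distr_std_gauss_uminus eq by simp
  have point: "stat \<tau> (\<lambda>i. \<theta> i + z i) + stat \<tau> (\<lambda>i. \<theta> i + - z i) - 2 * stat \<tau> z
    \<ge> 2 * (\<Sum>i\<in>S. (resid \<theta> i)\<^sup>2 - \<tau>)" for z
  proof -
    define d where "d i = excess \<tau> (resid \<theta> i + resid z i) + excess \<tau> (resid \<theta> i + - resid z i) - 2 * excess \<tau> (resid z i)" for i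
    have conv: "excess \<tau> (u + v) + excess \<tau> (u + - v) - 2 * excess \<tau> v \<ge> max 0 (2 * u\<^sup>2 - 2 * \<tau>)" for u v
    proof -
      have "(u + v)\<^sup>2 + (u + - v)\<^sup>2 = 2 * u\<^sup>2 + 2 * v\<^sup>2" by (simp add: power2_eq_square algebra_simps)
      moreover have "max 0 (2 * U - 2 * \<tau>) \<le> max (A - \<tau>) 0 + max (B - \<tau>) 0 - 2 * max (W - \<tau>) 0"
        if "A + B = 2 * U + 2 * W" "U \<ge> 0" "W \<ge> 0" for A B U W
        using that \<tau> by (auto simp: max_def)
      ultimately show ?thesis unfolding excess_def by simp
    qed
    have "2 * (\<Sum>i\<in>S. (resid \<theta> i)\<^sup>2 - \<tau>) = (\<Sum>i\<in>S. 2 * (resid \<theta> i)\<^sup>2 - 2 * \<tau>)"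
      by (simp add: sum_distrib_left right_diff_distrib)
    also have "\<dots> \<le> (\<Sum>i\<in>S. d i)"
      unfolding d_def using conv by (intro sum_mono) (metis max.bounded_iff)
    also have "\<dots> \<le> (\<Sum>i<p. d i)"
      unfolding d_def using conv S by (intro sum_mono2) (auto simp: max.bounded_iff)
    also have "\<dots> = stat \<tau> (\<lambda>i. \<theta> i + z i) + stat \<tau> (\<lambda>i. \<theta> i + - z i) - 2 * stat \<tau> z"
      unfolding d_def stat_def resid_add resid_uminus by (simp only: sum.distrib sum_subtractf sum_distrib_left)
    finally show ?thesis .
  qed
  have "2 * (\<Sum>i\<in>S. (resid \<theta> i)\<^sup>2 - \<tau>) = (\<integral>z. 2 * (\<Sum>i\<in>S. (resid \<theta> i)\<^sup>2 - \<tau>) \<partial>std_gauss p)"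
    by (simp add: N.prob_space)
  also have "\<dots> \<le> (\<integral>z. stat \<tau> (\<lambda>i. \<theta> i + z i) + stat \<tau> (\<lambda>i. \<theta> i + - z i) - 2 * stat \<tau> z \<partial>std_gauss p)"
    using i0 i1 i2 point by (intro integral_mono) auto
  also have "\<dots> = 2 * ((\<integral>z. stat \<tau> (\<lambda>i. \<theta> i + z i) \<partial>std_gauss p) - (\<integral>z. stat \<tau> z \<partial>std_gauss p))"
    using i0 i1 i2 by (simp add: e2[simplified])
  finally show ?thesis by simp
qed

text \<open>
  Subtracting the group means costs at most half of the energy on the support when at most
  a quarter of each group is nonzero.
\<close>

lemma resid_energy:
  assumes m: "m > 0" and s: "4 * s \<le> m" and x: "card {i \<in> {..<p}. x i \<noteq> 0} \<le> s"
  shows "(\<Sum>i\<in>{i \<in> {..<p}. x i \<noteq> 0}. (resid x i)\<^sup>2) \<ge> (\<Sum>i<p. (x i)\<^sup>2) / 2"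
    and "(\<Sum>i<p. (resid x i)\<^sup>2) \<le> (\<Sum>i<p. (x i)\<^sup>2)"
proof -
  define G where "G k = {i \<in> {..<p}. g i = k}" for k
  define T where "T k = {i \<in> G k. x i \<noteq> 0}" for k
  define b where "b k = (\<Sum>i\<in>G k. x i)" for k
  have fin: "finite (G k)" "finite (T k)" for k by (auto simp: G_def T_def)
  have resid: "resid x i = x i - b k / real m" if "i \<in> G k" for i k
    using that by (auto simp: resid_def G_def b_def)
  have sqT: "(\<Sum>i\<in>G k. (x i)\<^sup>2) = (\<Sum>i\<in>T k. (x i)\<^sup>2)" for k
    by (intro sum.mono_neutral_right fin) (auto simp: T_def)
  have bT: "b k = (\<Sum>i\<in>T k. x i)" for k
    unfolding b_def by (intro sum.mono_neutral_right fin) (auto simp: T_def)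
  \<comment> \<open>Only the nonzero entries, at most \<open>m / 4\<close> in each group, enter the Cauchy-Schwarz inequality.\<close>
  have b2: "(b k)\<^sup>2 \<le> real m / 4 * (\<Sum>i\<in>G k. (x i)\<^sup>2)" for k
  proof -
    have "T k \<subseteq> {i \<in> {..<p}. x i \<noteq> 0}" by (auto simp: T_def G_def)
    then have "card (T k) \<le> s" using x card_mono[of "{i \<in> {..<p}. x i \<noteq> 0}" "T k"] by simp
    then have cT: "real (card (T k)) \<le> real m / 4" using s by simp
    have "(b k)\<^sup>2 \<le> (\<Sum>i\<in>T k. (x i)\<^sup>2) * real (card (T k))"
      unfolding bT by (rule sum_squared_le_sum_of_squares)
    also have "\<dots> \<le> (\<Sum>i\<in>T k. (x i)\<^sup>2) * (real m / 4)"
      using cT by (intro mult_left_mono) (auto intro: sum_nonneg)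
    finally show ?thesis by (simp add: sqT mult.commute)
  qed
  have expand: "(\<Sum>i\<in>A. (x i - c)\<^sup>2) = (\<Sum>i\<in>A. (x i)\<^sup>2) - 2 * c * (\<Sum>i\<in>A. x i) + real (card A) * c\<^sup>2" for A c
  proof -
    have "(\<Sum>i\<in>A. (x i - c)\<^sup>2) = (\<Sum>i\<in>A. (x i)\<^sup>2 - 2 * c * x i + c\<^sup>2)"
      by (intro sum.cong) (auto simp: power2_eq_square algebra_simps)
    then show ?thesis by (simp add: sum.distrib sum_subtractf sum_distrib_left)
  qed
  have "(\<Sum>i\<in>G k. (x i)\<^sup>2) / 2 \<le> (\<Sum>i\<in>G k. if x i \<noteq> 0 then (resid x i)\<^sup>2 else 0)" for k
  proof -
    have "(\<Sum>i\<in>G k. if x i \<noteq> 0 then (resid x i)\<^sup>2 else 0) = (\<Sum>i\<in>T k. (resid x i)\<^sup>2)"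
      unfolding T_def by (rule sum.inter_filter[symmetric]) (rule fin)
    also have "\<dots> = (\<Sum>i\<in>T k. (x i - b k / real m)\<^sup>2)"
      by (intro sum.cong) (auto simp: T_def resid)
    also have "\<dots> = (\<Sum>i\<in>G k. (x i)\<^sup>2) - 2 * (b k / real m) * b k + real (card (T k)) * (b k / real m)\<^sup>2"
      unfolding expand sqT bT[symmetric] ..
    finally have "(\<Sum>i\<in>G k. if x i \<noteq> 0 then (resid x i)\<^sup>2 else 0) = (\<Sum>i\<in>G k. (x i)\<^sup>2) - 2 * (b k / real m) * b k + real (card (T k)) * (b k / real m)\<^sup>2" .
    moreover have "2 * (b k / real m) * b k = 2 * (b k)\<^sup>2 / real m"
      by (simp add: power2_eq_square)
    moreover have "real (card (T k)) * (b k / real m)\<^sup>2 \<ge> 0" by simp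
    moreover have "2 * (b k)\<^sup>2 / real m \<le> (\<Sum>i\<in>G k. (x i)\<^sup>2) / 2"
      using b2[of k] m by (simp add: field_simps)
    ultimately show ?thesis by linarith
  qed
  then have "(\<Sum>k<R. (\<Sum>i\<in>G k. (x i)\<^sup>2) / 2) \<le> (\<Sum>k<R. \<Sum>i\<in>G k. if x i \<noteq> 0 then (resid x i)\<^sup>2 else 0)"
    by (intro sum_mono)
  then show "(\<Sum>i\<in>{i \<in> {..<p}. x i \<noteq> 0}. (resid x i)\<^sup>2) \<ge> (\<Sum>i<p. (x i)\<^sup>2) / 2"
    unfolding G_def sum_divide_distrib[symmetric] sum_groups by (simp only: sum.inter_filter finite_lessThan)
  have "(\<Sum>i\<in>G k. (resid x i)\<^sup>2) \<le> (\<Sum>i\<in>G k. (x i)\<^sup>2)" if k: "k < R" for k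
  proof -
    have "card (G k) = m" unfolding G_def by (rule card_group[OF k])
    moreover have "(\<Sum>i\<in>G k. (resid x i)\<^sup>2) = (\<Sum>i\<in>G k. (x i - b k / real m)\<^sup>2)"
      by (intro sum.cong) (auto simp: resid)
    ultimately have "(\<Sum>i\<in>G k. (resid x i)\<^sup>2) = (\<Sum>i\<in>G k. (x i)\<^sup>2) - (b k)\<^sup>2 / real m"
      using m unfolding expand b_def[symmetric] by (simp add: power2_eq_square)
    then show ?thesis by simp
  qed
  then have "(\<Sum>k<R. \<Sum>i\<in>G k. (resid x i)\<^sup>2) \<le> (\<Sum>k<R. \<Sum>i\<in>G k. (x i)\<^sup>2)"
    by (rule sum_mono) simp
  then show "(\<Sum>i<p. (resid x i)\<^sup>2) \<le> (\<Sum>i<p. (x i)\<^sup>2)"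
    unfolding G_def sum_groups .
qed

end

section \<open>The upper bound\<close>

context labelled_groups
begin

lemma stat_shift:
  assumes m: "m > 0"
  shows "stat \<tau> (\<lambda>i. x i + c (g i)) = stat \<tau> x"
proof -
  have "resid (\<lambda>i. x i + c (g i)) i = resid x i" if i: "i < p" for i
  proof -
    have "(\<Sum>j\<in>grp i. c (g j)) = (\<Sum>j\<in>grp i. c (g i))" by (intro sum.cong) auto
    then have "(\<Sum>j\<in>grp i. c (g j)) = real m * c (g i)" using i by (simp add: card_grp')
    then show ?thesis using m i unfolding resid_def by (simp add: sum.distrib add_divide_distrib card_grp')
  qed
  then show ?thesis unfolding stat_def by (intro sum.cong) auto
qed

text \<open>
  The mean of the statistic under the null hypothesis.
\<close>

definition stat_mean :: "real \<Rightarrow> real" where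
  "stat_mean \<tau> = (\<integral>z. stat \<tau> z \<partial>std_gauss p)"

text \<open>
  The test rejects when the statistic of the data, normalised by \<open>\<sigma>\<close>, exceeds its mean under the null
  hypothesis by more than \<open>l\<close>.
\<close>

definition stat_test :: "real \<Rightarrow> real \<Rightarrow> real \<Rightarrow> (nat \<Rightarrow> real) \<Rightarrow> nat" where
  "stat_test \<sigma> \<tau> l x = (if stat \<tau> (\<lambda>i. x i / \<sigma>) > stat_mean \<tau> + l then 1 else 0)"

lemma stat_test_in_tests: "stat_test \<sigma> \<tau> l \<in> tests p"
proof -
  have [measurable]: "(\<lambda>x. stat \<tau> (\<lambda>i. x i / \<sigma>)) \<in> borel_measurable (Pi\<^sub>M {..<p} (\<lambda>_. borel))"
    by (rule stat_measurable) measurable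
  have "(\<lambda>x. if stat \<tau> (\<lambda>i. x i / \<sigma>) > stat_mean \<tau> + l then 1 else 0) \<in> Pi\<^sub>M {..<p} (\<lambda>_. borel) \<rightarrow>\<^sub>M count_space {0, 1 :: nat}"
    by measurable
  then show ?thesis unfolding tests_def stat_test_def[abs_def] .
qed

text \<open>
  The common factors cancel, so that the errors are those in the model with independent noise.
\<close>

lemma prob_stat_test:
  assumes m: "m > 0" and \<gamma>: "0 \<le> \<gamma>" "\<gamma> < 1"
  defines "\<sigma> \<equiv> sqrt (1 - \<gamma>)"
  shows "\<P>(x in mvn p \<theta> (cov \<gamma>). stat_test \<sigma> \<tau> l x = a)
    = \<P>(z in std_gauss p. (if stat \<tau> (\<lambda>i. \<theta> i / \<sigma> + z i) > stat_mean \<tau> + l then 1 else 0) = a)"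
proof -
  interpret NR: prob_space "std_gauss R" by simp
  have \<sigma>: "\<sigma> > 0" using \<gamma> by (simp add: \<sigma>_def)
  have "stat \<tau> (\<lambda>i. (\<lambda>i\<in>{..<p}. \<theta> i + sqrt \<gamma> * w (g i) + \<sigma> * z i) i / \<sigma>) = stat \<tau> (\<lambda>i. \<theta> i / \<sigma> + z i)" for w z
  proof -
    have "stat \<tau> (\<lambda>i. (\<lambda>i\<in>{..<p}. \<theta> i + sqrt \<gamma> * w (g i) + \<sigma> * z i) i / \<sigma>)
      = stat \<tau> (\<lambda>i. (\<theta> i / \<sigma> + z i) + sqrt \<gamma> * w (g i) / \<sigma>)"
      using \<sigma> by (intro stat_cong) (simp add: field_simps)
    also have "\<dots> = stat \<tau> (\<lambda>i. \<theta> i / \<sigma> + z i)"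
      using stat_shift[OF m, of \<tau> "\<lambda>i. \<theta> i / \<sigma> + z i" "\<lambda>k. sqrt \<gamma> * w k / \<sigma>"] .
    finally show ?thesis .
  qed
  then have "stat_test \<sigma> \<tau> l (\<lambda>i\<in>{..<p}. \<theta> i + sqrt \<gamma> * w (g i) + \<sigma> * z i)
      = (if stat \<tau> (\<lambda>i. \<theta> i / \<sigma> + z i) > stat_mean \<tau> + l then 1 else 0)" for w z
    by (simp only: stat_test_def)
  then show ?thesis
    using measure_mvn_cov(2)[OF \<gamma> tests_pred[OF stat_test_in_tests], of \<theta> \<sigma> \<tau> l a]
    unfolding \<sigma>_def[symmetric] by (simp only: lebesgue_integral_const NR.prob_space) simp
qed

lemma type_one_error:
  assumes m: "m > 0" and \<gamma>: "0 \<le> \<gamma>" "\<gamma> < 1" and l: "l > 0"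
  shows "\<P>(x in mvn p (\<lambda>i\<in>{..<p}. 0) (cov \<gamma>). stat_test (sqrt (1 - \<gamma>)) \<tau> l x = 1)
    \<le> 8388608 * (real p * exp (- \<tau> / 512)) / l\<^sup>2"
proof -
  interpret N: prob_space "std_gauss p" by simp
  have F [measurable]: "(\<lambda>z. stat \<tau> z) \<in> borel_measurable (std_gauss p)" by measurable
  have eq: "stat \<tau> (\<lambda>i. (\<lambda>i\<in>{..<p}. 0) i / sqrt (1 - \<gamma>) + z i) = stat \<tau> z" for z
    by (intro stat_cong) auto
  have sq: "integrable (std_gauss p) (\<lambda>z. (stat \<tau> z)\<^sup>2)"
    using stat_moments(2)[OF m, of \<tau> "\<lambda>_. 0"] by simp
  have var: "N.variance (\<lambda>z. stat \<tau> z) \<le> 8388608 * (real p * exp (- \<tau> / 512))"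
    using stat_moments(3)[OF m, of \<tau> "\<lambda>_. 0"] by (simp add: resid_def)
  have "\<P>(x in mvn p (\<lambda>i\<in>{..<p}. 0) (cov \<gamma>). stat_test (sqrt (1 - \<gamma>)) \<tau> l x = 1)
    = \<P>(z in std_gauss p. stat \<tau> z > stat_mean \<tau> + l)"
    unfolding prob_stat_test[OF m \<gamma>] eq by (intro arg_cong[where f = "measure _"]) auto
  also have "\<dots> \<le> \<P>(z in std_gauss p. l \<le> \<bar>stat \<tau> z - N.expectation (\<lambda>z. stat \<tau> z)\<bar>)"
    unfolding stat_mean_def by (intro N.finite_measure_mono) auto
  also have "\<dots> \<le> N.variance (\<lambda>z. stat \<tau> z) / l\<^sup>2"
    using sq l by (intro N.Chebyshev_inequality) auto
  also have "\<dots> \<le> 8388608 * (real p * exp (- \<tau> / 512)) / l\<^sup>2"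
    using var by (intro divide_right_mono) auto
  finally show ?thesis .
qed

text \<open>
  By the bounds on \<open>l\<close> and \<open>real s * \<tau>\<close>, the mean of the statistic exceeds the critical value by at
  least \<open>E / 8\<close>.
\<close>

lemma type_two_error:
  fixes \<theta> :: "nat \<Rightarrow> real"
  assumes m: "m > 0" and \<gamma>: "0 \<le> \<gamma>" "\<gamma> < 1" and s: "4 * s \<le> m" and \<tau>: "\<tau> \<ge> 0"
    and \<theta>: "card {i \<in> {..<p}. \<theta> i \<noteq> 0} \<le> s"
  defines "E \<equiv> (\<Sum>i<p. (\<theta> i)\<^sup>2) / (1 - \<gamma>)"
  assumes l: "l \<le> E / 8" "real s * \<tau> \<le> E / 4" and E: "E > 0"
  shows "\<P>(x in mvn p \<theta> (cov \<gamma>). stat_test (sqrt (1 - \<gamma>)) \<tau> l x = 0)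
    \<le> 536870912 * (E + real p * exp (- \<tau> / 512)) / E\<^sup>2"
proof -
  interpret N: prob_space "std_gauss p" by simp
  define \<nu> where "\<nu> i = \<theta> i / sqrt (1 - \<gamma>)" for i
  define F where "F z = stat \<tau> (\<lambda>i. \<nu> i + z i)" for z
  have F [measurable]: "F \<in> borel_measurable (std_gauss p)" unfolding F_def by measurable
  have sq: "integrable (std_gauss p) (\<lambda>z. (F z)\<^sup>2)"
    using stat_moments(2)[OF m, of \<tau> \<nu>] by (simp add: F_def)
  have \<nu>: "{i \<in> {..<p}. \<nu> i \<noteq> 0} = {i \<in> {..<p}. \<theta> i \<noteq> 0}" using \<gamma> by (auto simp: \<nu>_def)
  have E_eq: "(\<Sum>i<p. (\<nu> i)\<^sup>2) = E"
    using \<gamma> by (simp add: \<nu>_def E_def power_divide sum_divide_distrib)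
  define S where "S = {i \<in> {..<p}. \<nu> i \<noteq> 0}"
  have S: "card S \<le> s" "S \<subseteq> {..<p}" using \<theta> \<nu> by (auto simp: S_def)
  have energy: "(\<Sum>i\<in>S. (resid \<nu> i)\<^sup>2) \<ge> E / 2" "(\<Sum>i<p. (resid \<nu> i)\<^sup>2) \<le> E"
    using resid_energy[OF m s, of \<nu>] S(1) unfolding S_def E_eq by auto
  have var: "N.variance F \<le> 8388608 * (E + real p * exp (- \<tau> / 512))"
  proof -
    have "N.variance F \<le> 8388608 * ((\<Sum>i<p. (resid \<nu> i)\<^sup>2) + real p * exp (- \<tau> / 512))"
      unfolding F_def by (rule stat_moments(3)[OF m])
    also have "\<dots> \<le> 8388608 * (E + real p * exp (- \<tau> / 512))"
      using energy(2) by (intro mult_left_mono add_right_mono) auto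
    finally show ?thesis .
  qed
  have gap: "N.expectation F - stat_mean \<tau> \<ge> E / 4"
  proof -
    have "real (card S) * \<tau> \<le> real s * \<tau>" using S \<tau> by (intro mult_right_mono) auto
    then have "E / 4 \<le> (\<Sum>i\<in>S. (resid \<nu> i)\<^sup>2) - real (card S) * \<tau>" using energy(1) l by linarith
    also have "\<dots> = (\<Sum>i\<in>S. (resid \<nu> i)\<^sup>2 - \<tau>)" by (simp add: sum_subtractf)
    also have "\<dots> \<le> N.expectation F - stat_mean \<tau>"
      unfolding F_def stat_mean_def by (rule stat_mean_gap[OF m \<tau> S(2)])
    finally show ?thesis .
  qed
  have "\<P>(x in mvn p \<theta> (cov \<gamma>). stat_test (sqrt (1 - \<gamma>)) \<tau> l x = 0)
    = \<P>(z in std_gauss p. \<not> F z > stat_mean \<tau> + l)"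
    unfolding prob_stat_test[OF m \<gamma>] \<nu>_def[symmetric] F_def[symmetric]
    by (intro arg_cong[where f = "measure _"]) auto
  also have "\<dots> \<le> \<P>(z in std_gauss p. E / 8 \<le> \<bar>F z - N.expectation F\<bar>)"
  proof (intro N.finite_measure_mono subsetI)
    fix z assume z: "z \<in> {z \<in> space (std_gauss p). \<not> F z > stat_mean \<tau> + l}"
    then have "E / 8 \<le> N.expectation F - F z" using gap l(1) by simp
    also have "\<dots> \<le> \<bar>F z - N.expectation F\<bar>" by simp
    finally show "z \<in> {z \<in> space (std_gauss p). E / 8 \<le> \<bar>F z - N.expectation F\<bar>}" using z by simp
  qed measurable
  also have "\<dots> \<le> N.variance F / (E / 8)\<^sup>2"
    using sq E by (intro N.Chebyshev_inequality) auto
  also have "\<dots> \<le> 8388608 * (E + real p * exp (- \<tau> / 512)) / (E / 8)\<^sup>2"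
    using var by (intro divide_right_mono) auto
  also have "\<dots> = 536870912 * (E + real p * exp (- \<tau> / 512)) / E\<^sup>2"
    by (simp add: power_divide)
  finally show ?thesis .
qed

text \<open>
  Here \<open>\<psi>\<close> stands for the squared rate at noise level \<open>1\<close>, and \<open>K\<close> for the squared constant in front of
  the rate. The critical value is \<open>A * \<psi>\<close> above the null mean, with \<open>A\<close> chosen so that the error of
  the first kind is at most \<open>\<eta> / 2\<close>; the size of \<open>K\<close> then handles the error of the second kind.
\<close>

lemma risk_upper_bound:
  fixes \<psi> \<tau> K \<eta> \<epsilon> :: real
  assumes p: "p > 0" and m: "m > 0" and \<gamma>: "0 \<le> \<gamma>" "\<gamma> < 1" and s: "1 \<le> s" "4 * s \<le> m" and \<tau>: "\<tau> \<ge> 0"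
    and \<psi>: "\<psi> \<ge> 1 / 2" "real s * \<tau> \<le> 512 * \<psi>" "real p * exp (- \<tau> / 512) \<le> 3 * \<psi>\<^sup>2"
    and \<eta>: "0 < \<eta>" "\<eta> < 1" and K: "K \<ge> 8589934592 / \<eta>" and \<epsilon>: "\<epsilon> \<ge> 0" "\<epsilon>\<^sup>2 \<ge> K * ((1 - \<gamma>) * \<psi>)"
  shows "(INF \<phi>\<in>tests p.
        \<P>(x in mvn p (\<lambda>i\<in>{..<p}. 0) (cov \<gamma>). \<phi> x = 1)
        + (SUP \<theta>\<in>sparse_alt p s \<epsilon>. \<P>(x in mvn p \<theta> (cov \<gamma>). \<phi> x = 0))) \<le> \<eta>"
proof -
  \<comment> \<open>The constants are \<open>67108864 = 2 ^ 26\<close> and \<open>8589934592 = 2 ^ 33\<close>; the bounds on the variance carry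
    the factor \<open>2 ^ 23\<close>.\<close>
  define A where "A = 67108864 / \<eta>"
  define \<phi> where "\<phi> = stat_test (sqrt (1 - \<gamma>)) \<tau> (A * \<psi>)"
  have A: "A \<ge> 67108864" unfolding A_def using \<eta> by (simp add: le_divide_eq)
  have K1: "K \<ge> 8589934592" "K \<ge> 128 * A"
  proof -
    have "8589934592 / \<eta> \<ge> (8589934592 :: real)" using \<eta> by (simp add: le_divide_eq)
    then show "K \<ge> 8589934592" using K by linarith
    show "K \<ge> 128 * A" using K by (simp add: A_def)
  qed
  have err1: "\<P>(x in mvn p (\<lambda>i\<in>{..<p}. 0) (cov \<gamma>). \<phi> x = 1) \<le> \<eta> / 2"
  proof -
    have "\<P>(x in mvn p (\<lambda>i\<in>{..<p}. 0) (cov \<gamma>). \<phi> x = 1) \<le> 8388608 * (real p * exp (- \<tau> / 512)) / (A * \<psi>)\<^sup>2"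
      unfolding \<phi>_def using A \<psi>(1) by (intro type_one_error m \<gamma>) auto
    also have "\<dots> \<le> 8388608 * (3 * \<psi>\<^sup>2) / (A * \<psi>)\<^sup>2"
      using \<psi>(3) by (intro divide_right_mono mult_left_mono) auto
    also have "\<dots> = 25165824 / A\<^sup>2"
      using \<psi>(1) by (simp add: power_mult_distrib)
    also have "\<dots> \<le> 25165824 / A"
      using A by (intro divide_left_mono) (auto simp: power2_eq_square)
    also have "\<dots> \<le> \<eta> / 2" using \<eta> by (simp add: A_def)
    finally show ?thesis .
  qed
  have err2: "\<P>(x in mvn p \<theta> (cov \<gamma>). \<phi> x = 0) \<le> \<eta> / 2" if \<theta>: "\<theta> \<in> sparse_alt p s \<epsilon>" for \<theta>
  proof -
    define E where "E = (\<Sum>i<p. (\<theta> i)\<^sup>2) / (1 - \<gamma>)"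
    have card: "card {i \<in> {..<p}. \<theta> i \<noteq> 0} \<le> s" and "L2_set \<theta> {..<p} \<ge> \<epsilon>"
      using \<theta> by (auto simp: sparse_alt_def)
    then have "\<epsilon>\<^sup>2 \<le> (L2_set \<theta> {..<p})\<^sup>2" using \<epsilon> by (intro power_mono) auto
    also have "\<dots> = (\<Sum>i<p. (\<theta> i)\<^sup>2)" by (simp add: L2_set_def sum_nonneg)
    finally have "K * \<psi> * (1 - \<gamma>) \<le> (\<Sum>i<p. (\<theta> i)\<^sup>2)" using \<epsilon>(2) by (simp add: mult_ac)
    then have EK: "E \<ge> K * \<psi>" using \<gamma> by (simp add: E_def le_divide_eq)
    have \<psi>0: "\<psi> > 0" using \<psi>(1) by linarith
    have K0: "K > 0" using K1 by linarith
    have KA: "K * \<psi> \<ge> 128 * A * \<psi>" and KB: "K * \<psi> \<ge> 8589934592 * \<psi>"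
      using K1 \<psi>0 by (auto intro!: mult_right_mono)
    have Epos: "E > 0" using EK mult_pos_pos[OF K0 \<psi>0] by linarith
    have "A * \<psi> > 0" using A \<psi>0 by simp
    then have l1: "A * \<psi> \<le> E / 8" using KA EK by linarith
    have l2: "real s * \<tau> \<le> E / 4" using KB EK \<psi>(2) \<psi>0 by linarith
    have "\<P>(x in mvn p \<theta> (cov \<gamma>). \<phi> x = 0) \<le> 536870912 * (E + real p * exp (- \<tau> / 512)) / E\<^sup>2"
      using l1 l2 Epos unfolding \<phi>_def E_def by (rule type_two_error[OF m \<gamma> s(2) \<tau> card])
    also have "\<dots> \<le> 536870912 * (E + 3 * \<psi>\<^sup>2) / E\<^sup>2"
      using \<psi>(3) by (intro divide_right_mono mult_left_mono) auto
    also have "\<dots> = 536870912 * (1 / E + 3 * (\<psi> / E)\<^sup>2)"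
      using Epos by (simp add: power2_eq_square field_simps)
    also have "\<dots> \<le> 536870912 * (2 / K + 3 * (1 / K))"
    proof (intro mult_left_mono add_mono)
      have "K / 2 \<le> K * \<psi>" using K0 \<psi>(1) by (simp add: field_simps)
      then have "K / 2 \<le> E" using EK by linarith
      then have "1 / E \<le> 1 / (K / 2)" using K0 Epos by (intro divide_left_mono) auto
      then show "1 / E \<le> 2 / K" by simp
      have r: "\<psi> / E \<le> 1 / K" using EK K0 Epos by (simp add: field_simps)
      have "1 / K \<le> 1" using K1 by (simp add: divide_le_eq)
      then have "\<psi> / E \<le> 1" using r by linarith
      moreover have "\<psi> / E \<ge> 0" using \<psi>0 Epos by simp
      ultimately have "(\<psi> / E)\<^sup>2 \<le> \<psi> / E" unfolding power2_eq_square by (rule mult_left_le)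
      then show "(\<psi> / E)\<^sup>2 \<le> 1 / K" using r by linarith
    qed auto
    also have "\<dots> = 2684354560 / K" by simp
    also have "\<dots> \<le> \<eta> / 2"
    proof -
      have "K * \<eta> \<ge> 8589934592" using K \<eta> by (simp add: divide_le_eq)
      then show ?thesis using K0 by (simp add: divide_le_eq mult.commute)
    qed
    finally show ?thesis .
  qed
  have \<phi>: "\<phi> \<in> tests p" unfolding \<phi>_def by (rule stat_test_in_tests)
  have ne: "sparse_alt p s \<epsilon> \<noteq> {}"
  proof -
    define \<theta> where "\<theta> = (\<lambda>i\<in>{..<p}. if i = 0 then \<epsilon> else 0)"
    have "{i \<in> {..<p}. \<theta> i \<noteq> 0} \<subseteq> {0}" by (auto simp: \<theta>_def)
    then have "card {i \<in> {..<p}. \<theta> i \<noteq> 0} \<le> card {0 :: nat}" by (intro card_mono) auto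
    then have card: "card {i \<in> {..<p}. \<theta> i \<noteq> 0} \<le> s" using s(1) by simp
    have "(\<Sum>i<p. (\<theta> i)\<^sup>2) = (\<Sum>i<p. if i = 0 then \<epsilon>\<^sup>2 else 0)"
      by (intro sum.cong) (auto simp: \<theta>_def)
    then have "L2_set \<theta> {..<p} \<ge> \<epsilon>" using \<epsilon>(1) p by (simp add: L2_set_def)
    moreover have "\<theta> \<in> Rn p" by (simp add: \<theta>_def Rn_def)
    ultimately have "\<theta> \<in> sparse_alt p s \<epsilon>" using card by (simp add: sparse_alt_def)
    then show ?thesis by auto
  qed
  have bdd: "bdd_below ((\<lambda>\<phi>. \<P>(x in mvn p (\<lambda>i\<in>{..<p}. 0) (cov \<gamma>). \<phi> x = 1)
        + (SUP \<theta>\<in>sparse_alt p s \<epsilon>. \<P>(x in mvn p \<theta> (cov \<gamma>). \<phi> x = 0))) ` tests p)"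
  proof (rule bdd_belowI2[where m = 0])
    fix \<phi>' assume \<phi>': "\<phi>' \<in> tests p"
    obtain \<theta> where "\<theta> \<in> sparse_alt p s \<epsilon>" using ne by auto
    then have "0 \<le> (SUP \<theta>\<in>sparse_alt p s \<epsilon>. \<P>(x in mvn p \<theta> (cov \<gamma>). \<phi>' x = 0))"
      by (rule cSUP_upper2[OF bdd_above_type_two_error[OF \<gamma> \<phi>']]) simp
    then show "0 \<le> \<P>(x in mvn p (\<lambda>i\<in>{..<p}. 0) (cov \<gamma>). \<phi>' x = 1)
        + (SUP \<theta>\<in>sparse_alt p s \<epsilon>. \<P>(x in mvn p \<theta> (cov \<gamma>). \<phi>' x = 0))" by simp
  qed
  have "(INF \<phi>\<in>tests p.
        \<P>(x in mvn p (\<lambda>i\<in>{..<p}. 0) (cov \<gamma>). \<phi> x = 1)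
        + (SUP \<theta>\<in>sparse_alt p s \<epsilon>. \<P>(x in mvn p \<theta> (cov \<gamma>). \<phi> x = 0)))
    \<le> \<P>(x in mvn p (\<lambda>i\<in>{..<p}. 0) (cov \<gamma>). \<phi> x = 1)
        + (SUP \<theta>\<in>sparse_alt p s \<epsilon>. \<P>(x in mvn p \<theta> (cov \<gamma>). \<phi> x = 0))"
    by (rule cINF_lower[OF bdd \<phi>])
  also have "\<dots> \<le> \<eta> / 2 + \<eta> / 2"
    using err1 err2 ne by (intro add_mono cSUP_least) auto
  finally show ?thesis by simp
qed

end

section \<open>The separation rate\<close>

lemma psi1_sq_scale: "psi1_sq p s \<gamma> = (1 - \<gamma>) * psi1_sq p s 0"
  by (simp add: psi1_sq_def)

lemma testing_risk_labelled:
  assumes "equal_groups p R B"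
  shows "\<exists>g. labelled_groups p R (p div R) g \<and>
    (\<forall>s \<gamma> \<epsilon>. testing_risk p s \<gamma> R B \<epsilon> = (INF \<phi>\<in>tests p.
        \<P>(x in mvn p (\<lambda>i\<in>{..<p}. 0) (labelled_groups.cov p g \<gamma>). \<phi> x = 1)
        + (SUP \<theta>\<in>sparse_alt p s \<epsilon>. \<P>(x in mvn p \<theta> (labelled_groups.cov p g \<gamma>). \<phi> x = 0))))"
proof -
  obtain g where g: "\<And>i. i < p \<Longrightarrow> g i < R" "\<And>k. k < R \<Longrightarrow> B k = {i \<in> {..<p}. g i = k}"
    "\<And>k. k < R \<Longrightarrow> card {i \<in> {..<p}. g i = k} = p div R"
    by (rule equal_groups_labelling[OF assms]) blast
  interpret labelled_groups p R "p div R" g using g by unfold_locales auto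
  have "labelled_groups p R (p div R) g" by unfold_locales
  then show ?thesis
    by (intro exI[of _ g]) (simp add: testing_risk_def P_law_def group_cov_eq_cov[OF g(2)])
qed

lemma ln_sparse_ge:
  assumes "1 \<le> s" "real s \<le> sqrt (real p)"
  shows "ln (1 + real p / (real s)\<^sup>2) \<ge> 2 / 3"
proof -
  have "(real s)\<^sup>2 \<le> (sqrt (real p))\<^sup>2" using assms by (intro power_mono) auto
  then have "1 \<le> real p / (real s)\<^sup>2" using assms(1) by (simp add: le_divide_eq)
  then have "ln 2 \<le> ln (1 + real p / (real s)\<^sup>2)" by simp
  then show ?thesis using ln2_ge_two_thirds by linarith
qed

text \<open>
  The threshold \<open>\<tau>\<close> is \<open>512 * ln (1 + p / s\<^sup>2)\<close> for \<open>s < sqrt p\<close>, which makes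
  \<open>p * exp (- \<tau> / 512)\<close> at most \<open>s\<^sup>2\<close>, and \<open>0\<close> otherwise.
\<close>

lemma threshold_exists:
  assumes p: "p > 0" and s: "1 \<le> s"
  shows "\<exists>\<tau>\<ge>0. 1 / 2 \<le> psi1_sq p s 0 \<and> real s * \<tau> \<le> 512 * psi1_sq p s 0
    \<and> real p * exp (- \<tau> / 512) \<le> 3 * (psi1_sq p s 0)\<^sup>2"
proof (cases "real s < sqrt (real p)")
  case True
  define L where "L = ln (1 + real p / (real s)\<^sup>2)"
  have L: "L \<ge> 2 / 3" unfolding L_def using True s by (intro ln_sparse_ge) auto
  have \<psi>: "psi1_sq p s 0 = real s * L" using True by (simp add: psi1_sq_def L_def)
  have "2 / 3 \<le> 1 * L" using L by simp
  also have "\<dots> \<le> real s * L" using s L by (intro mult_right_mono) auto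
  finally have 1: "1 / 2 \<le> real s * L" by linarith
  have pos: "1 + real p / (real s)\<^sup>2 > 0" by (intro add_pos_nonneg) auto
  have "real p * exp (- (512 * L) / 512) = real p / (1 + real p / (real s)\<^sup>2)"
    using pos by (simp add: L_def exp_minus field_simps)
  also have "\<dots> \<le> (real s)\<^sup>2"
  proof -
    have "(real s)\<^sup>2 * (1 + real p / (real s)\<^sup>2) = (real s)\<^sup>2 + real p"
      using s by (simp add: distrib_left)
    then show ?thesis using pos by (simp add: divide_le_eq)
  qed
  also have "\<dots> \<le> (real s)\<^sup>2 * (3 * L\<^sup>2)"
  proof -
    have "(2 / 3)\<^sup>2 \<le> L\<^sup>2" using L by (intro power_mono) auto
    then have "1 \<le> 3 * L\<^sup>2" by (simp add: power2_eq_square)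
    then show ?thesis by (metis mult.right_neutral mult_left_mono zero_le_power2)
  qed
  finally have "real p * exp (- (512 * L) / 512) \<le> 3 * (real s * L)\<^sup>2"
    by (simp add: power_mult_distrib mult_ac)
  then show ?thesis using 1 L unfolding \<psi> by (intro exI[of _ "512 * L"]) auto
next
  case False
  then have \<psi>: "psi1_sq p s 0 = sqrt (real p)" by (simp add: psi1_sq_def)
  have "sqrt (real p) \<ge> 1" using p by simp
  then have "1 / 2 \<le> sqrt (real p)" by linarith
  then show ?thesis unfolding \<psi> by (intro exI[of _ 0]) auto
qed

text \<open>
  The sparsity \<open>n\<close> of the prior is \<open>s\<close> for \<open>s < sqrt p\<close>, and the integer part of \<open>sqrt p\<close>
  otherwise.
\<close>

lemma effective_sparsity_exists:
  assumes p: "p > 0" and s: "1 \<le> s" and \<gamma>: "\<gamma> < 1"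
  shows "\<exists>n\<ge>1. n * n \<le> p \<and> n \<le> s
    \<and> psi1_sq p s \<gamma> \<le> 4 * ((1 - \<gamma>) * real n * ln (1 + real p / (real n)\<^sup>2))"
proof (cases "real s < sqrt (real p)")
  case True
  have "(real s)\<^sup>2 \<le> (sqrt (real p))\<^sup>2" using True by (intro power_mono) auto
  then have "real (s * s) \<le> real p" by (simp add: power2_eq_square)
  then have "s * s \<le> p" by (simp only: of_nat_le_iff)
  moreover have "ln (1 + real p / (real s)\<^sup>2) \<ge> 0" by simp
  ultimately show ?thesis
    using True s \<gamma> by (intro exI[of _ s]) (auto simp: psi1_sq_def)
next
  case False
  define n where "n = nat \<lfloor>sqrt (real p)\<rfloor>"
  have p1: "sqrt (real p) \<ge> 1" using p by simp
  have n1: "n \<ge> 1" using p1 unfolding n_def by (simp add: le_nat_iff)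
  have n2: "real n \<le> sqrt (real p)" and n3: "sqrt (real p) < real n + 1"
    using p1 unfolding n_def by (auto simp: of_nat_nat)
  have "(real n)\<^sup>2 \<le> (sqrt (real p))\<^sup>2" using n2 by (intro power_mono) auto
  then have "real (n * n) \<le> real p" by (simp add: power2_eq_square)
  then have nn: "n * n \<le> p" by (simp only: of_nat_le_iff)
  have "real n \<le> real s" using n2 False by linarith
  then have ns: "n \<le> s" by simp
  define L where "L = ln (1 + real p / (real n)\<^sup>2)"
  have L: "L \<ge> 2 / 3" unfolding L_def by (rule ln_sparse_ge[OF n1 n2])
  \<comment> \<open>This and \<open>L \<ge> 2 / 3\<close> account for the factor \<open>4\<close>.\<close>
  have "sqrt (real p) \<le> 2 * real n" using n1 n3 by linarith
  also have "\<dots> \<le> real n * (4 * L)"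
    using L by (simp add: mult.commute[of 2] mult_left_mono)
  finally have "(1 - \<gamma>) * sqrt (real p) \<le> (1 - \<gamma>) * (real n * (4 * L))"
    using \<gamma> by (intro mult_left_mono) auto
  then have "psi1_sq p s \<gamma> \<le> 4 * ((1 - \<gamma>) * real n * L)"
    using False by (simp add: psi1_sq_def mult_ac)
  then show ?thesis using n1 nn ns unfolding L_def by blast
qed

theorem theorem4:
  shows "minimax_separation_rate
           (\<lambda>p s \<gamma> R. R \<in> {1..p} \<and> R dvd p \<and> 1 \<le> s \<and> real s \<le> real p / (4 * real R)
                       \<and> 0 \<le> \<gamma> \<and> \<gamma> < 1)
           (\<lambda>p s \<gamma> R. sqrt (psi1_sq p s \<gamma>))"
  unfolding minimax_separation_rate_def
proof (intro conjI ballI)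
  fix \<eta> :: real assume "\<eta> \<in> {0<..<1}"
  then have \<eta>: "0 < \<eta>" "\<eta> < 1" by auto
  show "\<exists>C\<^sub>\<eta>>0. \<forall>p s \<gamma> R B. R \<in> {1..p} \<and> R dvd p \<and> 1 \<le> s \<and> real s \<le> real p / (4 * real R)
      \<and> 0 \<le> \<gamma> \<and> \<gamma> < 1 \<longrightarrow> equal_groups p R B \<longrightarrow>
      (\<forall>C>C\<^sub>\<eta>. testing_risk p s \<gamma> R B (C * sqrt (psi1_sq p s \<gamma>)) \<le> \<eta>)"
  proof (intro exI[of _ "8589934592 / \<eta>"] conjI allI impI; (elim conjE)?)
    show "0 < 8589934592 / \<eta>" using \<eta> by simp
    fix p s :: nat and \<gamma> :: real and R :: nat and B :: "nat \<Rightarrow> nat set" and C :: real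
    assume R: "R \<in> {1..p}" "R dvd p" and s: "1 \<le> s" "real s \<le> real p / (4 * real R)"
      and \<gamma>: "0 \<le> \<gamma>" "\<gamma> < 1" and B: "equal_groups p R B" and C: "8589934592 / \<eta> < C"
    obtain g where g: "labelled_groups p R (p div R) g"
      and risk: "\<And>s \<gamma> \<epsilon>. testing_risk p s \<gamma> R B \<epsilon> = (INF \<phi>\<in>tests p.
        \<P>(x in mvn p (\<lambda>i\<in>{..<p}. 0) (labelled_groups.cov p g \<gamma>). \<phi> x = 1)
        + (SUP \<theta>\<in>sparse_alt p s \<epsilon>. \<P>(x in mvn p \<theta> (labelled_groups.cov p g \<gamma>). \<phi> x = 0)))"
      using testing_risk_labelled[OF B] by blast
    interpret labelled_groups p R "p div R" g by (rule g)
    have p: "p > 0" using R by auto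
    have m: "p div R > 0" using R by (simp add: div_greater_zero_iff)
    have "real p = real R * real (p div R)" using R by (auto simp: real_of_nat_div)
    then have "real p / (4 * real R) = real (p div R) / 4" using R by simp
    then have "4 * real s \<le> real (p div R)" using s(2) by simp
    then have s4: "4 * s \<le> p div R" by linarith
    obtain \<tau> where \<tau>: "\<tau> \<ge> 0" "1 / 2 \<le> psi1_sq p s 0" "real s * \<tau> \<le> 512 * psi1_sq p s 0"
      "real p * exp (- \<tau> / 512) \<le> 3 * (psi1_sq p s 0)\<^sup>2"
      using threshold_exists[OF p s(1)] by auto
    have "8589934592 / \<eta> \<ge> (1 :: real)" using \<eta> by (simp add: le_divide_eq)
    then have C1: "C \<ge> 1" using C by linarith
    have pos: "(1 - \<gamma>) * psi1_sq p s 0 \<ge> 0" using \<gamma> \<tau>(2) by (intro mult_nonneg_nonneg) auto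
    \<comment> \<open>Since \<open>C \<ge> 1\<close>, the upper bound applies with \<open>K = C\<close> instead of \<open>C\<^sup>2\<close>.\<close>
    have "C * ((1 - \<gamma>) * psi1_sq p s 0) \<le> C\<^sup>2 * ((1 - \<gamma>) * psi1_sq p s 0)"
      using C1 pos by (intro mult_right_mono) (auto simp: power2_eq_square)
    also have "\<dots> = (C * sqrt (psi1_sq p s \<gamma>))\<^sup>2"
      using pos unfolding psi1_sq_scale[of p s \<gamma>] by (simp only: power_mult_distrib real_sqrt_pow2)
    finally have "C * ((1 - \<gamma>) * psi1_sq p s 0) \<le> (C * sqrt (psi1_sq p s \<gamma>))\<^sup>2" .
    moreover have "0 \<le> C * sqrt (psi1_sq p s \<gamma>)"
      using C1 pos unfolding psi1_sq_scale[of p s \<gamma>] by simp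
    ultimately show "testing_risk p s \<gamma> R B (C * sqrt (psi1_sq p s \<gamma>)) \<le> \<eta>"
      unfolding risk using C by (intro risk_upper_bound[OF p m \<gamma> s(1) s4 \<tau> \<eta>]) auto
  qed
next
  fix \<eta> :: real assume "\<eta> \<in> {0<..<1}"
  then have \<eta>: "0 < \<eta>" "\<eta> < 1" by auto
  show "\<exists>c\<^sub>\<eta>>0. \<forall>p s \<gamma> R B. R \<in> {1..p} \<and> R dvd p \<and> 1 \<le> s \<and> real s \<le> real p / (4 * real R)
      \<and> 0 \<le> \<gamma> \<and> \<gamma> < 1 \<longrightarrow> equal_groups p R B \<longrightarrow>
      (\<forall>c. 0 < c \<and> c < c\<^sub>\<eta> \<longrightarrow> testing_risk p s \<gamma> R B (c * sqrt (psi1_sq p s \<gamma>)) \<ge> 1 - \<eta>)"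
  proof (intro exI[of _ "\<eta> / 4"] conjI allI impI; (elim conjE)?)
    show "0 < \<eta> / 4" using \<eta> by simp
    fix p s :: nat and \<gamma> :: real and R :: nat and B :: "nat \<Rightarrow> nat set" and c :: real
    assume R: "R \<in> {1..p}" and s: "1 \<le> s"
      and \<gamma>: "0 \<le> \<gamma>" "\<gamma> < 1" and B: "equal_groups p R B" and c: "0 < c" "c < \<eta> / 4"
    obtain g where g: "labelled_groups p R (p div R) g"
      and risk: "\<And>s \<gamma> \<epsilon>. testing_risk p s \<gamma> R B \<epsilon> = (INF \<phi>\<in>tests p.
        \<P>(x in mvn p (\<lambda>i\<in>{..<p}. 0) (labelled_groups.cov p g \<gamma>). \<phi> x = 1)
        + (SUP \<theta>\<in>sparse_alt p s \<epsilon>. \<P>(x in mvn p \<theta> (labelled_groups.cov p g \<gamma>). \<phi> x = 0)))"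
      using testing_risk_labelled[OF B] by blast
    interpret labelled_groups p R "p div R" g by (rule g)
    have p: "p > 0" using R by auto
    obtain n where n: "1 \<le> n" "n * n \<le> p" "n \<le> s"
      and \<psi>: "psi1_sq p s \<gamma> \<le> 4 * ((1 - \<gamma>) * real n * ln (1 + real p / (real n)\<^sup>2))"
      using effective_sparsity_exists[OF p s \<gamma>(2)] by auto
    have \<epsilon>: "c * sqrt (psi1_sq p s \<gamma>) \<le> \<eta> / 2 * sqrt ((1 - \<gamma>) * real n * ln (1 + real p / (real n)\<^sup>2))"
    proof -
      let ?X = "(1 - \<gamma>) * real n * ln (1 + real p / (real n)\<^sup>2)"
      have "sqrt (psi1_sq p s \<gamma>) \<le> sqrt (4 * ?X)" using \<psi> by (rule real_sqrt_le_mono)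
      also have "\<dots> = 2 * sqrt ?X" by (simp only: real_sqrt_mult real_sqrt_four)
      finally have "c * sqrt (psi1_sq p s \<gamma>) \<le> c * (2 * sqrt ?X)" using c by (intro mult_left_mono) auto
      also have "\<dots> = (2 * c) * sqrt ?X" by simp
      also have "\<dots> \<le> \<eta> / 2 * sqrt ?X"
        using c \<gamma> by (intro mult_right_mono) auto
      finally show ?thesis .
    qed
    have "1 - \<eta> = 1 - 2 * (\<eta> / 2)" by simp
    also have "\<dots> \<le> testing_risk p s \<gamma> R B (c * sqrt (psi1_sq p s \<gamma>))"
      unfolding risk
    proof (rule cINF_greatest)
      show "tests p \<noteq> {}" using stat_test_in_tests by blast
    next
      fix \<phi> assume "\<phi> \<in> tests p"
      then show "1 - 2 * (\<eta> / 2) \<le> \<P>(x in mvn p (\<lambda>i\<in>{..<p}. 0) (cov \<gamma>). \<phi> x = 1)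
          + (SUP \<theta>\<in>sparse_alt p s (c * sqrt (psi1_sq p s \<gamma>)). \<P>(x in mvn p \<theta> (cov \<gamma>). \<phi> x = 0))"
        using \<eta> \<epsilon> by (intro risk_lower_bound[OF \<gamma> n]) auto
    qed
    finally show "1 - \<eta> \<le> testing_risk p s \<gamma> R B (c * sqrt (psi1_sq p s \<gamma>))" .
  qed
qed

end
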